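(* Assume the setting and hypotheses (A1)–(A3) in the context, and assume that $\eta$ and $h$ are bounded uniformly in $\omega\in\Omega_0$ in the norms of ${\rm C}^{0,4}_b([0,T]\times\mathbb{R}^n)$ and ${\rm C}^2_b(\mathbb{R}^n)$, respectively. Let \[F(t,x,y)=f(t,x,y+\eta(t,x))+\nu\Delta\eta(t,x)-(y+\eta(t,x),\nabla)\eta(t,x).\] Then there exists a unique $\mathcal{F}^B_{T-t}$-adapted solution $\bar y$ of the backward equation \[ \bar y(t,x)=h(x)+\int_t^T\big[\nu\Delta\bar y(s,x)-(\bar\eta(s,x)+\bar y(s,x),\nabla)\bar y(s,x)+\bar F(s,x,\bar y(s,x))\big]ds,\quad (t,x)\in[0,T]\times\mathbb{R}^n, \] where $\bar\eta(t,x)=\eta(T-t,x)$, $\bar F(t,x,y)=F(T-t,x,y)$, which belongs to class ${\rm C}^{1,2}_b([0,T]\times\mathbb{R}^n)$ for all $\omega\in\Omega_0$.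
   Context: Fix $T>0$, $n,d\ge1$, $\nu>0$, $\beta\in(0,1)$. $(\Omega,\mathcal{F},\mathbb{P})$ carries a $d$-dimensional Brownian motion $B_t$; $\mathcal{F}_0$ is independent of the natural filtration of $B$; $\mathcal{F}^B_t=\sigma\{B_s,s\le t\}\vee\mathcal{F}_0\vee\mathcal{N}$. $(u,\nabla)v=\sum_ju_j\partial_{x_j}v$. ${\rm C}^{\frac\beta2,l}_b$: functions bounded and continuous with their spatial derivatives up to order $l$, $\frac\beta2$-Hölder in $t$ uniformly in space; ${\rm C}^{0,l}_b$ same without the Hölder condition; ${\rm C}^{1,2}_b$: bounded with bounded continuous $\partial_t$ and spatial derivatives up to order 2; ${\rm C}^{2+\beta}_b(\mathbb{R}^n)$: ${\rm C}^2_b$ with $\beta$-Hölder (on scales $<1$) second derivatives. (A1) $f$ deterministic, of class ${\rm C}^{\frac\beta2,2}_b([0,T]\times\mathbb{R}^{2n})$, $|f(t,x,y)|\le L(1+|y|)$, $|f(t,x,y)-f(t,x,y')|\le L|y-y'|$, first and second derivatives in $x,y$ bounded on $[0,T]\times\mathbb{R}^n\times[-D,D]^n$ for each $D>0$, $f(0,\cdot,0)$ compactly supported. (A2) $g=(g_1,\dots,g_d)$ $\mathcal{F}^B_t$-adapted, $H^k(\mathbb{R}^{d\times n})$-valued, $k=[\frac n2]+5$, $\mathbb{E}\int_0^T\|g(s,\cdot)\|^p_{H^k}ds<\infty$ for some $p>\frac4{1-\beta}$. (A3) each $h(x)$ is $\mathcal{F}_0$-measurable and $h(\cdot,\omega)\in{\rm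 C}^{2+\beta}_b(\mathbb{R}^n)$ for all $\omega$. $\eta(t,x)$ is a version of $\int_0^tg(s,x)dB_s$ and $\Omega_0$ is a full-measure set on which $\eta\in{\rm C}^{\frac\beta2,4}_b([0,T]\times\mathbb{R}^n)$. *)

theory Defs
  imports "HOL-Probability.Probability"
begin

definition pd :: "'a::euclidean_space \<Rightarrow> ('a \<Rightarrow> real) \<Rightarrow> 'a \<Rightarrow> real" where
  "pd b u x = deriv (\<lambda>r. u (x + r *\<^sub>R b)) 0"

fun Dl :: "'a::euclidean_space list \<Rightarrow> ('a \<Rightarrow> real) \<Rightarrow> 'a \<Rightarrow> real" where
  "Dl [] u = u"
| "Dl (b # bs) u = pd b (Dl bs u)"

definition lap :: "('a::euclidean_space \<Rightarrow> 'a) \<Rightarrow> 'a \<Rightarrow> 'a" where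
  "lap u x = (\<Sum>c\<in>Basis. (\<Sum>b\<in>Basis. Dl [b, b] (\<lambda>z. u z \<bullet> c) x) *\<^sub>R c)"

definition adv :: "'a::euclidean_space \<Rightarrow> ('a \<Rightarrow> 'a) \<Rightarrow> 'a \<Rightarrow> 'a" where
  "adv w v x = (\<Sum>c\<in>Basis. (\<Sum>b\<in>Basis. (w \<bullet> b) * Dl [b] (\<lambda>z. v z \<bullet> c) x) *\<^sub>R c)"

definition C0l_b :: "nat \<Rightarrow> real \<Rightarrow> (real \<Rightarrow> 'a::euclidean_space \<Rightarrow> 'b::euclidean_space) \<Rightarrow> bool" where
  "C0l_b l T u \<longleftrightarrow>
    (\<forall>c\<in>Basis. \<forall>bs. set bs \<subseteq> Basis \<and> length bs \<le> l \<longrightarrow>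
       (length bs < l \<longrightarrow> (\<forall>t\<in>{0..T}. \<forall>x. \<forall>b\<in>Basis.
          ((\<lambda>r. Dl bs (\<lambda>z. u t z \<bullet> c) (x + r *\<^sub>R b)) has_real_derivative
             Dl (b # bs) (\<lambda>z. u t z \<bullet> c) x) (at 0)))
       \<and> continuous_on ({0..T} \<times> UNIV) (\<lambda>(t, x). Dl bs (\<lambda>z. u t z \<bullet> c) x)
       \<and> bounded ((\<lambda>(t, x). Dl bs (\<lambda>z. u t z \<bullet> c) x) ` ({0..T} \<times> UNIV)))"

definition holder_t :: "real \<Rightarrow> real \<Rightarrow> (real \<Rightarrow> 'a \<Rightarrow> 'b::real_normed_vector) \<Rightarrow> bool" where
  "holder_t a T u \<longleftrightarrow> (\<exists>C. \<forall>t\<in>{0..T}. \<forall>s\<in>{0..T}. \<forall>x. norm (u t x - u s x) \<le> C * \<bar>t - s\<bar> powr a)"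

definition Cbl_b :: "real \<Rightarrow> nat \<Rightarrow> real \<Rightarrow> (real \<Rightarrow> 'a::euclidean_space \<Rightarrow> 'b::euclidean_space) \<Rightarrow> bool" where
  "Cbl_b \<beta> l T u \<longleftrightarrow> C0l_b l T u \<and> holder_t (\<beta> / 2) T u"

definition C12_b :: "real \<Rightarrow> (real \<Rightarrow> 'a::euclidean_space \<Rightarrow> 'b::euclidean_space) \<Rightarrow> bool" where
  "C12_b T u \<longleftrightarrow> C0l_b 2 T u \<and>
    (\<exists>ut. (\<forall>t\<in>{0..T}. \<forall>x. ((\<lambda>s. u s x) has_vector_derivative ut t x) (at t within {0..T}))
        \<and> continuous_on ({0..T} \<times> UNIV) (\<lambda>(t, x). ut t x)
        \<and> bounded ((\<lambda>(t, x). ut t x) ` ({0..T} \<times> UNIV)))"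

definition Cl_b :: "nat \<Rightarrow> ('a::euclidean_space \<Rightarrow> 'b::euclidean_space) \<Rightarrow> bool" where
  "Cl_b l u \<longleftrightarrow>
    (\<forall>c\<in>Basis. \<forall>bs. set bs \<subseteq> Basis \<and> length bs \<le> l \<longrightarrow>
       (length bs < l \<longrightarrow> (\<forall>x. \<forall>b\<in>Basis.
          ((\<lambda>r. Dl bs (\<lambda>z. u z \<bullet> c) (x + r *\<^sub>R b)) has_real_derivative
             Dl (b # bs) (\<lambda>z. u z \<bullet> c) x) (at 0)))
       \<and> continuous_on UNIV (Dl bs (\<lambda>z. u z \<bullet> c))
       \<and> bounded (range (Dl bs (\<lambda>z. u z \<bullet> c))))"

definition C2beta_b :: "real \<Rightarrow> ('a::euclidean_space \<Rightarrow> 'b::euclidean_space) \<Rightarrow> bool" where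
  "C2beta_b \<beta> u \<longleftrightarrow> Cl_b 2 u \<and>
    (\<forall>c\<in>Basis. \<forall>bs. set bs \<subseteq> Basis \<and> length bs = 2 \<longrightarrow>
       (\<exists>C. \<forall>x y. dist x y < 1 \<longrightarrow>
          \<bar>Dl bs (\<lambda>z. u z \<bullet> c) x - Dl bs (\<lambda>z. u z \<bullet> c) y\<bar> \<le> C * dist x y powr \<beta>))"

definition test_fun :: "('a::euclidean_space \<Rightarrow> real) \<Rightarrow> bool" where
  "test_fun \<phi> \<longleftrightarrow> (\<exists>K. compact K \<and> (\<forall>x. x \<notin> K \<longrightarrow> \<phi> x = 0)) \<and>
    (\<forall>bs. set bs \<subseteq> Basis \<longrightarrow> continuous_on UNIV (Dl bs \<phi>) \<and>
       (\<forall>b\<in>Basis. \<forall>x. ((\<lambda>r. Dl bs \<phi> (x + r *\<^sub>R b)) has_real_derivative Dl (b # bs) \<phi> x) (at 0)))"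

definition L2fun :: "('a::euclidean_space \<Rightarrow> real) \<Rightarrow> bool" where
  "L2fun u \<longleftrightarrow> u \<in> borel_measurable lborel \<and> integrable lborel (\<lambda>x. (u x)\<^sup>2)"

definition weak_deriv :: "'a::euclidean_space list \<Rightarrow> ('a \<Rightarrow> real) \<Rightarrow> ('a \<Rightarrow> real) \<Rightarrow> bool" where
  "weak_deriv bs u v \<longleftrightarrow> (\<forall>\<phi>. test_fun \<phi> \<longrightarrow>
     integrable lborel (\<lambda>x. u x * Dl bs \<phi> x) \<and> integrable lborel (\<lambda>x. v x * \<phi> x) \<and>
     (\<integral>x. u x * Dl bs \<phi> x \<partial>lborel) = (-1) ^ length bs * (\<integral>x. v x * \<phi> x \<partial>lborel))"

definition in_Hk :: "nat \<Rightarrow> ('a::euclidean_space \<Rightarrow> real) \<Rightarrow> bool" where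
  "in_Hk k u \<longleftrightarrow> L2fun u \<and>
     (\<forall>bs. set bs \<subseteq> Basis \<and> length bs \<le> k \<longrightarrow> (\<exists>v. L2fun v \<and> weak_deriv bs u v))"

definition Hk_norm :: "nat \<Rightarrow> ('a::euclidean_space \<Rightarrow> real) \<Rightarrow> real" where
  "Hk_norm k u = sqrt (\<Sum>bs\<in>{bs. set bs \<subseteq> Basis \<and> length bs \<le> k}.
      \<integral>x. ((SOME v. L2fun v \<and> weak_deriv bs u v) x)\<^sup>2 \<partial>lborel)"

definition in_Hk_vec :: "nat \<Rightarrow> ('a::euclidean_space \<Rightarrow> 'b::euclidean_space) \<Rightarrow> bool" where
  "in_Hk_vec k U \<longleftrightarrow> (\<forall>c\<in>Basis. in_Hk k (\<lambda>x. U x \<bullet> c))"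

definition Hk_norm_vec :: "nat \<Rightarrow> ('a::euclidean_space \<Rightarrow> 'b::euclidean_space) \<Rightarrow> real" where
  "Hk_norm_vec k U = sqrt (\<Sum>c\<in>Basis. (Hk_norm k (\<lambda>x. U x \<bullet> c))\<^sup>2)"

definition gen_sets :: "'w measure \<Rightarrow> ('w \<Rightarrow> 'b::topological_space) \<Rightarrow> 'w set set" where
  "gen_sets M X = {X -` A \<inter> space M | A. A \<in> sets borel}"

definition nat_sigma :: "'w measure \<Rightarrow> (real \<Rightarrow> 'w \<Rightarrow> 'b::topological_space) \<Rightarrow> real set \<Rightarrow> 'w set set" where
  "nat_sigma M B I = sigma_sets (space M) (\<Union>r\<in>I. gen_sets M (B r))"

definition brownian_motion :: "'w measure \<Rightarrow> (real \<Rightarrow> 'w \<Rightarrow> real^'d) \<Rightarrow> bool" where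
  "brownian_motion M B \<longleftrightarrow>
     (\<forall>t\<ge>0. B t \<in> borel_measurable M) \<and>
     (\<forall>\<omega>\<in>space M. B 0 \<omega> = 0 \<and> continuous_on {0..} (\<lambda>t. B t \<omega>)) \<and>
     (\<forall>s t. 0 \<le> s \<longrightarrow> s < t \<longrightarrow>
        (\<forall>j. distributed M lborel (\<lambda>\<omega>. (B t \<omega> - B s \<omega>) $ j)
                (\<lambda>x. ennreal (normal_density 0 (sqrt (t - s)) x))) \<and>
        prob_space.indep_vars M (\<lambda>_. borel) (\<lambda>j \<omega>. (B t \<omega> - B s \<omega>) $ j) UNIV \<and>
        prob_space.indep_set M (gen_sets M (\<lambda>\<omega>. B t \<omega> - B s \<omega>)) (nat_sigma M B {0..s}))"

definition FB :: "'w measure \<Rightarrow> (real \<Rightarrow> 'w \<Rightarrow> 'b::topological_space) \<Rightarrow> 'w set set \<Rightarrow> real \<Rightarrow> 'w set set" where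
  "FB M B F0 t = sigma_sets (space M) ((\<Union>r\<in>{0..t}. gen_sets M (B r)) \<union> F0 \<union> null_sets M)"

definition simple_adapted ::
  "'w measure \<Rightarrow> (real \<Rightarrow> 'w set set) \<Rightarrow> nat \<Rightarrow> (nat \<Rightarrow> real) \<Rightarrow> (nat \<Rightarrow> 'w \<Rightarrow> real^'d) \<Rightarrow> real \<Rightarrow> bool" where
  "simple_adapted M Fl N tt \<xi> t \<longleftrightarrow> tt 0 = 0 \<and> tt N = t \<and> (\<forall>k<N. tt k < tt (Suc k)) \<and>
     (\<forall>k<N. \<xi> k \<in> measurable (sigma (space M) (Fl (tt k))) borel \<and>
            (\<exists>C. \<forall>\<omega>\<in>space M. norm (\<xi> k \<omega>) \<le> C))"

definition simple_val :: "nat \<Rightarrow> (nat \<Rightarrow> real) \<Rightarrow> (nat \<Rightarrow> 'w \<Rightarrow> real^'d) \<Rightarrow> real \<Rightarrow> 'w \<Rightarrow> real^'d" where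
  "simple_val N tt \<xi> s \<omega> = (\<Sum>k<N. indicator {tt k<..tt (Suc k)} s *\<^sub>R \<xi> k \<omega>)"

definition simple_int :: "(real \<Rightarrow> 'w \<Rightarrow> real^'d) \<Rightarrow> nat \<Rightarrow> (nat \<Rightarrow> real) \<Rightarrow> (nat \<Rightarrow> 'w \<Rightarrow> real^'d) \<Rightarrow> 'w \<Rightarrow> real" where
  "simple_int B N tt \<xi> \<omega> = (\<Sum>k<N. \<xi> k \<omega> \<bullet> (B (tt (Suc k)) \<omega> - B (tt k) \<omega>))"

definition ito_version ::
  "'w measure \<Rightarrow> (real \<Rightarrow> 'w \<Rightarrow> real^'d) \<Rightarrow> (real \<Rightarrow> 'w set set) \<Rightarrow> (real \<Rightarrow> 'w \<Rightarrow> real^'d) \<Rightarrow> real \<Rightarrow> ('w \<Rightarrow> real) \<Rightarrow> bool" where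
  "ito_version M B Fl \<phi> t X \<longleftrightarrow> X \<in> borel_measurable M \<and>
     (\<exists>N tt \<xi>. (\<forall>m. simple_adapted M Fl (N m) (tt m) (\<xi> m) t) \<and>
        (\<lambda>m. \<integral>\<^sup>+\<omega>. (\<integral>\<^sup>+s. ennreal (indicator {0..t} s *
              (norm (simple_val (N m) (tt m) (\<xi> m) s \<omega> - \<phi> s \<omega>))\<^sup>2) \<partial>lborel) \<partial>M) \<longlonglongrightarrow> 0 \<and>
        (\<lambda>m. \<integral>\<^sup>+\<omega>. ennreal ((simple_int B (N m) (tt m) (\<xi> m) \<omega> - X \<omega>)\<^sup>2) \<partial>M) \<longlonglongrightarrow> 0)"

definition Fterm :: "(real \<Rightarrow> 'a \<Rightarrow> 'a \<Rightarrow> 'a) \<Rightarrow> real \<Rightarrow> (real \<Rightarrow> 'a::euclidean_space \<Rightarrow> 'a) \<Rightarrow> real \<Rightarrow> 'a \<Rightarrow> 'a \<Rightarrow> 'a" where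
  "Fterm f \<nu> e t x y = f t x (y + e t x) + \<nu> *\<^sub>R lap (e t) x - adv (y + e t x) (e t) x"

definition solves_bw ::
  "real \<Rightarrow> real \<Rightarrow> (real \<Rightarrow> 'a \<Rightarrow> 'a \<Rightarrow> 'a) \<Rightarrow> (real \<Rightarrow> 'a::euclidean_space \<Rightarrow> 'a) \<Rightarrow> ('a \<Rightarrow> 'a) \<Rightarrow> (real \<Rightarrow> 'a \<Rightarrow> 'a) \<Rightarrow> bool" where
  "solves_bw T \<nu> f e h y \<longleftrightarrow>
     (\<forall>t\<in>{0..T}. \<forall>x. y t x = h x + integral {t..T} (\<lambda>s.
         \<nu> *\<^sub>R lap (y s) x - adv (e (T - s) x + y s x) (y s) x + Fterm f \<nu> e (T - s) x (y s x)))"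

definition bw_solution ::
  "'w measure \<Rightarrow> (real \<Rightarrow> 'w \<Rightarrow> real^'d) \<Rightarrow> 'w set set \<Rightarrow> 'w set \<Rightarrow> real \<Rightarrow> real \<Rightarrow>
   (real \<Rightarrow> real^'n \<Rightarrow> real^'n \<Rightarrow> real^'n) \<Rightarrow> (real \<Rightarrow> real^'n \<Rightarrow> 'w \<Rightarrow> real^'n) \<Rightarrow>
   (real^'n \<Rightarrow> 'w \<Rightarrow> real^'n) \<Rightarrow> (real \<Rightarrow> real^'n \<Rightarrow> 'w \<Rightarrow> real^'n) \<Rightarrow> bool" where
  "bw_solution M B F0 \<Omega>0 T \<nu> f \<eta> h y \<longleftrightarrow>
     (\<forall>t\<in>{0..T}. \<forall>x. (\<lambda>\<omega>. y t x \<omega>) \<in> measurable (sigma (space M) (FB M B F0 (T - t))) borel) \<and>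
     (\<forall>\<omega>\<in>\<Omega>0. C12_b T (\<lambda>t x. y t x \<omega>) \<and>
        solves_bw T \<nu> f (\<lambda>t x. \<eta> t x \<omega>) (\<lambda>x. h x \<omega>) (\<lambda>t x. y t x \<omega>))"

end

theory Submission
  imports Defs
begin

text \<open>
  Put $\sigma = \sqrt{2\nu}$ and reverse time. For fixed $\omega$ the forward problem is solved by Picard
  iteration for the mild formulation, with the heat semigroup written as a Gaussian average
  $P_t h(x) = \int h(x + \sigma\sqrt t\, z)\, d\gamma(z)$. After the substitution $s = t(1 - \theta^2)$ the Duhamel
  integral and, by Stein's identity $\int z_b \varphi\, d\gamma = \int \partial_b \varphi\, d\gamma$, its
  first two spatial derivatives are integrals without singularity against a fixed probability measure, and
  differentiating them costs only one spatial derivative of the right-hand side. Hence the iteration closes in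
  $C^2_b$ without Hoelder estimates, and the weights $e^{\lambda t}$ make it converge on all of $[0,T]$, provided
  $u$ is truncated in the coefficients so that the nonlinearity grows linearly in $\nabla u$. The
  maximum principle for $|u|^2$, whose transport term is harmless, bounds $u$ by a constant that does not depend on
  the truncation level nor on $\omega$, so a suitable truncation is inactive. The same principle applied to the
  difference of two solutions gives uniqueness. The iterates are adapted since they are integrals of
  adapted fields over the past, and $\eta(t,x)$ itself is adapted since the filtration contains the null sets.
\<close>

section \<open>Gaussian integration by parts\<close>

text \<open>The obstacle is the second derivative of the Duhamel integral: two derivatives on the
  heat kernel give the non-integrable factor 1/(t-s). Here one derivative goes to the kernel and one
  to the right-hand side. With s = t(1-\<theta>^2) the Jacobian is 2t\<theta>, while a kernel
  derivative costs 1/(\<sigma> sqrt t \<theta>), so \<theta> cancels and a weight of size sqrt t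
  remains. Averaged against e^(-l t \<theta>^2) it is of order 1/sqrt l, uniformly in t, and this
  gain beats any Lipschitz constant. The right-hand side (A(u), \<nabla>)u + H(u), once
  differentiated, is linear in the Hessian but quadratic in the gradient. Hence the bounds come in
  two rounds: first u and its gradient, where the bounded A makes the growth linear, then the
  Hessian with the gradient already bounded. The derivative of the truncation is itself compared at
  two points, hence the class C^{1,1}. Adaptedness is read off the iterates: each is an explicit
  average of data at earlier times, and they converge for every \<omega> in the given full set, so
  the limit inherits it without a measurable choice of solutions.\<close>

definition gauss :: "'a::euclidean_space measure" where
  "gauss = distr (PiM Basis (\<lambda>_. std_normal_distribution)) borel (\<lambda>f. \<Sum>b\<in>Basis. f b *\<^sub>R b)"

lemma gauss_map_measurable [measurable]:
  "(\<lambda>f. \<Sum>b\<in>Basis. f b *\<^sub>R b) \<in> measurable (PiM (Basis::'a::euclidean_space set) (\<lambda>_. std_normal_distribution)) borel"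
  by measurable

lemma prob_space_PiM_std_normal:
  "prob_space (PiM I (\<lambda>_. std_normal_distribution))"
  by (intro prob_space_PiM prob_space_normal_density) auto

lemma prob_space_gauss: "prob_space (gauss :: 'a::euclidean_space measure)"
  unfolding gauss_def by (intro prob_space.prob_space_distr prob_space_PiM_std_normal gauss_map_measurable)

lemma sets_gauss [simp, measurable_cong]: "sets (gauss :: 'a::euclidean_space measure) = sets borel"
  by (simp add: gauss_def)

lemma space_gauss [simp]: "space (gauss :: 'a::euclidean_space measure) = UNIV"
  by (simp add: gauss_def)

lemma integrable_gauss_inner:
  assumes b: "b \<in> Basis"
  shows "integrable gauss (\<lambda>z::'a::euclidean_space. \<bar>z \<bullet> b\<bar>)"
proof -
  let ?M = "\<lambda>_::'a. std_normal_distribution"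
  have "integrable std_normal_distribution (\<lambda>x. \<bar>x\<bar>)"
    using integrable_std_normal_distribution_moment[of 1] by simp
  then have "integrable (distr (PiM Basis ?M) (?M b) (\<lambda>f. f b)) (\<lambda>x. \<bar>x\<bar>)"
    by (subst distr_PiM_component) (auto intro!: prob_space_normal_density b)
  then have "integrable (PiM Basis ?M) (\<lambda>f. \<bar>f b\<bar>)"
    by (subst (asm) integrable_distr_eq) (use b in auto)
  moreover have "(\<Sum>c\<in>Basis. f c *\<^sub>R c) \<bullet> b = f b" for f :: "'a \<Rightarrow> real"
    using b by simp
  ultimately show ?thesis
    unfolding gauss_def by (subst integrable_distr_eq) (auto intro!: borel_measurable_abs)
qed

lemma integrable_gauss_norm: "integrable gauss (\<lambda>z::'a::euclidean_space. norm z)"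
proof (rule Bochner_Integration.integrable_bound)
  show "integrable gauss (\<lambda>z::'a. \<Sum>b\<in>Basis. \<bar>z \<bullet> b\<bar>)"
    by (intro Bochner_Integration.integrable_sum integrable_gauss_inner)
  show "AE z::'a in gauss. norm (norm z) \<le> norm (\<Sum>b\<in>Basis. \<bar>z \<bullet> b\<bar>)"
    by (auto simp: norm_le_l1 intro!: AE_I2 order_trans[OF norm_le_l1])
qed simp

text \<open>The density n satisfies n'(y) = -y n(y), so the difference of the two integrands,
  weighted by n, is the derivative of n \<psi>. Since \<psi> is bounded, n \<psi> vanishes at both
  infinities, and the fundamental theorem on the whole line gives zero.\<close>

lemma std_normal_stein:
  fixes \<psi> \<psi>' :: "real \<Rightarrow> 'b::euclidean_space"
  assumes d: "\<And>y. (\<psi> has_vector_derivative \<psi>' y) (at y)"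
    and c': "continuous_on UNIV \<psi>'"
    and b: "\<And>y. norm (\<psi> y) \<le> C" and b': "\<And>y. norm (\<psi>' y) \<le> C"
  shows "(\<integral>y. y *\<^sub>R \<psi> y \<partial>std_normal_distribution) = (\<integral>y. \<psi>' y \<partial>std_normal_distribution)"
proof -
  have c: "continuous_on UNIV \<psi>"
    using d by (auto intro!: continuous_at_imp_continuous_on has_vector_derivative_continuous)
  have m[measurable]: "\<psi> \<in> borel_measurable borel" "\<psi>' \<in> borel_measurable borel"
    using c c' by (auto intro: borel_measurable_continuous_onI)
  let ?n = "std_normal_density"
  have i1: "integrable lborel (\<lambda>y. ?n y *\<^sub>R \<psi>' y)"
    by (rule Bochner_Integration.integrable_bound[where f="\<lambda>y. C * ?n y"])
       (auto intro!: AE_I2 integrable_mult_right mult_mono b' simp: abs_mult mult.commute[of C] 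
         intro: order_trans[OF b'])
  have i2: "integrable lborel (\<lambda>y. ?n y *\<^sub>R (y *\<^sub>R \<psi> y))"
  proof (rule Bochner_Integration.integrable_bound[where f="\<lambda>y. C * (?n y * \<bar>y\<bar>^1)"])
    show "integrable lborel (\<lambda>y. C * (?n y * \<bar>y\<bar>^1))"
      by (intro integrable_mult_right integrable_std_normal_moment_abs)
    show "AE y in lborel. norm (?n y *\<^sub>R (y *\<^sub>R \<psi> y)) \<le> norm (C * (?n y * \<bar>y\<bar>^1))"
    proof (rule AE_I2)
      fix y
      have "?n y * \<bar>y\<bar> * norm (\<psi> y) \<le> ?n y * \<bar>y\<bar> * C"
        by (intro mult_left_mono b) auto
      moreover have "C \<ge> 0" using b[of 0] norm_ge_zero order_trans by blast
      ultimately show "norm (?n y *\<^sub>R (y *\<^sub>R \<psi> y)) \<le> norm (C * (?n y * \<bar>y\<bar>^1))"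
        by (simp add: abs_mult mult_ac)
    qed
  qed simp
  have dn: "(?n has_real_derivative - y * ?n y) (at y)" for y
    unfolding std_normal_density_def
    by (auto intro!: derivative_eq_intros simp: field_simps)
  have D: "((\<lambda>y. ?n y *\<^sub>R \<psi> y) has_vector_derivative (?n y *\<^sub>R \<psi>' y - ?n y *\<^sub>R (y *\<^sub>R \<psi> y))) (at y)" for y
    using has_vector_derivative_scaleR[OF dn[of y] d[of y]]
    by (simp add: algebra_simps)
  have cn: "continuous_on UNIV ?n"
    by (auto intro!: continuous_at_imp_continuous_on DERIV_isCont[OF dn])
  have n0: "((\<lambda>y. ?n y) \<longlongrightarrow> 0) at_top" "((\<lambda>y. ?n y) \<longlongrightarrow> 0) at_bot"
    unfolding std_normal_density_def
    by (real_asymp)+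
  have z: "((\<lambda>y. ?n y *\<^sub>R \<psi> y) \<longlongrightarrow> 0) at_top" "((\<lambda>y. ?n y *\<^sub>R \<psi> y) \<longlongrightarrow> 0) at_bot"
  proof -
    have "((\<lambda>y. C * ?n y) \<longlongrightarrow> C * 0) at_top" "((\<lambda>y. C * ?n y) \<longlongrightarrow> C * 0) at_bot"
      by (intro tendsto_intros n0)+
    moreover have "norm (?n y *\<^sub>R \<psi> y) \<le> C * ?n y" for y
      using mult_left_mono[OF b[of y], of "?n y"] by (simp add: mult_ac)
    ultimately show "((\<lambda>y. ?n y *\<^sub>R \<psi> y) \<longlongrightarrow> 0) at_top" "((\<lambda>y. ?n y *\<^sub>R \<psi> y) \<longlongrightarrow> 0) at_bot"
      by (auto intro!: Lim_null_comparison[of "\<lambda>y. ?n y *\<^sub>R \<psi> y" "\<lambda>y. C * ?n y"] always_eventually simp del: norm_scaleR)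
  qed
  have "(LBINT y=-\<infinity>..\<infinity>. ?n y *\<^sub>R \<psi>' y - ?n y *\<^sub>R (y *\<^sub>R \<psi> y)) = 0 - 0"
  proof (rule interval_integral_FTC_integrable[OF _ D])
    show "isCont (\<lambda>y. ?n y *\<^sub>R \<psi>' y - ?n y *\<^sub>R (y *\<^sub>R \<psi> y)) x" for x
      using cn c c' by (auto intro!: continuous_intros simp: continuous_on_eq_continuous_at)
    show "set_integrable lborel (einterval (- \<infinity>) \<infinity>) (\<lambda>y. ?n y *\<^sub>R \<psi>' y - ?n y *\<^sub>R (y *\<^sub>R \<psi> y))"
      using i1 i2 by (simp add: set_integrable_def)
    show "(((\<lambda>y. ?n y *\<^sub>R \<psi> y) \<circ> real_of_ereal) \<longlongrightarrow> 0) (at_right (- \<infinity>))"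
      "(((\<lambda>y. ?n y *\<^sub>R \<psi> y) \<circ> real_of_ereal) \<longlongrightarrow> 0) (at_left \<infinity>)"
      using z by (simp_all add: ereal_tendsto_simps1)
  qed simp
  then have "(\<integral>y. ?n y *\<^sub>R \<psi>' y - ?n y *\<^sub>R (y *\<^sub>R \<psi> y) \<partial>lborel) = 0"
    by (simp add: interval_lebesgue_integral_def set_lebesgue_integral_def)
  then show ?thesis
    using i1 i2 by (simp add: integral_density)
qed

text \<open>A derivative along the direction \<open>b\<close> alone, with the derivative field
  passed as an argument. Gradients and Hessians thus travel as separate functions, and integrals and
  limits can be taken of them before any full differentiability is known.\<close>

definition has_pd :: "('a::euclidean_space \<Rightarrow> 'b::real_normed_vector) \<Rightarrow> 'a \<Rightarrow> ('a \<Rightarrow> 'b) \<Rightarrow> bool" where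
  "has_pd v b v' \<longleftrightarrow> (\<forall>x. ((\<lambda>r. v (x + r *\<^sub>R b)) has_vector_derivative v' x) (at 0))"

lemma has_pd_at:
  assumes "has_pd v b v'"
  shows "((\<lambda>r. v (x + r *\<^sub>R b)) has_vector_derivative v' (x + s *\<^sub>R b)) (at s)"
proof -
  define w where "w = (\<lambda>r. v ((x + s *\<^sub>R b) + r *\<^sub>R b))"
  have w: "(w has_vector_derivative v' (x + s *\<^sub>R b)) (at (s - s))"
    using assms by (simp add: has_pd_def w_def)
  have "((\<lambda>r. r - s) has_vector_derivative 1) (at s)"
    by (auto intro!: derivative_eq_intros)
  from vector_diff_chain_at[OF this w]
  have "((\<lambda>r. w (r - s)) has_vector_derivative v' (x + s *\<^sub>R b)) (at s)"
    by (simp add: o_def)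
  moreover have "w (r - s) = v (x + r *\<^sub>R b)" for r
    by (simp add: w_def scaleR_diff_left)
  ultimately show ?thesis by simp
qed

text \<open>Integrating the coordinate \<open>b\<close> first, with the others frozen at w, leaves
  the one-dimensional identity on the line w + y b. Because \<open>gauss\<close> is built as an
  image of a product measure, the splitting is an instance of Fubini.\<close>

lemma gauss_stein:
  fixes \<phi> \<phi>' :: "'a::euclidean_space \<Rightarrow> 'b::euclidean_space"
  assumes b: "b \<in> Basis" and d: "has_pd \<phi> b \<phi>'"
    and c: "continuous_on UNIV \<phi>" and c': "continuous_on UNIV \<phi>'"
    and bd: "\<And>y. norm (\<phi> y) \<le> C" and bd': "\<And>y. norm (\<phi>' y) \<le> C"
  shows "(\<integral>z. (z \<bullet> b) *\<^sub>R \<phi> z \<partial>gauss) = (\<integral>z. \<phi>' z \<partial>gauss)"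
proof -
  let ?M = "\<lambda>_::'a. std_normal_distribution"
  let ?s = "\<lambda>f. \<Sum>b\<in>Basis. f b *\<^sub>R b :: 'a"
  interpret product_sigma_finite ?M
    by (intro product_sigma_finite.intro prob_space_imp_sigma_finite prob_space_normal_density) simp
  interpret G: prob_space "gauss :: 'a measure" by (rule prob_space_gauss)
  have m[measurable]: "\<phi> \<in> borel_measurable borel" "\<phi>' \<in> borel_measurable borel"
    using c c' by (auto intro: borel_measurable_continuous_onI)
  have C0: "C \<ge> 0" using bd[of 0] norm_ge_zero order_trans by blast
  have i1: "integrable gauss (\<lambda>z. (z \<bullet> b) *\<^sub>R \<phi> z)"
  proof (rule Bochner_Integration.integrable_bound[where f="\<lambda>z. C * norm z"])
    show "AE z in gauss. norm ((z \<bullet> b) *\<^sub>R \<phi> z) \<le> norm (C * norm z)"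
    proof (rule AE_I2)
      fix z :: 'a
      have "\<bar>z \<bullet> b\<bar> * norm (\<phi> z) \<le> norm z * C"
        using Basis_le_norm[OF b] bd by (intro mult_mono) auto
      then show "norm ((z \<bullet> b) *\<^sub>R \<phi> z) \<le> norm (C * norm z)"
        using C0 by (simp add: mult_ac)
    qed
  qed (auto intro!: integrable_gauss_norm)
  have i2: "integrable gauss \<phi>'"
    by (rule G.integrable_const_bound[where B=C]) (auto simp: bd')
  have Ib: "Basis = insert b (Basis - {b})" using b by auto
  have key: "(\<integral>z. \<xi> z \<partial>gauss) = (\<integral>x. (\<integral>y. \<xi> (?s (x(b:=y))) \<partial>std_normal_distribution) \<partial>PiM (Basis - {b}) ?M)"
    if "integrable gauss \<xi>" for \<xi> :: "'a \<Rightarrow> 'b"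
  proof -
    have mx: "\<xi> \<in> borel_measurable borel" using that by auto
    have "integrable (PiM Basis ?M) (\<lambda>f. \<xi> (?s f))"
      using that mx unfolding gauss_def by (subst (asm) integrable_distr_eq) auto
    then have i: "integrable (PiM (insert b (Basis - {b})) ?M) (\<lambda>f. \<xi> (?s f))"
      using Ib by simp
    have "(\<integral>z. \<xi> z \<partial>gauss) = (\<integral>f. \<xi> (?s f) \<partial>PiM Basis ?M)"
      unfolding gauss_def by (subst integral_distr) (auto intro: mx)
    also have "\<dots> = (\<integral>f. \<xi> (?s f) \<partial>PiM (insert b (Basis - {b})) ?M)"
      using Ib by simp
    also have "\<dots> = (\<integral>x. (\<integral>y. \<xi> (?s (x(b:=y))) \<partial>std_normal_distribution) \<partial>PiM (Basis - {b}) ?M)"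
      by (rule product_integral_insert[OF _ _ i]) auto
    finally show ?thesis .
  qed
  have s: "?s (x(b:=y)) = (\<Sum>c\<in>Basis - {b}. x c *\<^sub>R c) + y *\<^sub>R b" for x y
  proof -
    have "?s (x(b:=y)) = y *\<^sub>R b + (\<Sum>c\<in>Basis - {b}. (x(b:=y)) c *\<^sub>R c)"
      using b by (subst sum.remove[of _ b]) auto
    also have "(\<Sum>c\<in>Basis - {b}. (x(b:=y)) c *\<^sub>R c) = (\<Sum>c\<in>Basis - {b}. x c *\<^sub>R c)"
      by (intro sum.cong) auto
    finally show ?thesis by simp
  qed
  have sb: "((\<Sum>c\<in>Basis - {b}. x c *\<^sub>R c) + y *\<^sub>R b) \<bullet> b = y" for x y
    using b by (simp add: inner_add_left inner_sum_left inner_not_same_Basis)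
  have "(\<integral>y. y *\<^sub>R \<phi> (w + y *\<^sub>R b) \<partial>std_normal_distribution) = (\<integral>y. \<phi>' (w + y *\<^sub>R b) \<partial>std_normal_distribution)" for w
    by (rule std_normal_stein[OF has_pd_at[OF d]])
       (auto intro!: bd bd' continuous_on_compose2[OF c'] continuous_intros)
  then show ?thesis
    unfolding key[OF i1] key[OF i2] s sb by simp
qed

section \<open>Gaussian averages and the Duhamel operator\<close>

lemma continuous_on_integral_dominated:
  fixes \<Psi> :: "'p::metric_space \<Rightarrow> 'z \<Rightarrow> 'b::{banach,second_countable_topology}"
  assumes c: "\<And>z. z \<in> space M \<Longrightarrow> continuous_on S (\<lambda>p. \<Psi> p z)"
    and m: "\<And>p. p \<in> S \<Longrightarrow> \<Psi> p \<in> borel_measurable M"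
    and w: "integrable M w" and b: "\<And>p z. p \<in> S \<Longrightarrow> z \<in> space M \<Longrightarrow> norm (\<Psi> p z) \<le> w z"
  shows "continuous_on S (\<lambda>p. \<integral>z. \<Psi> p z \<partial>M)"
proof (rule continuous_on_sequentiallyI)
  fix u a assume u: "\<forall>n. u n \<in> S" and a: "a \<in> S" and l: "u \<longlonglongrightarrow> a"
  show "(\<lambda>n. \<integral>z. \<Psi> (u n) z \<partial>M) \<longlonglongrightarrow> (\<integral>z. \<Psi> a z \<partial>M)"
  proof (rule integral_dominated_convergence[where w=w])
    show "AE z in M. (\<lambda>n. \<Psi> (u n) z) \<longlonglongrightarrow> \<Psi> a z"
      using c u a l by (auto intro!: AE_I2 simp: continuous_on_sequentially o_def)
  qed (use m w b u a in auto)
qed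

lemma norm_diff_le_vector_derivative:
  fixes f :: "real \<Rightarrow> 'b::real_normed_vector"
  assumes d: "\<And>r. (f has_vector_derivative f' r) (at r)" and b: "\<And>r. norm (f' r) \<le> B"
  shows "norm (f x - f y) \<le> B * \<bar>x - y\<bar>"
proof -
  have "norm (f x - f y) \<le> B * norm (x - y)"
  proof (rule differentiable_bound[of UNIV f "\<lambda>r h. h *\<^sub>R f' r"])
    show "onorm (\<lambda>h. h *\<^sub>R f' r) \<le> B" for r
      by (rule onorm_le) (use b[of r] in \<open>auto simp: mult.commute[of B] intro!: mult_left_mono\<close>)
  qed (use d in \<open>auto simp: has_vector_derivative_def\<close>)
  then show ?thesis by simp
qed

text \<open>Dominated convergence for the remainder of the difference quotient: the mean value
  inequality bounds the increment by w |r - s|, the linear term obeys the same bound, hence the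
  majorant 2 w.\<close>

lemma has_vector_derivative_integral_dominated:
  fixes \<Psi> :: "real \<Rightarrow> 'z \<Rightarrow> 'b::{banach,second_countable_topology}"
  assumes d: "\<And>r z. z \<in> space M \<Longrightarrow> ((\<lambda>r. \<Psi> r z) has_vector_derivative \<Psi>' r z) (at r)"
    and i: "\<And>r. integrable M (\<Psi> r)" and m: "\<Psi>' s \<in> borel_measurable M"
    and w: "integrable M w" and b: "\<And>r z. z \<in> space M \<Longrightarrow> norm (\<Psi>' r z) \<le> w z"
  shows "((\<lambda>r. \<integral>z. \<Psi> r z \<partial>M) has_vector_derivative (\<integral>z. \<Psi>' s z \<partial>M)) (at s)"
proof -
  have i': "integrable M (\<Psi>' s)"
    by (rule Bochner_Integration.integrable_bound[OF w m])
       (intro AE_I2, metis b abs_ge_self order_trans real_norm_def)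
  let ?Q = "\<lambda>r z. (\<Psi> r z - \<Psi> s z - (r - s) *\<^sub>R \<Psi>' s z) /\<^sub>R norm (r - s)"
  have iQ: "integrable M (?Q r)" for r
    using i i' by auto
  have eq: "((\<integral>z. \<Psi> r z \<partial>M) - (\<integral>z. \<Psi> s z \<partial>M) - (r - s) *\<^sub>R (\<integral>z. \<Psi>' s z \<partial>M)) /\<^sub>R norm (r - s) = (\<integral>z. ?Q r z \<partial>M)" for r
    using i i' by simp
  have bQ: "norm (?Q r z) \<le> 2 * w z" if z: "z \<in> space M" for r z
  proof (cases "r = s")
    case True
    have "0 \<le> w z" using b[OF z, of s] norm_ge_zero[of "\<Psi>' s z"] by linarith
    then show ?thesis using True by simp
  next
    case False
    have "norm (\<Psi> r z - \<Psi> s z) \<le> w z * \<bar>r - s\<bar>"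
      by (rule norm_diff_le_vector_derivative[OF d[OF z] b[OF z]])
    moreover have "norm ((r - s) *\<^sub>R \<Psi>' s z) \<le> w z * \<bar>r - s\<bar>"
      using mult_left_mono[OF b[OF z, of s], of "\<bar>r - s\<bar>"] by (simp add: mult.commute)
    ultimately have "norm (\<Psi> r z - \<Psi> s z - (r - s) *\<^sub>R \<Psi>' s z) \<le> 2 * w z * \<bar>r - s\<bar>"
      using norm_triangle_ineq4[of "\<Psi> r z - \<Psi> s z" "(r - s) *\<^sub>R \<Psi>' s z"] by linarith
    then have "norm (\<Psi> r z - \<Psi> s z - (r - s) *\<^sub>R \<Psi>' s z) / \<bar>r - s\<bar> \<le> 2 * w z"
      using False by (subst pos_divide_le_eq) auto
    then show ?thesis unfolding norm_scaleR by (simp add: divide_inverse mult.commute)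
  qed
  have "((\<lambda>r. \<integral>z. ?Q r z \<partial>M) \<longlongrightarrow> 0) (at s)"
    unfolding tendsto_at_iff_sequentially o_def
  proof (intro allI impI)
    fix X :: "nat \<Rightarrow> real" assume X: "\<forall>i. X i \<in> UNIV - {s}" "X \<longlonglongrightarrow> s"
    have "(\<lambda>n. \<integral>z. ?Q (X n) z \<partial>M) \<longlonglongrightarrow> (\<integral>z. 0 \<partial>M)"
    proof (rule integral_dominated_convergence[where w="\<lambda>z. 2 * w z"])
      show "AE z in M. (\<lambda>n. ?Q (X n) z) \<longlonglongrightarrow> 0"
      proof (rule AE_I2)
        fix z assume z: "z \<in> space M"
        have "((\<lambda>r. ?Q r z) \<longlongrightarrow> 0) (at s)"
          using d[OF z, of s] unfolding has_vector_derivative_def has_derivative_at_within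
          by (simp add: divide_inverse_commute)
        then show "(\<lambda>n. ?Q (X n) z) \<longlonglongrightarrow> 0"
          using X unfolding tendsto_at_iff_sequentially o_def by auto
      qed
      show "?Q (X n) \<in> borel_measurable M" for n
        using iQ[of "X n"] by auto
    qed (use bQ w in auto)
    then show "(\<lambda>n. \<integral>z. ?Q (X n) z \<partial>M) \<longlonglongrightarrow> 0" by simp
  qed
  then have "((\<lambda>r. ((\<integral>z. \<Psi> r z \<partial>M) - (\<integral>z. \<Psi> s z \<partial>M) - (r - s) *\<^sub>R (\<integral>z. \<Psi>' s z \<partial>M)) /\<^sub>R norm (r - s)) \<longlongrightarrow> 0) (at s)"
    unfolding eq .
  then show ?thesis
    unfolding has_vector_derivative_def has_derivative_at_within
    by (simp add: bounded_linear_scaleR_left)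
qed

definition heat0 :: "real \<Rightarrow> ('a::euclidean_space \<Rightarrow> 'b::euclidean_space) \<Rightarrow> real \<Rightarrow> 'a \<Rightarrow> 'b" where
  "heat0 \<sigma> h t x = (\<integral>z. h (x + (\<sigma> * sqrt t) *\<^sub>R z) \<partial>gauss)"

definition unif :: "real measure" where "unif = restrict_space lborel {0..1}"

text \<open>The law of a pair: the variable \<theta> of the time substitution and an independent
  Gaussian vector. As the measure is the same for all t and x, continuity and differentiability
  become dominated convergence under one integral.\<close>

definition ugauss :: "(real \<times> 'a::euclidean_space) measure" where "ugauss = unif \<Otimes>\<^sub>M gauss"

lemma space_unif [simp]: "space unif = {0..1}" by (simp add: unif_def space_restrict_space)

lemma prob_space_unif: "prob_space unif"
  by (rule prob_spaceI) (simp add: unif_def emeasure_restrict_space space_restrict_space)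

lemma space_ugauss [simp]: "space (ugauss :: (real \<times> 'a::euclidean_space) measure) = {0..1} \<times> UNIV"
  by (simp add: ugauss_def space_pair_measure)

lemma unif_gauss_pair: "pair_prob_space unif (gauss :: 'a::euclidean_space measure)"
  by (intro pair_prob_space.intro pair_sigma_finite.intro prob_space_imp_sigma_finite
      prob_space_unif prob_space_gauss)

lemma prob_space_ugauss: "prob_space (ugauss :: (real \<times> 'a::euclidean_space) measure)"
proof -
  interpret pair_prob_space unif "gauss :: 'a measure" by (rule unif_gauss_pair)
  show ?thesis unfolding ugauss_def by unfold_locales
qed

lemma measurable_unif: "f \<in> borel_measurable borel \<Longrightarrow> f \<in> borel_measurable unif"
  unfolding unif_def by (rule measurable_restrict_space1) simp

lemma measurable_ugauss_fst: "(\<lambda>\<zeta>. fst \<zeta>) \<in> measurable (ugauss :: (real \<times> 'a::euclidean_space) measure) borel"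
  unfolding ugauss_def
  by (rule measurable_compose[OF measurable_fst measurable_unif]) simp

lemma measurable_ugauss_snd: "(\<lambda>\<zeta>. snd \<zeta>) \<in> measurable (ugauss :: (real \<times> 'a::euclidean_space) measure) borel"
  unfolding ugauss_def
  by (rule measurable_compose[OF measurable_snd]) simp

lemma measurable_ugauss:
  fixes f :: "real \<times> 'a::euclidean_space \<Rightarrow> 'b::topological_space"
  assumes "f \<in> borel_measurable borel"
  shows "f \<in> borel_measurable ugauss"
proof -
  have "(\<lambda>\<zeta>. (fst \<zeta>, snd \<zeta>)) \<in> measurable ugauss (borel :: (real \<times> 'a) measure)"
    by (rule borel_measurable_Pair[OF measurable_ugauss_fst measurable_ugauss_snd])
  from measurable_compose[OF this assms] show ?thesis by simp
qed

lemma ugauss_fubini: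
  fixes f :: "real \<times> 'a::euclidean_space \<Rightarrow> 'b::euclidean_space"
  assumes "integrable ugauss f"
  shows "(\<integral>\<zeta>. f \<zeta> \<partial>ugauss) = (\<integral>\<theta>. (\<integral>z. f (\<theta>, z) \<partial>gauss) \<partial>unif)"
proof -
  interpret pair_prob_space unif "gauss :: 'a measure" by (rule unif_gauss_pair)
  show ?thesis using integral_fst'[of f] assms unfolding ugauss_def by simp
qed

lemma integrable_ugauss_norm: "integrable ugauss (\<lambda>\<zeta>::real \<times> 'a::euclidean_space. norm (snd \<zeta>))"
proof -
  interpret pair_prob_space unif "gauss :: 'a measure" by (rule unif_gauss_pair)
  have "integrable (unif \<Otimes>\<^sub>M gauss) (\<lambda>(x, y). norm (y::'a))"
    by (rule Fubini_integrable) (auto simp: integrable_gauss_norm)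
  then show ?thesis by (simp add: ugauss_def case_prod_beta')
qed

definition bcont :: "real \<Rightarrow> (real \<Rightarrow> 'a::euclidean_space \<Rightarrow> 'b::euclidean_space) \<Rightarrow> bool" where
  "bcont C G \<longleftrightarrow> continuous_on UNIV (\<lambda>(t, x). G t x) \<and> (\<forall>t x. norm (G t x) \<le> C)"

text \<open>The common bound of the two weights below. The growth in z comes from the factor z . b
  of Stein's identity; the factor sqrt t is what later turns into a gain of 1/sqrt l.\<close>

definition ker :: "real \<Rightarrow> real \<Rightarrow> (real \<Rightarrow> real \<Rightarrow> 'a::euclidean_space \<Rightarrow> real) \<Rightarrow> bool" where
  "ker T W \<rho> \<longleftrightarrow> 0 \<le> W \<and> continuous_on UNIV (\<lambda>(t, \<theta>, z). \<rho> t \<theta> z) \<and>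
     (\<forall>t\<in>{0..T}. \<forall>\<theta>\<in>{0..1}. \<forall>z. \<bar>\<rho> t \<theta> z\<bar> \<le> W * sqrt t * (1 + norm z))"

text \<open>Depending on the weight, this one operator is the Duhamel integral or its gradient. Here
  \<theta>^2 is the fraction (t - s)/t of elapsed time, so the Gaussian is scaled by \<sigma> sqrt(t
  - s) = \<sigma> sqrt t \<theta>.\<close>

definition kint :: "(real \<Rightarrow> real \<Rightarrow> 'a::euclidean_space \<Rightarrow> real) \<Rightarrow> real \<Rightarrow>
    (real \<Rightarrow> 'a \<Rightarrow> 'b::euclidean_space) \<Rightarrow> real \<Rightarrow> 'a \<Rightarrow> 'b" where
  "kint \<rho> \<sigma> G t x = (\<integral>\<zeta>. \<rho> t (fst \<zeta>) (snd \<zeta>) *\<^sub>R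
      G (t * (1 - (fst \<zeta>)\<^sup>2)) (x + (\<sigma> * sqrt t * fst \<zeta>) *\<^sub>R snd \<zeta>) \<partial>ugauss)"

lemma bcont_nonneg: "bcont C G \<Longrightarrow> 0 \<le> C"
  unfolding bcont_def by (meson norm_ge_zero order_trans)

lemma bcont_norm: "bcont C G \<Longrightarrow> norm (G t x) \<le> C"
  by (simp add: bcont_def)

lemma bcont_continuous:
  assumes "bcont C G" "continuous_on S f" "continuous_on S g"
  shows "continuous_on S (\<lambda>p. G (f p) (g p))"
proof -
  have "continuous_on UNIV (\<lambda>(t, x). G t x)" using assms by (simp add: bcont_def)
  from continuous_on_compose2[OF this, of S "\<lambda>p. (f p, g p)"] assms(2,3)
  show ?thesis by (auto intro!: continuous_intros)
qed

lemma ker_continuous: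
  assumes "ker T W \<rho>" "continuous_on S f" "continuous_on S g" "continuous_on S k"
  shows "continuous_on S (\<lambda>p. \<rho> (f p) (g p) (k p))"
proof -
  have c: "continuous_on UNIV (\<lambda>(t, \<theta>, x). \<rho> t \<theta> x)" using assms by (simp add: ker_def)
  have "continuous_on S (\<lambda>p. (f p, g p, k p))" by (intro continuous_on_Pair assms)
  from continuous_on_compose2[OF c this] show ?thesis by simp
qed

lemma kint_integrand_measurable:
  assumes "ker T W \<rho>" "bcont C G"
  shows "(\<lambda>\<zeta>. \<rho> t (fst \<zeta>) (snd \<zeta>) *\<^sub>R
      G (t * (1 - (fst \<zeta>)\<^sup>2)) (x + (\<sigma> * sqrt t * fst \<zeta>) *\<^sub>R snd \<zeta>)) \<in> borel_measurable ugauss"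
  by (intro measurable_ugauss borel_measurable_continuous_onI continuous_on_scaleR
      ker_continuous[OF assms(1)] bcont_continuous[OF assms(2)] continuous_intros)

lemma integrable_ugauss_weight: "integrable ugauss (\<lambda>\<zeta>::real \<times> 'a::euclidean_space. C * (1 + norm (snd \<zeta>)))"
proof -
  interpret prob_space "ugauss :: (real \<times> 'a) measure" by (rule prob_space_ugauss)
  show ?thesis by (auto intro!: integrable_ugauss_norm)
qed

lemma kint_integrand_bound:
  assumes k: "ker T W \<rho>" and G: "bcont C G" and t: "t \<in> {0..T}" and \<theta>: "\<theta> \<in> {0..1}"
  shows "norm (\<rho> t \<theta> z *\<^sub>R G s y) \<le> W * sqrt T * C * (1 + norm z)"
proof -
  have "\<bar>\<rho> t \<theta> z\<bar> \<le> W * sqrt t * (1 + norm z)" using k t \<theta> by (simp add: ker_def)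
  also have "\<dots> \<le> W * sqrt T * (1 + norm z)"
    using t k by (intro mult_right_mono mult_left_mono) (auto simp: ker_def)
  finally have "\<bar>\<rho> t \<theta> z\<bar> * norm (G s y) \<le> W * sqrt T * (1 + norm z) * C"
    using bcont_norm[OF G] bcont_nonneg[OF G] k t
    by (intro mult_mono) (auto simp: ker_def intro!: mult_nonneg_nonneg)
  then show ?thesis by (simp add: mult_ac)
qed

lemma kint_integrable:
  assumes k: "ker T W \<rho>" and G: "bcont C G" and t: "t \<in> {0..T}"
  shows "integrable ugauss (\<lambda>\<zeta>. \<rho> t (fst \<zeta>) (snd \<zeta>) *\<^sub>R
      G (t * (1 - (fst \<zeta>)\<^sup>2)) (x + (\<sigma> * sqrt t * fst \<zeta>) *\<^sub>R snd \<zeta>))"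
  by (rule Bochner_Integration.integrable_bound[OF integrable_ugauss_weight[of "W * sqrt T * C"]
        kint_integrand_measurable[OF k G]])
     (auto intro!: AE_I2 order_trans[OF kint_integrand_bound[OF k G t]] simp del: norm_scaleR)

lemma kint_continuous:
  assumes k: "ker T W \<rho>" and G: "bcont C G"
  shows "continuous_on ({0..T} \<times> UNIV) (\<lambda>(t, x). kint \<rho> \<sigma> G t x)"
proof -
  have "continuous_on ({0..T} \<times> UNIV) (\<lambda>p. \<integral>\<zeta>. \<rho> (fst p) (fst \<zeta>) (snd \<zeta>) *\<^sub>R
      G (fst p * (1 - (fst \<zeta>)\<^sup>2)) (snd p + (\<sigma> * sqrt (fst p) * fst \<zeta>) *\<^sub>R snd \<zeta>) \<partial>ugauss)"
  proof (rule continuous_on_integral_dominated[where w="\<lambda>\<zeta>. W * sqrt T * C * (1 + norm (snd \<zeta>))"])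
    fix \<zeta> :: "real \<times> 'a"
    show "continuous_on ({0..T} \<times> UNIV) (\<lambda>p. \<rho> (fst p) (fst \<zeta>) (snd \<zeta>) *\<^sub>R
      G (fst p * (1 - (fst \<zeta>)\<^sup>2)) (snd p + (\<sigma> * sqrt (fst p) * fst \<zeta>) *\<^sub>R snd \<zeta>))"
      by (intro continuous_on_scaleR ker_continuous[OF k] bcont_continuous[OF G] continuous_intros)
  next
    show "(\<lambda>\<zeta>. \<rho> (fst p) (fst \<zeta>) (snd \<zeta>) *\<^sub>R
      G (fst p * (1 - (fst \<zeta>)\<^sup>2)) (snd p + (\<sigma> * sqrt (fst p) * fst \<zeta>) *\<^sub>R snd \<zeta>)) \<in> borel_measurable ugauss" for p
      by (rule kint_integrand_measurable[OF k G])
  next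
    show "integrable ugauss (\<lambda>\<zeta>::real \<times> 'a. W * sqrt T * C * (1 + norm (snd \<zeta>)))"
      by (rule integrable_ugauss_weight)
  qed (auto intro!: kint_integrand_bound[OF k G] simp del: norm_scaleR)
  then show ?thesis by (simp add: kint_def case_prod_beta')
qed

text \<open>The point x enters the integrand only through \<open>G\<close>, so the derivative falls
  on \<open>G\<close> and leaves the weight alone; a multiple of 1 + |z| is the majorant.\<close>

lemma kint_has_pd:
  assumes k: "ker T W \<rho>" and G: "bcont C G" and G': "bcont C' G'" and t: "t \<in> {0..T}"
    and d: "\<And>s. has_pd (G s) b (G' s)"
  shows "has_pd (kint \<rho> \<sigma> G t) b (kint \<rho> \<sigma> G' t)"
  unfolding has_pd_def
proof
  fix x
  let ?F = "\<lambda>G r \<zeta>. \<rho> t (fst \<zeta>) (snd \<zeta>) *\<^sub>R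
      G (t * (1 - (fst \<zeta>)\<^sup>2)) (x + r *\<^sub>R b + (\<sigma> * sqrt t * fst \<zeta>) *\<^sub>R snd \<zeta>) :: 'b"
  have "((\<lambda>r. \<integral>\<zeta>. ?F G r \<zeta> \<partial>ugauss) has_vector_derivative (\<integral>\<zeta>. ?F G' 0 \<zeta> \<partial>ugauss)) (at 0)"
  proof (rule has_vector_derivative_integral_dominated[where w="\<lambda>\<zeta>. W * sqrt T * C' * (1 + norm (snd \<zeta>))"])
    fix r and \<zeta> :: "real \<times> 'a"
    have "((\<lambda>r. G (t * (1 - (fst \<zeta>)\<^sup>2)) (x + (\<sigma> * sqrt t * fst \<zeta>) *\<^sub>R snd \<zeta> + r *\<^sub>R b)) has_vector_derivative
        G' (t * (1 - (fst \<zeta>)\<^sup>2)) (x + (\<sigma> * sqrt t * fst \<zeta>) *\<^sub>R snd \<zeta> + r *\<^sub>R b)) (at r)"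
      by (rule has_pd_at[OF d])
    then have "((\<lambda>r. G (t * (1 - (fst \<zeta>)\<^sup>2)) (x + r *\<^sub>R b + (\<sigma> * sqrt t * fst \<zeta>) *\<^sub>R snd \<zeta>)) has_vector_derivative
        G' (t * (1 - (fst \<zeta>)\<^sup>2)) (x + r *\<^sub>R b + (\<sigma> * sqrt t * fst \<zeta>) *\<^sub>R snd \<zeta>)) (at r)"
      by (simp add: add.assoc add.commute[of "(\<sigma> * sqrt t * fst \<zeta>) *\<^sub>R snd \<zeta>"])
    then show "((\<lambda>r. ?F G r \<zeta>) has_vector_derivative ?F G' r \<zeta>) (at r)"
      by (rule bounded_linear.has_vector_derivative[OF bounded_linear_scaleR_right])
  next
    show "integrable ugauss (\<lambda>\<zeta>::real \<times> 'a. W * sqrt T * C' * (1 + norm (snd \<zeta>)))"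
      by (rule integrable_ugauss_weight)
  qed (auto intro!: kint_integrand_bound[OF k G' t] kint_integrable[OF k G t] kint_integrand_measurable[OF k G'] simp del: norm_scaleR)
  then show "((\<lambda>r. kint \<rho> \<sigma> G t (x + r *\<^sub>R b)) has_vector_derivative kint \<rho> \<sigma> G' t x) (at 0)"
    by (simp add: kint_def)
qed

lemma kint_diff:
  assumes k: "ker T W \<rho>" and G: "bcont C G" and G': "bcont C' G'" and t: "t \<in> {0..T}"
  shows "kint \<rho> \<sigma> G t x - kint \<rho> \<sigma> G' t x = kint \<rho> \<sigma> (\<lambda>s y. G s y - G' s y) t x"
  unfolding kint_def
  by (subst Bochner_Integration.integral_diff[symmetric])
     (auto intro!: kint_integrable[OF k G t] kint_integrable[OF k G' t] simp: scaleR_diff_right)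

definition gmom :: "'a::euclidean_space itself \<Rightarrow> real" where
  "gmom _ = (\<integral>z. 1 + norm (z::'a) \<partial>gauss)"

lemma gmom_nonneg: "0 \<le> gmom TYPE('a::euclidean_space)"
  unfolding gmom_def by (rule integral_nonneg_AE) auto

text \<open>From e^(-a) <= 1/(1+a) the integrand is at most sqrt t / (1 + l t \<theta>^2), the
  derivative of arctan(sqrt(l t) \<theta>) / sqrt l. The resulting bound is uniform in t and tends
  to zero as l grows; this is the source of every smallness used in the iteration.\<close>

lemma unif_exp_bound:
  assumes t: "t \<ge> 0" and l: "l > 0"
  shows "(\<integral>\<theta>. sqrt t * exp (- (l * t * \<theta>\<^sup>2)) \<partial>unif) \<le> pi / 2 / sqrt l"
proof -
  interpret prob_space unif by (rule prob_space_unif)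
  have pos: "1 + l * t * \<theta>\<^sup>2 > 0" for \<theta>
    using t l by (intro add_pos_nonneg) auto
  have "(\<integral>\<theta>. sqrt t * exp (- (l * t * \<theta>\<^sup>2)) \<partial>unif) \<le> (\<integral>\<theta>. sqrt t / (1 + l * t * \<theta>\<^sup>2) \<partial>unif)"
  proof (rule integral_mono)
    show "integrable unif (\<lambda>\<theta>. sqrt t * exp (- (l * t * \<theta>\<^sup>2)))"
      by (rule integrable_const_bound[where B="sqrt t"])
         (use t l in \<open>auto intro!: AE_I2 measurable_unif mult_left_le simp: abs_mult\<close>)
    show "integrable unif (\<lambda>\<theta>. sqrt t / (1 + l * t * \<theta>\<^sup>2))"
    proof (rule integrable_const_bound[where B="sqrt t"])
      show "AE \<theta> in unif. norm (sqrt t / (1 + l * t * \<theta>\<^sup>2)) \<le> sqrt t"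
      proof (rule AE_I2)
        fix \<theta>
        have "sqrt t / (1 + l * t * \<theta>\<^sup>2) \<le> sqrt t / 1"
          using t l by (intro divide_left_mono) (auto intro!: add_pos_nonneg)
        then show "norm (sqrt t / (1 + l * t * \<theta>\<^sup>2)) \<le> sqrt t"
          using pos[of \<theta>] t by simp
      qed
    qed (auto intro!: measurable_unif)
    fix \<theta>
    have "exp (- (l * t * \<theta>\<^sup>2)) = 1 / exp (l * t * \<theta>\<^sup>2)" by (simp add: exp_minus divide_inverse)
    also have "\<dots> \<le> 1 / (1 + l * t * \<theta>\<^sup>2)"
      using pos[of \<theta>] exp_ge_add_one_self[of "l * t * \<theta>\<^sup>2"] by (intro divide_left_mono) auto
    finally have "sqrt t * exp (- (l * t * \<theta>\<^sup>2)) \<le> sqrt t * (1 / (1 + l * t * \<theta>\<^sup>2))"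
      using t by (intro mult_left_mono) auto
    then show "sqrt t * exp (- (l * t * \<theta>\<^sup>2)) \<le> sqrt t / (1 + l * t * \<theta>\<^sup>2)" by simp
  qed
  also have "\<dots> = (\<integral>\<theta>. indicator {0..1} \<theta> *\<^sub>R (sqrt t / (1 + l * t * \<theta>\<^sup>2)) \<partial>lborel)"
    unfolding unif_def by (subst integral_restrict_space) auto
  also have "\<dots> = arctan (sqrt l * sqrt t * 1) / sqrt l - arctan (sqrt l * sqrt t * 0) / sqrt l"
  proof (rule integral_FTC_Icc)
    show "continuous_on {0..1} (\<lambda>\<theta>. sqrt t / (1 + l * t * \<theta>\<^sup>2))"
      using pos by (intro continuous_intros) (auto simp: less_imp_neq[symmetric])
    fix \<theta> :: real
    have "((\<lambda>\<theta>. arctan (c * s * \<theta>) / c) has_real_derivative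
        (c * s) * inverse (1 + (c * s * \<theta>)\<^sup>2) / c) (at \<theta> within {0..1})" if "c > 0" for c s :: real
    proof -
      have "((\<lambda>\<theta>. arctan (c * s * \<theta>)) has_real_derivative (c * s) * inverse (1 + (c * s * \<theta>)\<^sup>2)) (at \<theta> within {0..1})"
        by (auto intro!: derivative_eq_intros)
      from DERIV_cdivide[OF this] show ?thesis .
    qed
    from this[of "sqrt l" "sqrt t"] l
    have "((\<lambda>\<theta>. arctan (sqrt l * sqrt t * \<theta>) / sqrt l) has_real_derivative
        (sqrt l * sqrt t) * inverse (1 + (sqrt l * sqrt t * \<theta>)\<^sup>2) / sqrt l) (at \<theta> within {0..1})"
      by simp
    moreover have "(sqrt l * sqrt t) * inverse (1 + (sqrt l * sqrt t * \<theta>)\<^sup>2) / sqrt l = sqrt t / (1 + l * t * \<theta>\<^sup>2)"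
    proof -
      have "(c * s) * i / c = s * i" if "c \<noteq> 0" for c s i :: real using that by simp
      from this[of "sqrt l" "sqrt t"] show ?thesis
        using t l by (simp add: power_mult_distrib divide_inverse)
    qed
    ultimately show "((\<lambda>\<theta>. arctan (sqrt l * sqrt t * \<theta>) / sqrt l) has_vector_derivative
        sqrt t / (1 + l * t * \<theta>\<^sup>2)) (at \<theta> within {0..1})"
      by (simp add: has_real_derivative_iff_has_vector_derivative)
  qed simp
  also have "\<dots> \<le> pi / 2 / sqrt l"
    using l divide_right_mono[OF less_imp_le[OF arctan_ubound[of "sqrt l * sqrt t"]], of "sqrt l"] by simp
  finally show ?thesis .
qed

text \<open>At time s = t(1 - \<theta>^2) the weight e^(l s) equals e^(l t) e^(-l t \<theta>^2). The
  first factor is kept, the second is integrated in \<theta> with the sqrt t of the kernel, and the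
  Gaussian moment splits off by Fubini.\<close>

lemma kint_weighted_bound:
  fixes G :: "real \<Rightarrow> 'a::euclidean_space \<Rightarrow> 'b::euclidean_space"
  assumes k: "ker T W \<rho>" and G: "bcont C0 G" and t: "t \<in> {0..T}" and l: "l > 0" and C: "C \<ge> 0"
    and b: "\<And>s y. s \<in> {0..t} \<Longrightarrow> norm (G s y) \<le> C * exp (l * s)"
  shows "norm (kint \<rho> \<sigma> G t x) \<le> W * gmom TYPE('a) * (pi / 2) * C * exp (l * t) / sqrt l"
proof -
  interpret U: prob_space unif by (rule prob_space_unif)
  let ?f = "\<lambda>\<zeta>. \<rho> t (fst \<zeta>) (snd \<zeta>) *\<^sub>R
      G (t * (1 - (fst \<zeta>)\<^sup>2)) (x + (\<sigma> * sqrt t * fst \<zeta>) *\<^sub>R snd \<zeta>)"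
  let ?g = "\<lambda>\<zeta>::real \<times> 'a. W * C * exp (l * t) * (sqrt t * exp (- (l * t * (fst \<zeta>)\<^sup>2))) * (1 + norm (snd \<zeta>))"
  have W: "W \<ge> 0" using k by (simp add: ker_def)
  have ig: "integrable ugauss ?g"
  proof (rule Bochner_Integration.integrable_bound[OF integrable_ugauss_weight[of "W * C * exp (l * t) * sqrt t"]])
    show "?g \<in> borel_measurable ugauss"
      by (intro measurable_ugauss borel_measurable_continuous_onI continuous_intros)
    show "AE \<zeta>::real \<times> 'a in ugauss. norm (?g \<zeta>) \<le> norm (W * C * exp (l * t) * sqrt t * (1 + norm (snd \<zeta>)))"
    proof (rule AE_I2)
      fix \<zeta> :: "real \<times> 'a"
      have "W * C * exp (l * t) * (sqrt t * exp (- (l * t * (fst \<zeta>)\<^sup>2))) \<le> W * C * exp (l * t) * (sqrt t * 1)"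
        using W C t l by (intro mult_left_mono) auto
      then show "norm (?g \<zeta>) \<le> norm (W * C * exp (l * t) * sqrt t * (1 + norm (snd \<zeta>)))"
        using W C t by (auto simp: abs_mult intro!: mult_right_mono)
    qed
  qed
  have "norm (kint \<rho> \<sigma> G t x) \<le> (\<integral>\<zeta>. norm (?f \<zeta>) \<partial>ugauss)"
    unfolding kint_def by (rule integral_norm_bound)
  also have "\<dots> \<le> (\<integral>\<zeta>. ?g \<zeta> \<partial>ugauss)"
  proof (rule integral_mono)
    show "integrable ugauss (\<lambda>\<zeta>. norm (?f \<zeta>))"
      by (intro integrable_norm kint_integrable[OF k G t])
    show "integrable ugauss ?g" by (rule ig)
    fix \<zeta> :: "real \<times> 'a" assume z: "\<zeta> \<in> space ugauss"
    then have th: "fst \<zeta> \<in> {0..1}" by auto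
    have "(fst \<zeta>)\<^sup>2 \<le> 1" using th by (auto intro!: power_le_one)
    then have s: "t * (1 - (fst \<zeta>)\<^sup>2) \<in> {0..t}"
      using t by (auto intro!: mult_nonneg_nonneg mult_left_le)
    have "norm (?f \<zeta>) \<le> (W * sqrt t * (1 + norm (snd \<zeta>))) * (C * exp (l * (t * (1 - (fst \<zeta>)\<^sup>2))))"
      unfolding norm_scaleR
      using k t th W C b[OF s] by (intro mult_mono) (auto simp: ker_def intro!: mult_nonneg_nonneg)
    also have "exp (l * (t * (1 - (fst \<zeta>)\<^sup>2))) = exp (l * t) * exp (- (l * t * (fst \<zeta>)\<^sup>2))"
      by (simp add: exp_add[symmetric] algebra_simps)
    finally show "norm (?f \<zeta>) \<le> ?g \<zeta>" by (simp add: mult_ac)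
  qed
  also have "\<dots> = (\<integral>\<theta>. (\<integral>z. ?g (\<theta>, z) \<partial>gauss) \<partial>unif)"
    by (rule ugauss_fubini[OF ig])
  also have "\<dots> = W * C * exp (l * t) * gmom TYPE('a) * (\<integral>\<theta>. sqrt t * exp (- (l * t * \<theta>\<^sup>2)) \<partial>unif)"
    unfolding gmom_def by simp
  also have "\<dots> \<le> W * C * exp (l * t) * gmom TYPE('a) * (pi / 2 / sqrt l)"
    using W C gmom_nonneg[where 'a='a] t l by (intro mult_left_mono unif_exp_bound) auto
  finally show ?thesis by (simp add: mult_ac)
qed

text \<open>With $s = t(1-\theta^2)$, the integral $\int_0^t P_{t-s} G(s)\,ds$ becomes the average with weight
  \<open>duh_ker\<close>; \<open>grad_ker\<close> is what Stein's identity makes of its derivative in direction $b$.\<close>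

definition duh_ker :: "real \<Rightarrow> real \<Rightarrow> 'a::euclidean_space \<Rightarrow> real" where
  "duh_ker t \<theta> z = 2 * t * \<theta>"

definition grad_ker :: "real \<Rightarrow> 'a::euclidean_space \<Rightarrow> real \<Rightarrow> real \<Rightarrow> 'a \<Rightarrow> real" where
  "grad_ker \<sigma> b t \<theta> z = 2 / \<sigma> * sqrt t * (z \<bullet> b)"

text \<open>Uses t = sqrt t sqrt t <= sqrt T sqrt t. The summand 2/\<sigma> belongs to
  \<open>grad_ker\<close>; with a common constant one rate l controls the function and its
  gradient.\<close>

lemma ker_duh: "ker T (2 * sqrt T + 2 / \<sigma>) duh_ker" if "T \<ge> 0" "\<sigma> > 0"
  unfolding ker_def duh_ker_def
proof (intro conjI ballI allI)
  fix t \<theta> :: real and z :: 'a assume t: "t \<in> {0..T}" and th: "\<theta> \<in> {0..1}"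
  have "\<bar>2 * t * \<theta>\<bar> \<le> 2 * t * 1" using t th by (auto simp: abs_mult mult_left_le)
  also have "\<dots> = 2 * (sqrt t * sqrt t)" using t by simp
  also have "\<dots> \<le> 2 * (sqrt T * sqrt t)" using t by (intro mult_left_mono mult_right_mono) auto
  also have "\<dots> \<le> (2 * sqrt T + 2 / \<sigma>) * sqrt t * 1" using t that by (simp add: algebra_simps)
  also have "\<dots> \<le> (2 * sqrt T + 2 / \<sigma>) * sqrt t * (1 + norm z)" using t that by (intro mult_left_mono) auto
  finally show "\<bar>2 * t * \<theta>\<bar> \<le> (2 * sqrt T + 2 / \<sigma>) * sqrt t * (1 + norm z)" .
qed (use that in \<open>auto intro!: continuous_intros simp: case_prod_beta'\<close>)

lemma ker_grad: "ker T (2 * sqrt T + 2 / \<sigma>) (grad_ker \<sigma> b)" if "T \<ge> 0" "\<sigma> > 0" "b \<in> Basis"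
  unfolding ker_def grad_ker_def
proof (intro conjI ballI allI)
  fix t \<theta> :: real and z :: 'a assume t: "t \<in> {0..T}" and th: "\<theta> \<in> {0..1}"
  have "\<bar>2 / \<sigma> * sqrt t * (z \<bullet> b)\<bar> = 2 / \<sigma> * sqrt t * \<bar>z \<bullet> b\<bar>" using t that by (simp add: abs_mult)
  also have "\<dots> \<le> (2 * sqrt T + 2 / \<sigma>) * sqrt t * (1 + norm z)"
    using t that Basis_le_norm[OF that(3), of z] by (intro mult_mono) auto
  finally show "\<bar>2 / \<sigma> * sqrt t * (z \<bullet> b)\<bar> \<le> (2 * sqrt T + 2 / \<sigma>) * sqrt t * (1 + norm z)" .
qed (use that in \<open>auto intro!: continuous_intros simp: case_prod_beta'\<close>)

text \<open>For fixed \<theta>, Stein's identity for z |-> G(x + c z) with c = \<sigma> sqrt t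
  \<theta> trades the factor c and the derivative for z . b. As 2t\<theta> = (2/\<sigma>) sqrt t c,
  the \<theta> of the Jacobian is used up exactly and no negative power of \<theta> appears.\<close>

lemma duh_pd_eq_grad:
  fixes G :: "real \<Rightarrow> 'a::euclidean_space \<Rightarrow> 'b::euclidean_space"
  assumes t: "t \<in> {0..T}" and s: "\<sigma> > 0" and b: "b \<in> Basis"
    and G: "bcont C G" and G': "bcont C' G'" and d: "\<And>s. has_pd (G s) b (G' s)"
  shows "kint duh_ker \<sigma> G' t x = kint (grad_ker \<sigma> b) \<sigma> G t x"
proof -
  have T: "T \<ge> 0" using t by auto
  note i1 = kint_integrable[OF ker_duh[OF T s] G' t]
  note i2 = kint_integrable[OF ker_grad[OF T s b] G t]
  have "(\<integral>z. (2 * t * \<theta>) *\<^sub>R G' r (x + (\<sigma> * sqrt t * \<theta>) *\<^sub>R z) \<partial>gauss)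
      = (\<integral>z. (2 / \<sigma> * sqrt t * (z \<bullet> b)) *\<^sub>R G r (x + (\<sigma> * sqrt t * \<theta>) *\<^sub>R z) \<partial>gauss)" for \<theta> r
  proof -
    let ?c = "\<sigma> * sqrt t * \<theta>"
    have "(\<integral>z. (z \<bullet> b) *\<^sub>R G r (x + ?c *\<^sub>R z) \<partial>gauss) = (\<integral>z. ?c *\<^sub>R G' r (x + ?c *\<^sub>R z) \<partial>gauss)"
    proof (rule gauss_stein[OF b, where C="max C (\<bar>?c\<bar> * C')"])
      show "has_pd (\<lambda>z. G r (x + ?c *\<^sub>R z)) b (\<lambda>z. ?c *\<^sub>R G' r (x + ?c *\<^sub>R z))"
        unfolding has_pd_def
      proof
        fix z
        have 1: "((\<lambda>q. ?c * q) has_vector_derivative ?c) (at 0)"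
          by (auto intro!: derivative_eq_intros)
        have 2: "((\<lambda>q. G r (x + ?c *\<^sub>R z + q *\<^sub>R b)) has_vector_derivative G' r (x + ?c *\<^sub>R z)) (at (?c * 0))"
          using d[of r] by (simp add: has_pd_def)
        show "((\<lambda>q. G r (x + ?c *\<^sub>R (z + q *\<^sub>R b))) has_vector_derivative ?c *\<^sub>R G' r (x + ?c *\<^sub>R z)) (at 0)"
          using vector_diff_chain_at[OF 1 2] by (simp add: o_def scaleR_add_right add.assoc)
      qed
      show "norm (?c *\<^sub>R G' r (x + ?c *\<^sub>R y)) \<le> max C (\<bar>?c\<bar> * C')" for y
        using mult_left_mono[OF bcont_norm[OF G', of r "x + ?c *\<^sub>R y"], of "\<bar>?c\<bar>"] by simp
      show "norm (G r (x + ?c *\<^sub>R y)) \<le> max C (\<bar>?c\<bar> * C')" for y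
        using bcont_norm[OF G] by (simp add: le_max_iff_disj)
    qed (intro continuous_intros bcont_continuous[OF G] bcont_continuous[OF G'])+
    then have "(2 / \<sigma> * sqrt t) *\<^sub>R (\<integral>z. (z \<bullet> b) *\<^sub>R G r (x + ?c *\<^sub>R z) \<partial>gauss)
        = (2 / \<sigma> * sqrt t) *\<^sub>R (\<integral>z. ?c *\<^sub>R G' r (x + ?c *\<^sub>R z) \<partial>gauss)" by simp
    moreover have "2 / \<sigma> * sqrt t * ?c = 2 * t * \<theta>" using t s by simp
    ultimately show ?thesis
      by (simp only: scaleR_scaleR integral_scaleR_right[symmetric])
  qed
  then show ?thesis
    unfolding kint_def ugauss_fubini[OF i1] ugauss_fubini[OF i2]
    by (simp add: duh_ker_def grad_ker_def)
qed

section \<open>The heat equation\<close>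

text \<open>The increment is split along the coordinates, moving one at a time. On each piece the
  mean value inequality is applied to \<phi> minus its linear part, whose derivative is small
  because the partial derivatives are continuous at x.\<close>

lemma has_derivative_from_partials:
  fixes \<phi> :: "'a::euclidean_space \<Rightarrow> 'b::real_normed_vector"
  assumes d: "\<And>b. b \<in> Basis \<Longrightarrow> has_pd \<phi> b (\<phi>' b)"
    and c: "\<And>b. b \<in> Basis \<Longrightarrow> isCont (\<phi>' b) x"
  shows "(\<phi> has_derivative (\<lambda>h. \<Sum>b\<in>Basis. (h \<bullet> b) *\<^sub>R \<phi>' b x)) (at x)"
  unfolding has_derivative_at_alt
proof (intro conjI allI impI)
  show "bounded_linear (\<lambda>h. \<Sum>b\<in>Basis. (h \<bullet> b) *\<^sub>R \<phi>' b x)"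
    by (intro bounded_linear_sum bounded_linear_compose[OF bounded_linear_scaleR_left] bounded_linear_inner_left)
next
  fix e :: real assume e: "e > 0"
  \<comment> \<open>Each of the \<open>DIM('a)\<close> coordinates contributes at most e' times the
    norm of the increment.\<close>
  define e' where "e' = e / DIM('a)"
  have e': "e' > 0" using e by (simp add: e'_def)
  have "\<forall>\<^sub>F y in nhds x. \<forall>b\<in>Basis. dist (\<phi>' b y) (\<phi>' b x) < e'"
    using c e' unfolding isCont_def tendsto_at_iff_tendsto_nhds
    by (intro eventually_ball_finite finite_Basis ballI) (auto intro: tendstoD)
  then obtain \<delta> where \<delta>: "\<delta> > 0" "\<And>y b. dist y x < \<delta> \<Longrightarrow> b \<in> Basis \<Longrightarrow> dist (\<phi>' b y) (\<phi>' b x) < e'"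
    unfolding eventually_nhds_metric by auto
  have main: "norm (\<phi> (x + (\<Sum>b\<in>S. (h \<bullet> b) *\<^sub>R b)) - \<phi> x - (\<Sum>b\<in>S. (h \<bullet> b) *\<^sub>R \<phi>' b x)) \<le> e' * (\<Sum>b\<in>S. \<bar>h \<bullet> b\<bar>)"
    if h: "norm h < \<delta>" and S: "S \<subseteq> Basis" for h S
    using finite_subset[OF S finite_Basis] S
  proof (induction S rule: finite_induct)
    case empty
    then show ?case by simp
  next
    case (insert k S)
    let ?w = "x + (\<Sum>b\<in>S. (h \<bullet> b) *\<^sub>R b)"
    have k: "k \<in> Basis" and SB: "S \<subseteq> Basis" using insert.prems by auto
    \<comment> \<open>Each component of the intermediate displacement is bounded by that of h, so
      the whole path stays in the \<delta>-ball.\<close>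
    have near: "dist (?w + r *\<^sub>R k) x < \<delta>" if r: "r \<in> closed_segment 0 (h \<bullet> k)" for r
    proof -
      have r': "\<bar>r\<bar> \<le> \<bar>h \<bullet> k\<bar>" using r by (auto simp: closed_segment_eq_real_ivl split: if_splits)
      have "norm ((\<Sum>b\<in>S. (h \<bullet> b) *\<^sub>R b) + r *\<^sub>R k) \<le> norm h"
      proof (rule norm_le_componentwise)
        fix i :: 'a assume i: "i \<in> Basis"
        have "(\<Sum>b\<in>S. (h \<bullet> b) * (b \<bullet> i)) = (\<Sum>b\<in>S. if b = i then h \<bullet> i else 0)"
          using i SB by (intro sum.cong) (auto simp: inner_Basis)
        also have "\<dots> = (if i \<in> S then h \<bullet> i else 0)"
          using insert.hyps by (simp add: sum.delta)
        finally have "((\<Sum>b\<in>S. (h \<bullet> b) *\<^sub>R b) + r *\<^sub>R k) \<bullet> i = (if i \<in> S then h \<bullet> i else 0) + r * (k \<bullet> i)"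
          by (simp add: inner_add_left inner_sum_left)
        then show "\<bar>((\<Sum>b\<in>S. (h \<bullet> b) *\<^sub>R b) + r *\<^sub>R k) \<bullet> i\<bar> \<le> \<bar>h \<bullet> i\<bar>"
          using insert.hyps i k r' by (auto simp: inner_Basis)
      qed
      then show ?thesis using h by (simp add: dist_norm add.assoc)
    qed
    let ?g = "\<lambda>r. \<phi> (?w + r *\<^sub>R k) - r *\<^sub>R \<phi>' k x"
    have g: "norm (?g (h \<bullet> k) - ?g 0) \<le> e' * norm (h \<bullet> k - 0)"
    proof (rule differentiable_bound[of "closed_segment 0 (h \<bullet> k)" _ "\<lambda>r s. s *\<^sub>R (\<phi>' k (?w + r *\<^sub>R k) - \<phi>' k x)"])
      fix r assume r: "r \<in> closed_segment 0 (h \<bullet> k)"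
      have "(?g has_vector_derivative (\<phi>' k (?w + r *\<^sub>R k) - \<phi>' k x)) (at r within closed_segment 0 (h \<bullet> k))"
        by (auto intro!: derivative_eq_intros has_vector_derivative_at_within[OF has_pd_at[OF d[OF k]]])
      then show "(?g has_derivative (\<lambda>s. s *\<^sub>R (\<phi>' k (?w + r *\<^sub>R k) - \<phi>' k x))) (at r within closed_segment 0 (h \<bullet> k))"
        by (simp add: has_vector_derivative_def)
      show "onorm (\<lambda>s. s *\<^sub>R (\<phi>' k (?w + r *\<^sub>R k) - \<phi>' k x)) \<le> e'"
        using \<delta>(2)[OF near[OF r] k]
        by (intro onorm_le) (auto simp: dist_norm mult.commute[of e'] intro!: mult_left_mono)
    qed auto
    have eq: "\<phi> (x + (\<Sum>b\<in>insert k S. (h \<bullet> b) *\<^sub>R b)) - \<phi> x - (\<Sum>b\<in>insert k S. (h \<bullet> b) *\<^sub>R \<phi>' b x)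
        = (?g (h \<bullet> k) - ?g 0) + (\<phi> ?w - \<phi> x - (\<Sum>b\<in>S. (h \<bullet> b) *\<^sub>R \<phi>' b x))"
      using insert.hyps by (simp add: add_ac)
    from norm_triangle_mono[OF g insert.IH[OF SB]] show ?case
      unfolding eq using insert.hyps by (simp add: distrib_left)
  qed
  show "\<exists>d>0. \<forall>y. norm (y - x) < d \<longrightarrow>
      norm (\<phi> y - \<phi> x - (\<Sum>b\<in>Basis. ((y - x) \<bullet> b) *\<^sub>R \<phi>' b x)) \<le> e * norm (y - x)"
  proof (intro exI[of _ \<delta>] conjI allI impI)
    fix y assume y: "norm (y - x) < \<delta>"
    have "norm (\<phi> y - \<phi> x - (\<Sum>b\<in>Basis. ((y - x) \<bullet> b) *\<^sub>R \<phi>' b x)) \<le> e' * (\<Sum>b\<in>Basis. \<bar>(y - x) \<bullet> b\<bar>)"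
      using main[OF y order_refl] by (simp add: euclidean_representation)
    also have "\<dots> \<le> e' * (\<Sum>b\<in>(Basis::'a set). norm (y - x))"
      using e' by (intro mult_left_mono sum_mono Basis_le_norm) auto
    also have "\<dots> = e * norm (y - x)" by (simp add: e'_def)
    finally show "norm (\<phi> y - \<phi> x - (\<Sum>b\<in>Basis. ((y - x) \<bullet> b) *\<^sub>R \<phi>' b x)) \<le> e * norm (y - x)" .
  qed (rule \<delta>)
qed

text \<open>The change of variables r = t(1 - \<theta>^2) is made through the antiderivative \<Phi>:
  the left integrand is the derivative of -\<Phi>(t(1 - \<theta>^2)), because sqrt(t - r) = sqrt t
  \<theta>. In the application S q r averages G(r) over a Gaussian of scale \<sigma> q.\<close>

lemma duhamel_substitution:
  fixes S :: "real \<Rightarrow> real \<Rightarrow> 'b::euclidean_space"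
  assumes cS: "continuous_on UNIV (\<lambda>(q, r). S q r)" and t: "t \<ge> 0"
  shows "(\<integral>\<theta>. (2 * t * \<theta>) *\<^sub>R S (sqrt t * \<theta>) (t * (1 - \<theta>\<^sup>2)) \<partial>unif) = integral {0..t} (\<lambda>r. S (sqrt (t - r)) r)"
proof -
  have cS': "continuous_on A (\<lambda>p. S (f p) (g p))" if "continuous_on A f" "continuous_on A g" for A :: "real set" and f g
    using continuous_on_compose2[OF cS, of A "\<lambda>p. (f p, g p)"] that by (auto intro!: continuous_intros)
  define \<Phi> where "\<Phi> \<tau> = integral {0..\<tau>} (\<lambda>r. S (sqrt (t - r)) r)" for \<tau>
  have d\<Phi>: "(\<Phi> has_vector_derivative S (sqrt (t - \<tau>)) \<tau>) (at \<tau> within {0..t})" if "\<tau> \<in> {0..t}" for \<tau>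
    unfolding \<Phi>_def using that
    by (intro integral_has_vector_derivative cS' continuous_intros)
  have "(\<integral>\<theta>. (2 * t * \<theta>) *\<^sub>R S (sqrt t * \<theta>) (t * (1 - \<theta>\<^sup>2)) \<partial>unif)
      = (\<integral>\<theta>. indicator {0..1} \<theta> *\<^sub>R ((2 * t * \<theta>) *\<^sub>R S (sqrt t * \<theta>) (t * (1 - \<theta>\<^sup>2))) \<partial>lborel)"
    unfolding unif_def by (subst integral_restrict_space) auto
  also have "\<dots> = - \<Phi> (t * (1 - 1\<^sup>2)) - (- \<Phi> (t * (1 - 0\<^sup>2)))"
  proof (rule integral_FTC_Icc[where F="\<lambda>\<theta>. - \<Phi> (t * (1 - \<theta>\<^sup>2))"])
    show "continuous_on {0..1} (\<lambda>\<theta>. (2 * t * \<theta>) *\<^sub>R S (sqrt t * \<theta>) (t * (1 - \<theta>\<^sup>2)))"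
      by (intro continuous_intros cS')
    fix \<theta> :: real assume th: "0 \<le> \<theta>" "\<theta> \<le> 1"
    have sub: "(\<lambda>\<theta>. t * (1 - \<theta>\<^sup>2)) ` {0..1} \<subseteq> {0..t}"
      using t by (auto intro!: mult_nonneg_nonneg mult_left_le simp: power_le_one)
    have 1: "((\<lambda>\<theta>. t * (1 - \<theta>\<^sup>2)) has_vector_derivative (- (2 * t * \<theta>))) (at \<theta> within {0..1})"
      unfolding has_real_derivative_iff_has_vector_derivative[symmetric]
      by (auto intro!: derivative_eq_intros)
    have 2: "(\<Phi> has_vector_derivative S (sqrt (t - t * (1 - \<theta>\<^sup>2))) (t * (1 - \<theta>\<^sup>2))) (at (t * (1 - \<theta>\<^sup>2)) within (\<lambda>\<theta>. t * (1 - \<theta>\<^sup>2)) ` {0..1})"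
      using sub th by (intro has_vector_derivative_within_subset[OF d\<Phi>]) (auto simp: image_subset_iff)
    have 3: "sqrt (t - t * (1 - \<theta>\<^sup>2)) = sqrt t * \<theta>"
      using th by (simp add: algebra_simps real_sqrt_mult)
    from vector_diff_chain_within[OF 1 2]
    have "((\<lambda>\<theta>. \<Phi> (t * (1 - \<theta>\<^sup>2))) has_vector_derivative (- (2 * t * \<theta>)) *\<^sub>R S (sqrt t * \<theta>) (t * (1 - \<theta>\<^sup>2))) (at \<theta> within {0..1})"
      by (simp add: o_def 3)
    from has_vector_derivative_minus[OF this]
    show "((\<lambda>\<theta>. - \<Phi> (t * (1 - \<theta>\<^sup>2))) has_vector_derivative (2 * t * \<theta>) *\<^sub>R S (sqrt t * \<theta>) (t * (1 - \<theta>\<^sup>2))) (at \<theta> within {0..1})"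
      by simp
  qed simp
  finally show ?thesis by (simp add: \<Phi>_def)
qed

text \<open>With q = sqrt s \<theta> the left-hand side is the integral of Q(q, s - q^2) over 0 <=
  q, q^2 <= s <= t. Setting r = s - q^2 turns the region into 0 <= q, 0 <= r, r + q^2 <= t, where
  the q-integral is S(sqrt(t - r), r) - S(0, r). The variable q is the square root of elapsed time,
  in which the derivative Q is continuous up to q = 0.\<close>

lemma duhamel_fubini:
  fixes S Q :: "real \<Rightarrow> real \<Rightarrow> 'b::euclidean_space"
  assumes cQ: "continuous_on UNIV (\<lambda>(q, r). Q q r)"
    and t: "t \<ge> 0"
    and d: "\<And>q r. ((\<lambda>q. S q r) has_vector_derivative Q q r) (at q)"
  shows "((\<lambda>s. \<integral>\<theta>. sqrt s *\<^sub>R Q (sqrt s * \<theta>) (s * (1 - \<theta>\<^sup>2)) \<partial>unif)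
      has_integral integral {0..t} (\<lambda>r. S (sqrt (t - r)) r - S 0 r)) {0..t}"
proof -
  have cQ': "continuous_on A (\<lambda>p. Q (f p) (g p))" if "continuous_on A f" "continuous_on A g" for A :: "'c::topological_space set" and f g
    using continuous_on_compose2[OF cQ, of A "\<lambda>p. (f p, g p)"] that by (auto intro!: continuous_intros)
  define D where "D = {(s, q). 0 \<le> q \<and> q\<^sup>2 \<le> s \<and> s \<le> t}"
  define F where "F s q = indicator D (s, q) *\<^sub>R Q q (s - q\<^sup>2)" for s q :: real
  define D' where "D' = {(q, r). 0 \<le> q \<and> 0 \<le> r \<and> r + q\<^sup>2 \<le> t}"
  define F' where "F' q r = indicator D' (q, r) *\<^sub>R Q q r" for r q :: real
  have q_le: "q \<le> sqrt t" if "q\<^sup>2 \<le> t" for q using that real_le_rsqrt by blast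
  have closedD: "closed D"
    unfolding D_def case_prod_beta' by (intro closed_Collect_conj closed_Collect_le continuous_intros)
  have closedD': "closed D'"
    unfolding D'_def case_prod_beta' by (intro closed_Collect_conj closed_Collect_le continuous_intros)
  have subD: "D \<subseteq> cbox (0, 0) (t, sqrt t)"
  proof
    fix p assume "p \<in> D"
    then obtain s q where p: "p = (s, q)" "0 \<le> q" "q\<^sup>2 \<le> s" "s \<le> t" by (auto simp: D_def)
    then show "p \<in> cbox (0, 0) (t, sqrt t)"
      using q_le[of q] order_trans[OF zero_le_power2[of q], of s] by (auto simp: cbox_Pair_eq)
  qed
  have subD': "D' \<subseteq> cbox (0, 0) (sqrt t, t)"
  proof
    fix p assume "p \<in> D'"
    then obtain s q where p: "p = (q, s)" "0 \<le> q" "0 \<le> s" "s + q\<^sup>2 \<le> t" by (auto simp: D'_def)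
    moreover have "q\<^sup>2 \<le> t" "s \<le> t" using p zero_le_power2[of q] by linarith+
    ultimately show "p \<in> cbox (0, 0) (sqrt t, t)" using q_le[of q] by (auto simp: cbox_Pair_eq)
  qed
  have compD: "compact D" using closedD subD bounded_subset[OF bounded_cbox] by (simp add: compact_eq_bounded_closed)
  have compD': "compact D'" using closedD' subD' bounded_subset[OF bounded_cbox] by (simp add: compact_eq_bounded_closed)
  have iF: "integrable (lborel \<Otimes>\<^sub>M lborel) (case_prod F)"
  proof -
    have "set_integrable lborel D (\<lambda>(s, q). Q q (s - q\<^sup>2))"
      unfolding case_prod_beta'
      by (rule borel_integrable_compact[OF compD, folded set_integrable_def]) (intro cQ' continuous_intros)
    then show ?thesis by (simp add: set_integrable_def lborel_prod F_def case_prod_beta')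
  qed
  have iF': "integrable (lborel \<Otimes>\<^sub>M lborel) (case_prod F')"
  proof -
    have "set_integrable lborel D' (\<lambda>(q, r). Q q r)"
      unfolding case_prod_beta'
      by (rule borel_integrable_compact[OF compD', folded set_integrable_def]) (intro cQ' continuous_intros)
    then show ?thesis by (simp add: set_integrable_def lborel_prod F'_def case_prod_beta')
  qed
  have inner1: "(\<integral>q. F s q \<partial>lborel) = indicator {0..t} s *\<^sub>R (\<integral>\<theta>. sqrt s *\<^sub>R Q (sqrt s * \<theta>) (s * (1 - \<theta>\<^sup>2)) \<partial>unif)" for s
  proof -
    consider "s \<notin> {0..t}" | "s = 0" "s \<in> {0..t}" | "s > 0" "s \<le> t" by force
    then show ?thesis
    proof cases
      case 1
      have "(s, q) \<notin> D" for q using 1 order_trans[OF zero_le_power2[of q], of s] by (auto simp: D_def)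
      then show ?thesis using 1 by (simp add: F_def)
    next
      \<comment> \<open>The slice of \<open>D\<close> at s = 0 is the single point q = 0, where
        scaling by sqrt s is impossible; it is a null set.\<close>
      case 2
      have "AE q in lborel. F s q = 0"
        using AE_lborel_singleton[of "0::real"] by eventually_elim (auto simp: F_def D_def 2)
      then have "(\<integral>q. F s q \<partial>lborel) = 0" by (rule integral_eq_zero_AE)
      then show ?thesis using 2 by simp
    next
      case 3
      have "(\<integral>q. F s q \<partial>lborel) = \<bar>sqrt s\<bar> *\<^sub>R (\<integral>\<theta>. F s (0 + sqrt s * \<theta>) \<partial>lborel)"
        using 3 by (intro lborel_integral_real_affine) auto
      also have "\<dots> = (\<integral>\<theta>. sqrt s *\<^sub>R F s (sqrt s * \<theta>) \<partial>lborel)" using 3 by simp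
      also have "\<dots> = (\<integral>\<theta>. indicator {0..1} \<theta> *\<^sub>R (sqrt s *\<^sub>R Q (sqrt s * \<theta>) (s * (1 - \<theta>\<^sup>2))) \<partial>lborel)"
      proof (intro Bochner_Integration.integral_cong refl)
        fix \<theta> :: real
        have e: "(sqrt s * \<theta>)\<^sup>2 = s * \<theta>\<^sup>2" using 3 by (simp add: power_mult_distrib)
        have "(s, sqrt s * \<theta>) \<in> D \<longleftrightarrow> \<theta> \<in> {0..1}"
        proof -
          have "0 \<le> sqrt s * \<theta> \<longleftrightarrow> 0 \<le> \<theta>" using 3 by (simp add: zero_le_mult_iff)
          moreover have "s * \<theta>\<^sup>2 \<le> s \<longleftrightarrow> \<theta>\<^sup>2 \<le> 1" using 3 by simp
          moreover have "0 \<le> \<theta> \<Longrightarrow> \<theta>\<^sup>2 \<le> 1 \<longleftrightarrow> \<theta> \<le> 1" by (simp add: abs_square_le_1)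
          ultimately show ?thesis using 3 by (auto simp: D_def e)
        qed
        then show "sqrt s *\<^sub>R F s (sqrt s * \<theta>) = indicator {0..1} \<theta> *\<^sub>R (sqrt s *\<^sub>R Q (sqrt s * \<theta>) (s * (1 - \<theta>\<^sup>2)))"
          by (simp add: F_def e right_diff_distrib split: split_indicator)
      qed
      also have "\<dots> = (\<integral>\<theta>. sqrt s *\<^sub>R Q (sqrt s * \<theta>) (s * (1 - \<theta>\<^sup>2)) \<partial>unif)"
        unfolding unif_def by (subst integral_restrict_space) auto
      finally show ?thesis using 3 by simp
    qed
  qed
  have inner2: "(\<integral>s. F s q \<partial>lborel) = (\<integral>r. F' q r \<partial>lborel)" for q
  proof -
    have "(\<integral>s. F s q \<partial>lborel) = \<bar>1\<bar> *\<^sub>R (\<integral>r. F (q\<^sup>2 + 1 * r) q \<partial>lborel)"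
      by (intro lborel_integral_real_affine) auto
    also have "\<dots> = (\<integral>r. F' q r \<partial>lborel)"
      by (simp add: F_def F'_def D_def D'_def add_ac) (auto intro!: Bochner_Integration.integral_cong simp: indicator_def)
    finally show ?thesis .
  qed
  have inner3: "(\<integral>q. F' q r \<partial>lborel) = indicator {0..t} r *\<^sub>R (S (sqrt (t - r)) r - S 0 r)" for r
  proof (cases "r \<in> {0..t}")
    case False
    have "(q, r) \<notin> D'" for q
    proof
      assume "(q, r) \<in> D'"
      then have "0 \<le> r" "r + q\<^sup>2 \<le> t" by (auto simp: D'_def)
      moreover have "r \<le> r + q\<^sup>2" by simp
      ultimately have "0 \<le> r" "r \<le> t" by linarith+
      then show False using False by simp
    qed
    then show ?thesis using False by (simp add: F'_def)
  next
    case True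
    have "(q, r) \<in> D' \<longleftrightarrow> q \<in> {0..sqrt (t - r)}" for q
    proof
      assume "(q, r) \<in> D'"
      then show "q \<in> {0..sqrt (t - r)}" by (auto simp: D'_def intro!: real_le_rsqrt)
    next
      assume "q \<in> {0..sqrt (t - r)}"
      then have "0 \<le> q" "q\<^sup>2 \<le> t - r" using True
        by (auto dest: power_mono[where n=2])
      then show "(q, r) \<in> D'" using True by (auto simp: D'_def)
    qed
    then have "(\<integral>q. F' q r \<partial>lborel) = (\<integral>q. indicator {0..sqrt (t - r)} q *\<^sub>R Q q r \<partial>lborel)"
      by (intro Bochner_Integration.integral_cong) (auto simp: F'_def indicator_def)
    also have "\<dots> = S (sqrt (t - r)) r - S 0 r"
      using True by (intro integral_FTC_Icc has_vector_derivative_at_within[OF d] cQ' continuous_intros) auto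
    finally show ?thesis using True by simp
  qed
  have "(\<integral>s. (\<integral>q. F s q \<partial>lborel) \<partial>lborel) = (\<integral>q. (\<integral>s. F s q \<partial>lborel) \<partial>lborel)"
    by (rule lborel_pair.Fubini_integral[OF iF, symmetric])
  also have "\<dots> = (\<integral>q. (\<integral>r. F' q r \<partial>lborel) \<partial>lborel)" by (simp add: inner2)
  also have "\<dots> = (\<integral>r. (\<integral>q. F' q r \<partial>lborel) \<partial>lborel)"
    by (rule lborel_pair.Fubini_integral[OF iF', symmetric])
  finally have eq: "(\<integral>s. indicator {0..t} s *\<^sub>R (\<integral>\<theta>. sqrt s *\<^sub>R Q (sqrt s * \<theta>) (s * (1 - \<theta>\<^sup>2)) \<partial>unif) \<partial>lborel)
      = (\<integral>r. indicator {0..t} r *\<^sub>R (S (sqrt (t - r)) r - S 0 r) \<partial>lborel)"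
    by (simp only: inner1 inner3)
  have i1: "set_integrable lborel {0..t} (\<lambda>s. \<integral>\<theta>. sqrt s *\<^sub>R Q (sqrt s * \<theta>) (s * (1 - \<theta>\<^sup>2)) \<partial>unif)"
    using lborel_pair.integrable_fst'[OF iF] by (simp add: inner1 set_integrable_def)
  have i2: "set_integrable lborel {0..t} (\<lambda>r. S (sqrt (t - r)) r - S 0 r)"
    using lborel_pair.integrable_snd[OF iF'] by (simp add: inner3 set_integrable_def)
  show ?thesis
    using integrable_integral[OF set_borel_integral_eq_integral(1)[OF i1]] eq
    unfolding set_borel_integral_eq_integral(2)[OF i1, symmetric] set_borel_integral_eq_integral(2)[OF i2, symmetric]
    by (simp add: set_lebesgue_integral_def)
qed

lemma line_has_vector_derivative:
  fixes \<phi> :: "'a::euclidean_space \<Rightarrow> 'b::real_normed_vector"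
  assumes d: "\<And>b. b \<in> Basis \<Longrightarrow> has_pd \<phi> b (\<phi>' b)"
    and c: "\<And>b. b \<in> Basis \<Longrightarrow> continuous_on UNIV (\<phi>' b)"
  shows "((\<lambda>q. \<phi> (x + (\<sigma> * q) *\<^sub>R z)) has_vector_derivative
      (\<Sum>b\<in>Basis. (\<sigma> * (z \<bullet> b)) *\<^sub>R \<phi>' b (x + (\<sigma> * q) *\<^sub>R z))) (at q)"
proof -
  have 1: "((\<lambda>q. x + (\<sigma> * q) *\<^sub>R z) has_derivative (\<lambda>s. (\<sigma> * s) *\<^sub>R z)) (at q)"
    by (auto intro!: derivative_eq_intros)
  have 2: "(\<phi> has_derivative (\<lambda>h. \<Sum>b\<in>Basis. (h \<bullet> b) *\<^sub>R \<phi>' b (x + (\<sigma> * q) *\<^sub>R z))) (at (x + (\<sigma> * q) *\<^sub>R z))"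
    using c by (intro has_derivative_from_partials d) (auto simp: continuous_on_eq_continuous_at)
  have 3: "(\<Sum>b\<in>Basis. (((\<sigma> * s) *\<^sub>R z) \<bullet> b) *\<^sub>R \<phi>' b (x + (\<sigma> * q) *\<^sub>R z))
      = s *\<^sub>R (\<Sum>b\<in>Basis. (\<sigma> * (z \<bullet> b)) *\<^sub>R \<phi>' b (x + (\<sigma> * q) *\<^sub>R z))" for s
    by (simp add: scaleR_sum_right mult_ac)
  from diff_chain_at[OF 1 2] show ?thesis
    by (simp only: has_vector_derivative_def o_def 3)
qed

lemma bcont_slice: "bcont C G \<Longrightarrow> continuous_on UNIV (G r)"
  by (rule bcont_continuous) (auto intro: continuous_intros)

lemma bcont_mono: "bcont C G \<Longrightarrow> C \<le> C' \<Longrightarrow> bcont C' G"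
  unfolding bcont_def by (meson order_trans)

lemma integrable_gauss_bcont:
  assumes "bcont C G"
  shows "integrable gauss (\<lambda>z. G r (x + c *\<^sub>R z))"
proof -
  interpret prob_space "gauss :: 'a measure" by (rule prob_space_gauss)
  show ?thesis
    by (rule integrable_const_bound[where B=C])
       (auto intro!: AE_I2 bcont_norm[OF assms] borel_measurable_continuous_onI bcont_continuous[OF assms] continuous_intros
         simp: measurable_cong_sets[OF sets_gauss refl])
qed

lemma gauss_weight_bound:
  assumes G: "bcont C G" and b: "b \<in> Basis"
  shows "norm ((z \<bullet> b) *\<^sub>R G r y) \<le> C * norm z"
proof -
  have "\<bar>z \<bullet> b\<bar> * norm (G r y) \<le> norm z * C"
    using Basis_le_norm[OF b, of z] bcont_norm[OF G] by (intro mult_mono) auto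
  then show ?thesis by (simp add: mult.commute)
qed

lemma measurable_gauss_weight:
  assumes G: "bcont C G"
  shows "(\<lambda>z. (z \<bullet> b) *\<^sub>R G r (x + c *\<^sub>R z)) \<in> borel_measurable gauss"
  unfolding measurable_cong_sets[OF sets_gauss refl]
  by (intro borel_measurable_continuous_onI bcont_continuous[OF G] continuous_intros)

lemma integrable_gauss_weight:
  fixes G :: "real \<Rightarrow> 'a::euclidean_space \<Rightarrow> 'b::euclidean_space"
  assumes G: "bcont C G" and b: "b \<in> Basis"
  shows "integrable gauss (\<lambda>z. (z \<bullet> b) *\<^sub>R G r (x + c *\<^sub>R z))"
  by (rule Bochner_Integration.integrable_bound[where f="\<lambda>z. C * norm z"])
     (use gauss_weight_bound[OF G b] bcont_nonneg[OF G] in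
       \<open>auto intro!: AE_I2 integrable_gauss_norm measurable_gauss_weight[OF G] simp: abs_mult\<close>)

text \<open>The derivative of $q \mapsto \int G(r, x + \sigma q z)\,d\gamma(z)$, with \<open>G' b\<close> in the role of $\partial_b G$.\<close>

definition gQ :: "real \<Rightarrow> ('a \<Rightarrow> real \<Rightarrow> 'a \<Rightarrow> 'b) \<Rightarrow> 'a::euclidean_space \<Rightarrow> real \<Rightarrow> real \<Rightarrow> 'b::euclidean_space" where
  "gQ \<sigma> G' x q r = (\<Sum>b\<in>Basis. \<sigma> *\<^sub>R (\<integral>z. (z \<bullet> b) *\<^sub>R G' b r (x + (\<sigma> * q) *\<^sub>R z) \<partial>gauss))"

text \<open>In q the derivative has first order in \<open>G\<close>, carries the weight z, and holds
  at q = 0 as well. In the time variable q^2 a factor 1/q would appear.\<close>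

lemma gauss_average_has_derivative:
  fixes G :: "real \<Rightarrow> 'a::euclidean_space \<Rightarrow> 'b::euclidean_space"
  assumes G: "bcont C G" and G': "\<And>b. b \<in> Basis \<Longrightarrow> bcont C (G' b)"
    and d: "\<And>b. b \<in> Basis \<Longrightarrow> has_pd (G r) b (G' b r)"
  shows "((\<lambda>q. \<integral>z. G r (x + (\<sigma> * q) *\<^sub>R z) \<partial>gauss) has_vector_derivative gQ \<sigma> G' x q r) (at q)"
proof -
  let ?D = "\<lambda>q z. \<Sum>b\<in>Basis. \<sigma> *\<^sub>R ((z \<bullet> b) *\<^sub>R G' b r (x + (\<sigma> * q) *\<^sub>R z))"
  have "((\<lambda>q. \<integral>z. G r (x + (\<sigma> * q) *\<^sub>R z) \<partial>gauss) has_vector_derivative (\<integral>z. ?D q z \<partial>gauss)) (at q)"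
  proof (rule has_vector_derivative_integral_dominated[where w="\<lambda>z. (\<Sum>b\<in>(Basis::'a set). \<bar>\<sigma>\<bar> * C) * norm z"])
    show "((\<lambda>q. G r (x + (\<sigma> * q) *\<^sub>R z)) has_vector_derivative ?D q z) (at q)" for q z
      using line_has_vector_derivative[where \<sigma>=\<sigma> and x=x and q=q and z=z, OF d bcont_slice[OF G']] by simp
    show "norm (?D q z) \<le> (\<Sum>b\<in>(Basis::'a set). \<bar>\<sigma>\<bar> * C) * norm z" for q z
      unfolding sum_distrib_right
    proof (rule order_trans[OF norm_sum sum_mono])
      fix b :: 'a assume b: "b \<in> Basis"
      show "norm (\<sigma> *\<^sub>R ((z \<bullet> b) *\<^sub>R G' b r (x + (\<sigma> * q) *\<^sub>R z))) \<le> \<bar>\<sigma>\<bar> * C * norm z"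
        unfolding norm_scaleR[of \<sigma>] mult.assoc by (rule mult_left_mono[OF gauss_weight_bound[OF G'[OF b] b]]) simp
    qed
    show "?D q \<in> borel_measurable gauss"
      by (intro borel_measurable_sum borel_measurable_scaleR[OF borel_measurable_const measurable_gauss_weight[OF G']])
  qed (auto intro!: integrable_gauss_norm integrable_gauss_bcont[OF G])
  also have "(\<integral>z. ?D q z \<partial>gauss) = gQ \<sigma> G' x q r"
    unfolding gQ_def
    by (subst Bochner_Integration.integral_sum)
       (auto intro!: integrable_scaleR_right integrable_gauss_weight[OF G'] simp del: scaleR_scaleR)
  finally show ?thesis .
qed

lemma gauss_average_continuous:
  fixes G :: "real \<Rightarrow> 'a::euclidean_space \<Rightarrow> 'b::euclidean_space"
  assumes G: "bcont C G"
  shows "continuous_on UNIV (\<lambda>(q, r, x). \<integral>z. G r (x + (\<sigma> * q) *\<^sub>R z) \<partial>gauss)"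
proof -
  interpret prob_space "gauss :: 'a measure" by (rule prob_space_gauss)
  show ?thesis
    unfolding case_prod_beta'
  proof (rule continuous_on_integral_dominated[where w="\<lambda>_. C"])
    show "continuous_on UNIV (\<lambda>p. G (fst (snd p)) (snd (snd p) + (\<sigma> * fst p) *\<^sub>R z))" for z :: 'a
      by (intro bcont_continuous[OF G] continuous_intros)
  qed (use integrable_gauss_bcont[OF G] bcont_norm[OF G] in auto)
qed

lemma gQ_continuous:
  fixes G' :: "'a::euclidean_space \<Rightarrow> real \<Rightarrow> 'a \<Rightarrow> 'b::euclidean_space"
  assumes G': "\<And>b. b \<in> Basis \<Longrightarrow> bcont C (G' b)"
  shows "continuous_on UNIV (\<lambda>(q, r). gQ \<sigma> G' x q r)"
  unfolding case_prod_beta' gQ_def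
proof (intro continuous_on_sum continuous_on_scaleR continuous_on_const)
  fix b :: 'a assume b: "b \<in> Basis"
  show "continuous_on UNIV (\<lambda>p. \<integral>z. (z \<bullet> b) *\<^sub>R G' b (snd p) (x + (\<sigma> * fst p) *\<^sub>R z) \<partial>gauss)"
  proof (rule continuous_on_integral_dominated[where w="\<lambda>z. C * norm z"])
    show "continuous_on UNIV (\<lambda>p. (z \<bullet> b) *\<^sub>R G' b (snd p) (x + (\<sigma> * fst p) *\<^sub>R z))" for z :: 'a
      by (intro bcont_continuous[OF G'[OF b]] continuous_intros)
  qed (use gauss_weight_bound[OF G'[OF b] b] measurable_gauss_weight[OF G'[OF b]] in
      \<open>auto intro!: integrable_gauss_norm simp del: norm_scaleR\<close>)
qed

lemma heat0_continuous:
  assumes h: "bcont C (\<lambda>_. h)"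
  shows "continuous_on UNIV (\<lambda>(t, x). heat0 \<sigma> h t x)"
proof -
  have "continuous_on UNIV (\<lambda>p::real \<times> 'a. (sqrt (fst p), 0::real, snd p))" by (intro continuous_intros)
  from continuous_on_compose2[OF gauss_average_continuous[OF h, of \<sigma>] this]
  show ?thesis by (simp add: heat0_def case_prod_beta')
qed

lemma heat0_bound:
  assumes h: "bcont C (\<lambda>_. h)"
  shows "norm (heat0 \<sigma> h t x) \<le> C"
proof -
  interpret prob_space "gauss :: 'a measure" by (rule prob_space_gauss)
  have "norm (heat0 \<sigma> h t x) \<le> (\<integral>z. norm (h (x + (\<sigma> * sqrt t) *\<^sub>R z)) \<partial>gauss)"
    unfolding heat0_def by (rule integral_norm_bound)
  also have "\<dots> \<le> (\<integral>z. C \<partial>(gauss :: 'a measure))"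
    using integrable_gauss_bcont[OF h] bcont_norm[OF h] by (intro integral_mono integrable_norm) auto
  finally show ?thesis by (simp add: prob_space[simplified])
qed

lemma heat0_has_pd:
  assumes h: "bcont C (\<lambda>_. h)" and h': "bcont C' (\<lambda>_. h')" and d: "has_pd h b h'"
  shows "has_pd (heat0 \<sigma> h t) b (heat0 \<sigma> h' t)"
  unfolding has_pd_def
proof
  fix x
  interpret prob_space "gauss :: 'a measure" by (rule prob_space_gauss)
  have "((\<lambda>r. \<integral>z. h (x + r *\<^sub>R b + (\<sigma> * sqrt t) *\<^sub>R z) \<partial>gauss) has_vector_derivative
      (\<integral>z. h' (x + 0 *\<^sub>R b + (\<sigma> * sqrt t) *\<^sub>R z) \<partial>gauss)) (at 0)"
  proof (rule has_vector_derivative_integral_dominated[where w="\<lambda>_. C'"])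
    fix r z
    show "((\<lambda>r. h (x + r *\<^sub>R b + (\<sigma> * sqrt t) *\<^sub>R z)) has_vector_derivative h' (x + r *\<^sub>R b + (\<sigma> * sqrt t) *\<^sub>R z)) (at r)"
      using has_pd_at[OF d, of "x + (\<sigma> * sqrt t) *\<^sub>R z" r]
      by (simp add: add.assoc add.commute[of "(\<sigma> * sqrt t) *\<^sub>R z"])
  qed (use integrable_gauss_bcont[OF h] integrable_gauss_bcont[OF h', of x "\<sigma> * sqrt t"] bcont_norm[OF h'] in auto)
  then show "((\<lambda>r. heat0 \<sigma> h t (x + r *\<^sub>R b)) has_vector_derivative heat0 \<sigma> h' t x) (at 0)"
    by (simp add: heat0_def)
qed

text \<open>In the variable q = sqrt t the derivative of the average is \<sigma> times the mean of z
  . \<nabla>h, which Stein's identity turns into \<sigma>^2 q times the mean of the Laplacian; the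
  chain factor 1/(2 q) leaves \<sigma>^2/2. The square root is not differentiable at 0, hence the
  fundamental theorem with interior derivatives.\<close>

lemma heat0_integral:
  fixes h :: "'a::euclidean_space \<Rightarrow> 'b::euclidean_space"
  assumes h: "bcont C (\<lambda>_. h)" and h1: "\<And>b. b \<in> Basis \<Longrightarrow> bcont C (\<lambda>_. h1 b)"
    and h2: "\<And>b. b \<in> Basis \<Longrightarrow> bcont C (\<lambda>_. h2 b)"
    and d1: "\<And>b. b \<in> Basis \<Longrightarrow> has_pd h b (h1 b)" and d2: "\<And>b. b \<in> Basis \<Longrightarrow> has_pd (h1 b) b (h2 b)"
    and t: "t \<ge> 0"
  shows "((\<lambda>s. (\<sigma>\<^sup>2 / 2) *\<^sub>R (\<Sum>b\<in>Basis. heat0 \<sigma> (h2 b) s x)) has_integral (heat0 \<sigma> h t x - h x)) {0..t}"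
proof -
  interpret prob_space "gauss :: 'a measure" by (rule prob_space_gauss)
  have "((\<lambda>s. (\<sigma>\<^sup>2 / 2) *\<^sub>R (\<Sum>b\<in>Basis. heat0 \<sigma> (h2 b) s x)) has_integral (heat0 \<sigma> h t x - heat0 \<sigma> h 0 x)) {0..t}"
  proof (rule fundamental_theorem_of_calculus_interior[OF t])
    have "continuous_on {0..t} (\<lambda>s. (s, x))" by (intro continuous_intros)
    from continuous_on_compose2[OF heat0_continuous[OF h] this]
    show "continuous_on {0..t} (\<lambda>s. heat0 \<sigma> h s x)" by simp
    fix s assume s: "s \<in> {0<..<t}"
    have st: "gQ \<sigma> (\<lambda>b _. h1 b) x q 0 = (\<sigma>\<^sup>2 * q) *\<^sub>R (\<Sum>b\<in>Basis. \<integral>z. h2 b (x + (\<sigma> * q) *\<^sub>R z) \<partial>gauss)" for q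
    proof -
      have "(\<integral>z. (z \<bullet> b) *\<^sub>R h1 b (x + (\<sigma> * q) *\<^sub>R z) \<partial>gauss) = (\<sigma> * q) *\<^sub>R (\<integral>z. h2 b (x + (\<sigma> * q) *\<^sub>R z) \<partial>gauss)"
        if b: "b \<in> Basis" for b
      proof -
        have "(\<integral>z. (z \<bullet> b) *\<^sub>R h1 b (x + (\<sigma> * q) *\<^sub>R z) \<partial>gauss) = (\<integral>z. (\<sigma> * q) *\<^sub>R h2 b (x + (\<sigma> * q) *\<^sub>R z) \<partial>gauss)"
        proof (rule gauss_stein[OF b, where C="max C (\<bar>\<sigma> * q\<bar> * C)"])
          show "has_pd (\<lambda>z. h1 b (x + (\<sigma> * q) *\<^sub>R z)) b (\<lambda>z. (\<sigma> * q) *\<^sub>R h2 b (x + (\<sigma> * q) *\<^sub>R z))"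
            unfolding has_pd_def
          proof
            fix z
            have 1: "((\<lambda>r. \<sigma> * q * r) has_vector_derivative \<sigma> * q) (at 0)"
              by (auto intro!: derivative_eq_intros)
            have 2: "((\<lambda>r. h1 b (x + (\<sigma> * q) *\<^sub>R z + r *\<^sub>R b)) has_vector_derivative h2 b (x + (\<sigma> * q) *\<^sub>R z)) (at (\<sigma> * q * 0))"
              using d2[OF b] by (simp add: has_pd_def)
            show "((\<lambda>r. h1 b (x + (\<sigma> * q) *\<^sub>R (z + r *\<^sub>R b))) has_vector_derivative (\<sigma> * q) *\<^sub>R h2 b (x + (\<sigma> * q) *\<^sub>R z)) (at 0)"
              using vector_diff_chain_at[OF 1 2] by (simp add: o_def scaleR_add_right add.assoc)
          qed
          show "norm ((\<sigma> * q) *\<^sub>R h2 b (x + (\<sigma> * q) *\<^sub>R y)) \<le> max C (\<bar>\<sigma> * q\<bar> * C)" for y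
            using mult_left_mono[OF bcont_norm[OF h2[OF b], of "x + (\<sigma> * q) *\<^sub>R y"], of "\<bar>\<sigma> * q\<bar>"] by simp
          show "norm (h1 b (x + (\<sigma> * q) *\<^sub>R y)) \<le> max C (\<bar>\<sigma> * q\<bar> * C)" for y
            using bcont_norm[OF h1[OF b]] by (simp add: le_max_iff_disj)
        qed (intro continuous_intros bcont_continuous[OF h1[OF b], of _ "\<lambda>_. 0"] bcont_continuous[OF h2[OF b], of _ "\<lambda>_. 0"])+
        then show ?thesis by simp
      qed
      then show ?thesis
        unfolding gQ_def scaleR_sum_right by (intro sum.cong refl) (simp add: power2_eq_square mult.assoc)
    qed
    have E: "((\<lambda>q. \<integral>z. h (x + (\<sigma> * q) *\<^sub>R z) \<partial>gauss) has_vector_derivative gQ \<sigma> (\<lambda>b _. h1 b) x (sqrt s) 0) (at (sqrt s))"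
      by (rule gauss_average_has_derivative[OF h h1 d1]) auto
    have sq: "(sqrt has_vector_derivative inverse (sqrt s) / 2) (at s)"
      unfolding has_real_derivative_iff_has_vector_derivative[symmetric]
      using s by (intro DERIV_real_sqrt) auto
    have "inverse (sqrt s) * (\<sigma>\<^sup>2 * sqrt s) / 2 = \<sigma>\<^sup>2 / 2" using s by simp
    with vector_diff_chain_at[OF sq E]
    show "((\<lambda>s. heat0 \<sigma> h s x) has_vector_derivative (\<sigma>\<^sup>2 / 2) *\<^sub>R (\<Sum>b\<in>Basis. heat0 \<sigma> (h2 b) s x)) (at s)"
      by (simp add: st o_def heat0_def)
  qed
  then show ?thesis by (simp add: heat0_def prob_space[simplified])
qed

text \<open>The heat equation for the Duhamel integral, in integrated form. Its Laplacian is written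
  with first derivatives of \<open>G\<close> only, the other derivative being on the kernel. By
  \<open>duhamel_fubini\<close> the time integral of this Laplacian term is the Duhamel integral
  minus the integral of \<open>G\<close>, so no time derivative has to be computed.\<close>

lemma duhamel_integral:
  fixes G :: "real \<Rightarrow> 'a::euclidean_space \<Rightarrow> 'b::euclidean_space"
  assumes G: "bcont C G" and G': "\<And>b. b \<in> Basis \<Longrightarrow> bcont C (G' b)"
    and d: "\<And>b r. b \<in> Basis \<Longrightarrow> has_pd (G r) b (G' b r)"
    and t: "t \<in> {0..T}" and \<sigma>: "\<sigma> > 0"
  shows "((\<lambda>s. (\<sigma>\<^sup>2 / 2) *\<^sub>R (\<Sum>b\<in>Basis. kint (grad_ker \<sigma> b) \<sigma> (G' b) s x) + G s x) has_integral kint duh_ker \<sigma> G t x) {0..t}"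
proof -
  have T: "T \<ge> 0" and t0: "t \<ge> 0" using t by auto
  interpret prob_space "gauss :: 'a measure" by (rule prob_space_gauss)
  define S where "S q r = (\<integral>z. G r (x + (\<sigma> * q) *\<^sub>R z) \<partial>gauss)" for q r
  define Q where "Q = gQ \<sigma> G' x"
  have S0: "S 0 r = G r x" for r by (simp add: S_def prob_space[simplified])
  have cS: "continuous_on UNIV (\<lambda>(q, r). S q r)"
  proof -
    have "continuous_on UNIV (\<lambda>p::real \<times> real. (fst p, snd p, x))" by (intro continuous_intros)
    from continuous_on_compose2[OF gauss_average_continuous[OF G, of \<sigma>] this]
    show ?thesis by (simp add: S_def case_prod_beta')
  qed
  have duh: "kint duh_ker \<sigma> G t x = integral {0..t} (\<lambda>r. S (sqrt (t - r)) r)"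
  proof -
    have "kint duh_ker \<sigma> G t x = (\<integral>\<theta>. (2 * t * \<theta>) *\<^sub>R S (sqrt t * \<theta>) (t * (1 - \<theta>\<^sup>2)) \<partial>unif)"
      unfolding kint_def ugauss_fubini[OF kint_integrable[OF ker_duh[OF T \<sigma>] G t]]
      by (simp add: duh_ker_def S_def mult.assoc)
    also have "\<dots> = integral {0..t} (\<lambda>r. S (sqrt (t - r)) r)"
      by (rule duhamel_substitution[OF cS t0])
    finally show ?thesis .
  qed
  \<comment> \<open>The factor \<sigma>^2/2 times the 2/\<sigma> of \<open>grad_ker\<close> leaves
    the \<sigma> that \<open>gQ\<close> carries.\<close>
  have lap: "(\<sigma>\<^sup>2 / 2) *\<^sub>R (\<Sum>b\<in>Basis. kint (grad_ker \<sigma> b) \<sigma> (G' b) s x)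
      = (\<integral>\<theta>. sqrt s *\<^sub>R Q (sqrt s * \<theta>) (s * (1 - \<theta>\<^sup>2)) \<partial>unif)" if s: "s \<in> {0..t}" for s
  proof -
    have s': "s \<in> {0..T}" using s t by auto
    let ?f = "\<lambda>b \<zeta>. grad_ker \<sigma> b s (fst \<zeta>) (snd \<zeta>) *\<^sub>R
      G' b (s * (1 - (fst \<zeta>)\<^sup>2)) (x + (\<sigma> * sqrt s * fst \<zeta>) *\<^sub>R snd \<zeta>)"
    have i: "integrable ugauss (?f b)" if "b \<in> Basis" for b
      by (rule kint_integrable[OF ker_grad[OF T \<sigma> that] G'[OF that] s'])
    have "(\<sigma>\<^sup>2 / 2) *\<^sub>R (\<Sum>b\<in>Basis. kint (grad_ker \<sigma> b) \<sigma> (G' b) s x) = (\<integral>\<zeta>. (\<sigma>\<^sup>2 / 2) *\<^sub>R (\<Sum>b\<in>Basis. ?f b \<zeta>) \<partial>ugauss)"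
      unfolding kint_def using i by (simp add: Bochner_Integration.integral_sum)
    also have "\<dots> = (\<integral>\<theta>. (\<integral>z. (\<sigma>\<^sup>2 / 2) *\<^sub>R (\<Sum>b\<in>Basis. ?f b (\<theta>, z)) \<partial>gauss) \<partial>unif)"
      by (rule ugauss_fubini) (use i in auto)
    also have "\<dots> = (\<integral>\<theta>. sqrt s *\<^sub>R Q (sqrt s * \<theta>) (s * (1 - \<theta>\<^sup>2)) \<partial>unif)"
    proof (rule Bochner_Integration.integral_cong[OF refl])
      fix \<theta>
      have "(\<integral>z. (\<sigma>\<^sup>2 / 2) *\<^sub>R (\<Sum>b\<in>Basis. ?f b (\<theta>, z)) \<partial>gauss)
        = (\<integral>z. (\<Sum>b\<in>Basis. (sqrt s * \<sigma>) *\<^sub>R ((z \<bullet> b) *\<^sub>R G' b (s * (1 - \<theta>\<^sup>2)) (x + (\<sigma> * (sqrt s * \<theta>)) *\<^sub>R z))) \<partial>gauss)"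
        using \<sigma> by (intro Bochner_Integration.integral_cong refl)
          (simp add: grad_ker_def scaleR_sum_right power2_eq_square mult_ac)
      also have "\<dots> = (\<Sum>b\<in>Basis. (sqrt s * \<sigma>) *\<^sub>R (\<integral>z. ((z \<bullet> b) *\<^sub>R G' b (s * (1 - \<theta>\<^sup>2)) (x + (\<sigma> * (sqrt s * \<theta>)) *\<^sub>R z)) \<partial>gauss))"
        by (subst Bochner_Integration.integral_sum)
           (auto intro!: integrable_scaleR_right integrable_gauss_weight[OF G'] simp del: scaleR_scaleR)
      also have "\<dots> = sqrt s *\<^sub>R Q (sqrt s * \<theta>) (s * (1 - \<theta>\<^sup>2))"
        by (simp add: Q_def gQ_def scaleR_sum_right)
      finally show "(\<integral>z. (\<sigma>\<^sup>2 / 2) *\<^sub>R (\<Sum>b\<in>Basis. ?f b (\<theta>, z)) \<partial>gauss) = sqrt s *\<^sub>R Q (sqrt s * \<theta>) (s * (1 - \<theta>\<^sup>2))" .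
    qed
    finally show ?thesis .
  qed
  have cG: "continuous_on {0..t} (\<lambda>r. G r x)"
    by (intro bcont_continuous[OF G] continuous_intros)
  have cS1: "continuous_on {0..t} (\<lambda>r. S (sqrt (t - r)) r)"
  proof -
    have "continuous_on {0..t} (\<lambda>r. (sqrt (t - r), r))" by (intro continuous_intros)
    from continuous_on_compose2[OF cS this] show ?thesis by simp
  qed
  have "((\<lambda>s. \<integral>\<theta>. sqrt s *\<^sub>R Q (sqrt s * \<theta>) (s * (1 - \<theta>\<^sup>2)) \<partial>unif)
      has_integral integral {0..t} (\<lambda>r. S (sqrt (t - r)) r - S 0 r)) {0..t}"
    unfolding Q_def
    by (rule duhamel_fubini[OF gQ_continuous[OF G'] t0])
       (auto simp: S_def intro!: gauss_average_has_derivative[OF G G' d])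
  also have "integral {0..t} (\<lambda>r. S (sqrt (t - r)) r - S 0 r) = kint duh_ker \<sigma> G t x - integral {0..t} (\<lambda>r. G r x)"
    unfolding duh S0 by (intro Henstock_Kurzweil_Integration.integral_diff integrable_continuous_interval cS1 cG)
  finally have "((\<lambda>s. (\<sigma>\<^sup>2 / 2) *\<^sub>R (\<Sum>b\<in>Basis. kint (grad_ker \<sigma> b) \<sigma> (G' b) s x))
      has_integral kint duh_ker \<sigma> G t x - integral {0..t} (\<lambda>r. G r x)) {0..t}"
    by (subst has_integral_cong[OF lap])
  from has_integral_add[OF this integrable_integral[OF integrable_continuous_interval[OF cG]]]
  show ?thesis by simp
qed

section \<open>Picard iteration for semilinear parabolic systems\<close>

text \<open>With \<open>p b\<close> the derivative of u in direction \<open>b\<close> this is (a,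
  \<nabla>)u. The gradient is kept as an independent variable so that the nonlinearity can be
  estimated pointwise.\<close>

definition lin :: "'a::euclidean_space \<Rightarrow> ('a \<Rightarrow> 'b::real_normed_vector) \<Rightarrow> 'b" where
  "lin a p = (\<Sum>b\<in>Basis. (a \<bullet> b) *\<^sub>R p b)"

lemma lin_bound:
  fixes a :: "'a::euclidean_space" and K B :: real
  assumes "norm a \<le> K" and "\<And>b. b \<in> Basis \<Longrightarrow> norm (p b) \<le> B"
  shows "norm (lin a p) \<le> DIM('a) * K * B"
proof -
  have "norm (lin a p) \<le> (\<Sum>b\<in>(Basis::'a set). K * B)"
    unfolding lin_def
  proof (rule order_trans[OF norm_sum sum_mono])
    fix b :: 'a assume b: "b \<in> Basis"
    have "\<bar>a \<bullet> b\<bar> * norm (p b) \<le> K * B"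
      using Basis_le_norm[OF b, of a] assms(1) assms(2)[OF b] norm_ge_zero[of a] by (intro mult_mono) (linarith | simp)+
    then show "norm ((a \<bullet> b) *\<^sub>R p b) \<le> K * B" by simp
  qed
  then show ?thesis by simp
qed

lemma lin_diff:
  fixes a a' :: "'a::euclidean_space" and D K B E :: real
  assumes "norm (a - a') \<le> D" "norm a' \<le> K" "\<And>b. b \<in> Basis \<Longrightarrow> norm (p b) \<le> B"
    "\<And>b. b \<in> Basis \<Longrightarrow> norm (p b - p' b) \<le> E"
  shows "norm (lin a p - lin a' p') \<le> DIM('a) * D * B + DIM('a) * K * E"
proof -
  have "lin a p - lin a' p' = lin (a - a') p + lin a' (\<lambda>b. p b - p' b)"
    by (simp add: lin_def sum_subtractf inner_diff_left scaleR_diff_left scaleR_diff_right)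
  then show ?thesis
    using norm_triangle_mono[OF lin_bound[OF assms(1,3)] lin_bound[OF assms(2,4)]] by simp
qed

text \<open>\<open>A' t x u a w\<close> is the derivative of \<open>A t\<close> at $(x,u)$ in the direction $(a,w)$.\<close>

definition coef :: "real \<Rightarrow> (real \<Rightarrow> 'a::euclidean_space \<Rightarrow> 'a \<Rightarrow> 'a) \<Rightarrow> (real \<Rightarrow> 'a \<Rightarrow> 'a \<Rightarrow> 'a \<Rightarrow> 'a \<Rightarrow> 'a) \<Rightarrow> bool" where
  "coef K A A' \<longleftrightarrow>
    continuous_on UNIV (\<lambda>(t, x, u). A t x u) \<and>
    (\<forall>a\<in>Basis. continuous_on UNIV (\<lambda>(t, x, u, w). A' t x u a w)) \<and>
    (\<forall>t x u. norm (A t x u) \<le> K) \<and>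
    (\<forall>t x u u'. norm (A t x u - A t x u') \<le> K * norm (u - u')) \<and>
    (\<forall>t x u w. \<forall>a\<in>Basis. norm (A' t x u a w) \<le> K * (1 + norm w)) \<and>
    (\<forall>t x u u' w w'. \<forall>a\<in>Basis. norm (A' t x u a w - A' t x u' a w') \<le> K * (norm (w - w') + (1 + norm w) * norm (u - u'))) \<and>
    (\<forall>t x v v'. \<forall>a\<in>Basis. (v has_vector_derivative v') (at 0) \<longrightarrow>
       ((\<lambda>r. A t (x + r *\<^sub>R a) (v r)) has_vector_derivative A' t x (v 0) a v') (at 0))"

lemma coefD:
  assumes "coef K A A'"
  shows "norm (A t x u) \<le> K" "norm (A t x u - A t x u') \<le> K * norm (u - u')"
    "a \<in> Basis \<Longrightarrow> norm (A' t x u a w) \<le> K * (1 + norm w)"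
    "a \<in> Basis \<Longrightarrow> norm (A' t x u a w - A' t x u' a w') \<le> K * (norm (w - w') + (1 + norm w) * norm (u - u'))"
    "a \<in> Basis \<Longrightarrow> (v has_vector_derivative v') (at 0) \<Longrightarrow>
       ((\<lambda>r. A t (x + r *\<^sub>R a) (v r)) has_vector_derivative A' t x (v 0) a v') (at 0)"
    "K \<ge> 0"
proof -
  show 1: "norm (A t x u) \<le> K" using assms by (simp add: coef_def)
  show "norm (A t x u - A t x u') \<le> K * norm (u - u')" using assms by (simp add: coef_def)
  show "a \<in> Basis \<Longrightarrow> norm (A' t x u a w) \<le> K * (1 + norm w)" using assms by (simp add: coef_def)
  show "a \<in> Basis \<Longrightarrow> norm (A' t x u a w - A' t x u' a w') \<le> K * (norm (w - w') + (1 + norm w) * norm (u - u'))"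
    using assms by (simp add: coef_def)
  show "a \<in> Basis \<Longrightarrow> (v has_vector_derivative v') (at 0) \<Longrightarrow>
       ((\<lambda>r. A t (x + r *\<^sub>R a) (v r)) has_vector_derivative A' t x (v 0) a v') (at 0)"
    using assms by (simp add: coef_def)
  show "K \<ge> 0" using order_trans[OF norm_ge_zero 1] .
qed

lemma coef_continuous:
  assumes "coef K A A'" "continuous_on S f" "continuous_on S g" "continuous_on S k"
  shows "continuous_on S (\<lambda>p. A (f p) (g p) (k p))"
proof -
  have c: "continuous_on UNIV (\<lambda>(t, x, u). A t x u)" using assms(1) by (simp add: coef_def)
  have "continuous_on S (\<lambda>p. (f p, g p, k p))" by (intro continuous_on_Pair assms)
  from continuous_on_compose2[OF c this] show ?thesis by simp
qed

lemma coef_continuous':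
  assumes "coef K A A'" "a \<in> Basis" "continuous_on S f" "continuous_on S g" "continuous_on S k" "continuous_on S l"
  shows "continuous_on S (\<lambda>p. A' (f p) (g p) (k p) a (l p))"
proof -
  have c: "continuous_on UNIV (\<lambda>(t, x, u, w). A' t x u a w)" using assms(1,2) by (simp add: coef_def)
  have "continuous_on S (\<lambda>p. (f p, g p, k p, l p))" by (intro continuous_on_Pair assms)
  from continuous_on_compose2[OF c this] show ?thesis by simp
qed

text \<open>Term-by-term differentiation is applied on each line x + r b separately, where the
  derivatives converge uniformly.\<close>

lemma has_pd_uniform_limit:
  fixes f :: "nat \<Rightarrow> 'a::euclidean_space \<Rightarrow> 'b::euclidean_space"
  assumes d: "\<And>n. has_pd (f n) b (g n)" and f: "\<And>x. (\<lambda>n. f n x) \<longlonglongrightarrow> F x" and g: "uniform_limit UNIV g G sequentially"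
  shows "has_pd F b G"
  unfolding has_pd_def
proof
  fix x
  have "\<exists>l. \<forall>r\<in>UNIV. (\<lambda>n. f n (x + r *\<^sub>R b)) \<longlonglongrightarrow> l r \<and> (l has_derivative (\<lambda>h. h *\<^sub>R G (x + r *\<^sub>R b))) (at r within UNIV)"
  proof (rule has_derivative_sequence[where f'="\<lambda>n r h. h *\<^sub>R g n (x + r *\<^sub>R b)" and ?x0.0=0])
    show "((\<lambda>r. f n (x + r *\<^sub>R b)) has_derivative (\<lambda>h. h *\<^sub>R g n (x + r *\<^sub>R b))) (at r within UNIV)" for n r
      using has_pd_at[OF d] by (simp add: has_vector_derivative_def)
    fix e :: real assume e: "e > 0"
    show "\<forall>\<^sub>F n in sequentially. \<forall>r\<in>UNIV. \<forall>h. norm (h *\<^sub>R g n (x + r *\<^sub>R b) - h *\<^sub>R G (x + r *\<^sub>R b)) \<le> e * norm h"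
      using uniform_limitD[OF g e]
    proof eventually_elim
      case (elim n)
      show ?case
      proof (intro ballI allI)
        fix r h :: real
        have "norm (g n (x + r *\<^sub>R b) - G (x + r *\<^sub>R b)) \<le> e" using elim by (auto simp: dist_norm less_imp_le)
        then show "norm (h *\<^sub>R g n (x + r *\<^sub>R b) - h *\<^sub>R G (x + r *\<^sub>R b)) \<le> e * norm h"
          unfolding scaleR_diff_right[symmetric] norm_scaleR real_norm_def mult.commute[of e]
          by (rule mult_left_mono) simp
      qed
    qed
  qed (use f in auto)
  then obtain l where l: "\<And>r. (\<lambda>n. f n (x + r *\<^sub>R b)) \<longlonglongrightarrow> l r"
    "\<And>r. (l has_derivative (\<lambda>h. h *\<^sub>R G (x + r *\<^sub>R b))) (at r)" by auto
  have "l = (\<lambda>r. F (x + r *\<^sub>R b))" using LIMSEQ_unique[OF l(1) f] by auto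
  then show "((\<lambda>r. F (x + r *\<^sub>R b)) has_vector_derivative G x) (at 0)"
    using l(2)[of 0] by (simp add: has_vector_derivative_def)
qed

lemma uniform_limit_geometric:
  fixes f :: "nat \<Rightarrow> 'p \<Rightarrow> 'b::banach"
  assumes "\<And>n p. norm (f (Suc n) p - f n p) \<le> D * (1/2) ^ n"
  shows "\<exists>F. uniform_limit UNIV f F sequentially"
proof -
  have "summable (\<lambda>n. D * (1/2) ^ n :: real)" by (intro summable_mult summable_geometric) simp
  then have "uniform_limit UNIV (\<lambda>n p. \<Sum>i<n. f (Suc i) p - f i p) (\<lambda>p. \<Sum>i. f (Suc i) p - f i p) sequentially"
    using assms by (intro Weierstrass_m_test) auto
  then have "uniform_limit UNIV (\<lambda>n p. f 0 p + (\<Sum>i<n. f (Suc i) p - f i p)) (\<lambda>p. f 0 p + (\<Sum>i. f (Suc i) p - f i p)) sequentially"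
    by (intro uniform_limit_add uniform_limit_const)
  moreover have "(\<lambda>n p. f 0 p + (\<Sum>i<n. f (Suc i) p - f i p)) = f"
  proof (intro ext)
    show "f 0 p + (\<Sum>i<n. f (Suc i) p - f i p) = f n p" for n p
      using sum_lessThan_telescope[of "\<lambda>n. f n p" n] by simp
  qed
  ultimately show ?thesis by (metis (no_types))
qed

text \<open>The Cauchy problem for u_t = (\<sigma>^2/2) \<Delta>u + (A(t,x,u), \<nabla>)u + H(t,x,u)
  with u(0) = h. \<open>A\<close> and \<open>H\<close> are bounded and depend on u but not on its
  gradient, so the right-hand side grows linearly in the gradient. \<open>h1 b\<close> and
  \<open>h2 b a\<close> are the derivatives of \<open>h\<close>; one constant \<open>K\<close>
  serves for all data.\<close>

locale semilinear =
  fixes T \<sigma> K :: real and A H :: "real \<Rightarrow> 'a::euclidean_space \<Rightarrow> 'a \<Rightarrow> 'a"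
    and A' H' :: "real \<Rightarrow> 'a \<Rightarrow> 'a \<Rightarrow> 'a \<Rightarrow> 'a \<Rightarrow> 'a"
    and h :: "'a \<Rightarrow> 'a" and h1 :: "'a \<Rightarrow> 'a \<Rightarrow> 'a" and h2 :: "'a \<Rightarrow> 'a \<Rightarrow> 'a \<Rightarrow> 'a"
  assumes T: "T > 0" and \<sigma>: "\<sigma> > 0"
    and A: "coef K A A'" and H: "coef K H H'"
    and h: "bcont K (\<lambda>_. h)" and h1: "\<And>b. b \<in> Basis \<Longrightarrow> bcont K (\<lambda>_. h1 b)"
    and h2: "\<And>b a. b \<in> Basis \<Longrightarrow> a \<in> Basis \<Longrightarrow> bcont K (\<lambda>_. h2 b a)"
    and dh: "\<And>b. b \<in> Basis \<Longrightarrow> has_pd h b (h1 b)"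
    and dh1: "\<And>b a. b \<in> Basis \<Longrightarrow> a \<in> Basis \<Longrightarrow> has_pd (h1 b) a (h2 b a)"
begin

text \<open>Freezes time outside [0,T], so that all fields of the iteration are continuous on the
  whole line and uniform limits can be taken over all (t,x).\<close>

definition clip :: "real \<Rightarrow> real" where "clip t = max 0 (min T t)"

lemma clip_in: "clip t \<in> {0..T}" using T by (auto simp: clip_def)
lemma clip_id: "t \<in> {0..T} \<Longrightarrow> clip t = t" by (auto simp: clip_def)
lemma clip_clip: "clip (clip t) = clip t" using clip_id[OF clip_in] .
lemma clip_continuous: "continuous_on S clip" unfolding clip_def by (intro continuous_intros)



section \<open>Pointwise bounds and Lipschitz estimates for the right-hand side\<close>

definition Gf :: "real \<Rightarrow> 'a \<Rightarrow> 'a \<Rightarrow> ('a \<Rightarrow> 'a) \<Rightarrow> 'a" where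
  "Gf t x u p = lin (A t x u) p + H t x u"

text \<open>The derivative in direction \<open>a\<close> of x |-> Gf(t, x, u(x), p(x)), where
  \<open>P b\<close> stands for the a-derivative of \<open>p b\<close>. It is affine in P but
  quadratic in p through the first summand; this dictates the order of the bounds
  \<open>bounds1\<close> and \<open>bounds2\<close>.\<close>

definition dGf :: "'a \<Rightarrow> real \<Rightarrow> 'a \<Rightarrow> 'a \<Rightarrow> ('a \<Rightarrow> 'a) \<Rightarrow> ('a \<Rightarrow> 'a) \<Rightarrow> 'a" where
  "dGf a t x u p P = lin (A' t x u a (p a)) p + lin (A t x u) P + H' t x u a (p a)"

lemma K0: "K \<ge> 0" using coefD(6)[OF A] .

lemma Gf_bound:
  assumes "\<And>b. b \<in> Basis \<Longrightarrow> norm (p b) \<le> B"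
  shows "norm (Gf t x u p) \<le> DIM('a) * K * B + K"
  unfolding Gf_def by (rule norm_triangle_mono[OF lin_bound[OF coefD(1)[OF A] assms] coefD(1)[OF H]])

lemma dGf_bound:
  assumes p: "\<And>b. b \<in> Basis \<Longrightarrow> norm (p b) \<le> B" and P: "\<And>b. b \<in> Basis \<Longrightarrow> norm (P b) \<le> B'" and a: "a \<in> Basis"
  shows "norm (dGf a t x u p P) \<le> DIM('a) * (K * (1 + B)) * B + DIM('a) * K * B' + K * (1 + B)"
proof -
  have 1: "norm (A' t x u a (p a)) \<le> K * (1 + B)" "norm (H' t x u a (p a)) \<le> K * (1 + B)"
    using coefD(3)[OF A a, of t x u "p a"] coefD(3)[OF H a, of t x u "p a"] p[OF a] K0
      mult_left_mono[of "1 + norm (p a)" "1 + B" K] by auto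
  show ?thesis unfolding dGf_def
    by (rule norm_triangle_mono[OF norm_triangle_mono[OF lin_bound[OF 1(1) p] lin_bound[OF coefD(1)[OF A] P]] 1(2)])
qed

text \<open>The difference of the coefficients \<open>A\<close> is multiplied by p, so the Lipschitz
  constant depends on the bound B of the gradient. Uniform gradient bounds must therefore precede
  the contraction estimate.\<close>

lemma Gf_diff:
  assumes p: "\<And>b. b \<in> Basis \<Longrightarrow> norm (p b) \<le> B"
    and du: "norm (u - u') \<le> \<delta>" and dp: "\<And>b. b \<in> Basis \<Longrightarrow> norm (p b - p' b) \<le> \<delta>"
  shows "norm (Gf t x u p - Gf t x u' p') \<le> (DIM('a) * K * B + DIM('a) * K + K) * \<delta>"
proof -
  have 1: "norm (A t x u - A t x u') \<le> K * \<delta>" "norm (H t x u - H t x u') \<le> K * \<delta>"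
    using coefD(2)[OF A, of t x u u'] coefD(2)[OF H, of t x u u'] mult_left_mono[OF du K0] by auto
  have "norm ((lin (A t x u) p - lin (A t x u') p') + (H t x u - H t x u'))
      \<le> (DIM('a) * (K * \<delta>) * B + DIM('a) * K * \<delta>) + K * \<delta>"
    by (rule norm_triangle_mono[OF lin_diff[OF 1(1) coefD(1)[OF A] p dp] 1(2)])
  then show ?thesis by (simp add: Gf_def algebra_simps)
qed

lemma dGf_diff:
  assumes p: "\<And>b. b \<in> Basis \<Longrightarrow> norm (p b) \<le> B" and p': "\<And>b. b \<in> Basis \<Longrightarrow> norm (p' b) \<le> B"
    and P: "\<And>b. b \<in> Basis \<Longrightarrow> norm (P b) \<le> B'"
    and du: "norm (u - u') \<le> \<delta>" and dp: "\<And>b. b \<in> Basis \<Longrightarrow> norm (p b - p' b) \<le> \<delta>"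
    and dP: "\<And>b. b \<in> Basis \<Longrightarrow> norm (P b - P' b) \<le> \<delta>" and a: "a \<in> Basis"
  shows "norm (dGf a t x u p P - dGf a t x u' p' P') \<le>
      (DIM('a) * (K * (2 + B)) * B + DIM('a) * (K * (1 + B)) + DIM('a) * K * B' + DIM('a) * K + K * (2 + B)) * \<delta>"
proof -
  have \<delta>: "\<delta> \<ge> 0" using du norm_ge_zero order_trans by blast
  have B: "B \<ge> 0" using p[OF a] norm_ge_zero order_trans by blast
  have 0: "norm (A t x u - A t x u') \<le> K * \<delta>"
    using coefD(2)[OF A, of t x u u'] mult_left_mono[OF du K0] by auto
  have "norm (p a - p' a) + (1 + norm (p a)) * norm (u - u') \<le> \<delta> + (1 + B) * \<delta>"
    using dp[OF a] du p[OF a] \<delta> B by (intro add_mono mult_mono) auto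
  then have "K * (norm (p a - p' a) + (1 + norm (p a)) * norm (u - u')) \<le> K * (\<delta> + (1 + B) * \<delta>)"
    by (rule mult_left_mono[OF _ K0])
  then have 1: "norm (A' t x u a (p a) - A' t x u' a (p' a)) \<le> K * (2 + B) * \<delta>"
    "norm (H' t x u a (p a) - H' t x u' a (p' a)) \<le> K * (2 + B) * \<delta>"
    using coefD(4)[OF A a, of t x u "p a" u' "p' a"] coefD(4)[OF H a, of t x u "p a" u' "p' a"]
    by (auto simp: algebra_simps)
  have 2: "norm (A' t x u' a (p' a)) \<le> K * (1 + B)"
    using coefD(3)[OF A a, of t x u' "p' a"] p'[OF a] K0 mult_left_mono[of "1 + norm (p' a)" "1 + B" K] by auto
  have "norm (((lin (A' t x u a (p a)) p - lin (A' t x u' a (p' a)) p') + (lin (A t x u) P - lin (A t x u') P'))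
      + (H' t x u a (p a) - H' t x u' a (p' a)))
    \<le> ((DIM('a) * (K * (2 + B) * \<delta>) * B + DIM('a) * (K * (1 + B)) * \<delta>) + (DIM('a) * (K * \<delta>) * B' + DIM('a) * K * \<delta>)) + K * (2 + B) * \<delta>"
    by (rule norm_triangle_mono[OF norm_triangle_mono[OF lin_diff[OF 1(1) 2 p dp] lin_diff[OF 0 coefD(1)[OF A] P dP]] 1(2)])
  then show ?thesis by (simp add: dGf_def algebra_simps)
qed

definition Gs where "Gs u p = (\<lambda>t x. Gf t x (u t x) (\<lambda>b. p b t x))"
definition dGs where "dGs a u p P = (\<lambda>t x. dGf a t x (u t x) (\<lambda>b. p b t x) (\<lambda>b. P b a t x))"

text \<open>\<open>P b a\<close> is the derivative of \<open>p b\<close> in direction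
  \<open>a\<close>. In the iteration the first index is the direction that goes to the kernel, the
  second the one that falls on the right-hand side.\<close>

definition good :: "real \<Rightarrow> (real \<Rightarrow> 'a \<Rightarrow> 'a) \<Rightarrow> ('a \<Rightarrow> real \<Rightarrow> 'a \<Rightarrow> 'a) \<Rightarrow> ('a \<Rightarrow> 'a \<Rightarrow> real \<Rightarrow> 'a \<Rightarrow> 'a) \<Rightarrow> bool" where
  "good C u p P \<longleftrightarrow> bcont C u \<and> (\<forall>b\<in>Basis. bcont C (p b)) \<and> (\<forall>b\<in>Basis. \<forall>a\<in>Basis. bcont C (P b a)) \<and>
     (\<forall>b\<in>Basis. \<forall>t. has_pd (u t) b (p b t)) \<and> (\<forall>b\<in>Basis. \<forall>a\<in>Basis. \<forall>t. has_pd (p b t) a (P b a t))"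

lemma goodD:
  assumes "good C u p P"
  shows "bcont C u" "b \<in> Basis \<Longrightarrow> bcont C (p b)" "b \<in> Basis \<Longrightarrow> a \<in> Basis \<Longrightarrow> bcont C (P b a)"
    "b \<in> Basis \<Longrightarrow> has_pd (u t) b (p b t)" "b \<in> Basis \<Longrightarrow> a \<in> Basis \<Longrightarrow> has_pd (p b t) a (P b a t)"
  using assms unfolding good_def by auto

lemma bcont_Gs:
  assumes g: "good C u p P"
  shows "bcont (DIM('a) * K * C + K) (Gs u p)"
  unfolding bcont_def
proof (intro conjI allI)
  show "norm (Gs u p t x) \<le> DIM('a) * K * C + K" for t x
    unfolding Gs_def by (rule Gf_bound) (use goodD(2)[OF g] bcont_norm in blast)
  show "continuous_on UNIV (\<lambda>(t, x). Gs u p t x)"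
    unfolding Gs_def Gf_def lin_def case_prod_beta'
    by (intro continuous_on_add continuous_on_sum continuous_on_scaleR continuous_on_inner continuous_on_const
        coef_continuous[OF A] coef_continuous[OF H] bcont_continuous[OF goodD(1)[OF g]] bcont_continuous[OF goodD(2)[OF g]]
        continuous_on_fst continuous_on_snd continuous_on_id)
qed

lemma bcont_dGs:
  assumes g: "good C u p P" and a: "a \<in> Basis"
  shows "bcont (DIM('a) * (K * (1 + C)) * C + DIM('a) * K * C + K * (1 + C)) (dGs a u p P)"
  unfolding bcont_def
proof (intro conjI allI)
  show "norm (dGs a u p P t x) \<le> DIM('a) * (K * (1 + C)) * C + DIM('a) * K * C + K * (1 + C)" for t x
    unfolding dGs_def by (rule dGf_bound[OF _ _ a]) (use goodD(2,3)[OF g] a bcont_norm in blast)+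
  show "continuous_on UNIV (\<lambda>(t, x). dGs a u p P t x)"
    unfolding dGs_def dGf_def lin_def case_prod_beta'
    by (intro continuous_on_add continuous_on_sum continuous_on_scaleR continuous_on_inner continuous_on_const
        coef_continuous[OF A] coef_continuous'[OF A a] coef_continuous'[OF H a]
        bcont_continuous[OF goodD(1)[OF g]] bcont_continuous[OF goodD(2)[OF g]] bcont_continuous[OF goodD(3)[OF g _ a]]
        continuous_on_fst continuous_on_snd continuous_on_id a)
qed

lemma has_pd_Gs:
  assumes g: "good C u p P" and a: "a \<in> Basis"
  shows "has_pd (Gs u p t) a (dGs a u p P t)"
  unfolding has_pd_def
proof
  fix x
  have u: "((\<lambda>r. u t (x + r *\<^sub>R a)) has_vector_derivative p a t x) (at 0)"
    using goodD(4)[OF g a] by (simp add: has_pd_def)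
  have p: "((\<lambda>r. p b t (x + r *\<^sub>R a)) has_vector_derivative P b a t x) (at 0)" if "b \<in> Basis" for b
    using goodD(5)[OF g that a] by (simp add: has_pd_def)
  have dA: "((\<lambda>r. A t (x + r *\<^sub>R a) (u t (x + r *\<^sub>R a))) has_vector_derivative A' t x (u t x) a (p a t x)) (at 0)"
    using coefD(5)[OF A a u, of t x] by simp
  have dH: "((\<lambda>r. H t (x + r *\<^sub>R a) (u t (x + r *\<^sub>R a))) has_vector_derivative H' t x (u t x) a (p a t x)) (at 0)"
    using coefD(5)[OF H a u, of t x] by simp
  have "((\<lambda>r. (A t (x + r *\<^sub>R a) (u t (x + r *\<^sub>R a)) \<bullet> b) *\<^sub>R p b t (x + r *\<^sub>R a)) has_vector_derivative
      (A' t x (u t x) a (p a t x) \<bullet> b) *\<^sub>R p b t x + (A t x (u t x) \<bullet> b) *\<^sub>R P b a t x) (at 0)" if b: "b \<in> Basis" for b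
  proof -
    have "((\<lambda>r. A t (x + r *\<^sub>R a) (u t (x + r *\<^sub>R a)) \<bullet> b) has_real_derivative A' t x (u t x) a (p a t x) \<bullet> b) (at 0)"
      unfolding has_real_derivative_iff_has_vector_derivative
      by (rule bounded_linear.has_vector_derivative[OF bounded_linear_inner_left dA])
    from has_vector_derivative_scaleR[OF this p[OF b]] show ?thesis by (simp add: add.commute)
  qed
  from has_vector_derivative_add[OF has_vector_derivative_sum[OF this] dH]
  show "((\<lambda>r. Gs u p t (x + r *\<^sub>R a)) has_vector_derivative dGs a u p P t x) (at 0)"
    by (simp add: Gs_def dGs_def Gf_def dGf_def lin_def sum.distrib)
qed

definition "Wk = 2 * sqrt T + 2 / \<sigma>"
text \<open>\<open>kap / sqrt l\<close> bounds \<open>kint\<close>, for both kernels, in the sup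
  norm weighted with e^(-l t). The factor pi/2 is the limit of arctan from
  \<open>unif_exp_bound\<close>, the middle one a Gaussian moment.\<close>

definition "kap = Wk * gmom TYPE('a) * (pi / 2)"

lemma kers: "ker T Wk (duh_ker :: real \<Rightarrow> real \<Rightarrow> 'a \<Rightarrow> real)" "b \<in> Basis \<Longrightarrow> ker T Wk (grad_ker \<sigma> b)"
  unfolding Wk_def using T \<sigma> by (auto intro!: ker_duh ker_grad)

lemma kap0: "kap \<ge> 0"
  unfolding kap_def Wk_def using T \<sigma> gmom_nonneg[where 'a='a] by (intro mult_nonneg_nonneg) auto

lemma kint_weighted:
  assumes k: "ker T Wk \<rho>" and G: "bcont C0 (G :: real \<Rightarrow> 'a \<Rightarrow> 'a)" and t: "t \<in> {0..T}" and l: "l > 0"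
    and b: "\<And>s y. s \<in> {0..T} \<Longrightarrow> norm (G s y) \<le> C * exp (l * s)"
  shows "norm (kint \<rho> \<sigma> G t x) \<le> kap * C / sqrt l * exp (l * t)"
proof -
  have "norm (G 0 0) \<le> C * exp (l * 0)" using T by (intro b) simp
  from order_trans[OF norm_ge_zero this] have C: "C \<ge> 0" by simp
  have b': "norm (G s y) \<le> C * exp (l * s)" if "s \<in> {0..t}" for s y
    using b that t by auto
  from kint_weighted_bound[OF k G t l C b'] show ?thesis
    by (simp add: kap_def mult_ac)
qed

section \<open>The Picard map on a function together with its gradient and Hessian\<close>

definition stU where "stU u p t x = heat0 \<sigma> h (clip t) x + kint duh_ker \<sigma> (Gs u p) (clip t) x"
text \<open>The gradient is given in kernel form. In this form it depends on \<open>Gs\<close> but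
  not on its derivative, so u and p can be bounded without reference to P.\<close>

definition stp where "stp u p b t x = heat0 \<sigma> (h1 b) (clip t) x + kint (grad_ker \<sigma> b) \<sigma> (Gs u p) (clip t) x"
definition stP where "stP u p P b a t x = heat0 \<sigma> (h2 b a) (clip t) x + kint (grad_ker \<sigma> b) \<sigma> (dGs a u p P) (clip t) x"

lemma bcont_step:
  assumes h: "bcont K (\<lambda>_. k)" and \<rho>: "ker T Wk \<rho>" and G: "bcont C (G :: real \<Rightarrow> 'a \<Rightarrow> 'a)"
  shows "bcont (K + kap * C * exp T) (\<lambda>t x. heat0 \<sigma> k (clip t) x + kint \<rho> \<sigma> G (clip t) x)"
  unfolding bcont_def
proof (intro conjI allI)
  have c: "continuous_on UNIV (\<lambda>p::real \<times> 'a. (clip (fst p), snd p))"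
    by (intro continuous_intros continuous_on_compose2[OF clip_continuous[of UNIV]]) auto
  have "continuous_on UNIV (\<lambda>p. heat0 \<sigma> k (clip (fst p)) (snd p))"
    using continuous_on_compose2[OF heat0_continuous[OF h] c] by simp
  moreover have "continuous_on UNIV (\<lambda>p. kint \<rho> \<sigma> G (clip (fst p)) (snd p))"
  proof -
    have "range (\<lambda>p::real \<times> 'a. (clip (fst p), snd p)) \<subseteq> {0..T} \<times> UNIV" using clip_in by auto
    from continuous_on_compose2[OF kint_continuous[OF \<rho> G] c this] show ?thesis by simp
  qed
  ultimately show "continuous_on UNIV (\<lambda>(t, x). heat0 \<sigma> k (clip t) x + kint \<rho> \<sigma> G (clip t) x)"
    unfolding case_prod_beta' by (rule continuous_on_add)
  fix t x
  have C: "C \<ge> 0" using bcont_nonneg[OF G] .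
  \<comment> \<open>A crude bound depending on C is enough here, so the rate is simply 1.\<close>
  have "norm (kint \<rho> \<sigma> G (clip t) x) \<le> kap * C / sqrt 1 * exp (1 * clip t)"
  proof (rule kint_weighted[OF \<rho> G clip_in])
    fix s y assume s: "s \<in> {0..T}"
    have "C * 1 \<le> C * exp (1 * s)" using C s by (intro mult_left_mono) auto
    then show "norm (G s y) \<le> C * exp (1 * s)" using bcont_norm[OF G, of s y] by linarith
  qed simp
  also have "\<dots> \<le> kap * C * exp T" using kap0 C clip_in[of t] by (simp add: mult_left_mono)
  finally show "norm (heat0 \<sigma> k (clip t) x + kint \<rho> \<sigma> G (clip t) x) \<le> K + kap * C * exp T"
    by (rule norm_triangle_mono[OF heat0_bound[OF h]])
qed

text \<open>Differentiating the Duhamel integral puts the derivative on \<open>Gs\<close>;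
  \<open>duh_pd_eq_grad\<close> then moves it to the kernel, which identifies \<open>stp\<close> as
  the gradient of \<open>stU\<close>. The second differentiation falls on the \<open>Gs\<close>
  inside \<open>stp\<close> and stays there.\<close>

lemma good_step:
  assumes g: "good C u p P"
  shows "\<exists>C'. good C' (stU u p) (stp u p) (stP u p P)"
proof -
  define C1 where "C1 = DIM('a) * K * C + K"
  define C2 where "C2 = DIM('a) * (K * (1 + C)) * C + DIM('a) * K * C + K * (1 + C)"
  have G: "bcont C1 (Gs u p)" unfolding C1_def by (rule bcont_Gs[OF g])
  have dG: "bcont C2 (dGs a u p P)" if "a \<in> Basis" for a unfolding C2_def by (rule bcont_dGs[OF g that])
  let ?D1 = "K + kap * C1 * exp T" and ?D2 = "K + kap * C2 * exp T"
  have 1: "bcont ?D1 (stU u p)" unfolding stU_def[abs_def] by (rule bcont_step[OF h kers(1) G])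
  have 2: "bcont ?D1 (stp u p b)" if "b \<in> Basis" for b
    unfolding stp_def[abs_def] by (rule bcont_step[OF h1[OF that] kers(2)[OF that] G])
  have 3: "bcont ?D2 (stP u p P b a)" if "b \<in> Basis" "a \<in> Basis" for b a
    unfolding stP_def[abs_def] by (rule bcont_step[OF h2[OF that] kers(2)[OF that(1)] dG[OF that(2)]])
  have 4: "has_pd (stU u p t) b (stp u p b t)" if b: "b \<in> Basis" for b t
  proof -
    have "kint duh_ker \<sigma> (dGs b u p P) (clip t) x = kint (grad_ker \<sigma> b) \<sigma> (Gs u p) (clip t) x" for x
      by (rule duh_pd_eq_grad[OF clip_in \<sigma> b G dG[OF b] has_pd_Gs[OF g b]])
    moreover have "has_pd (kint duh_ker \<sigma> (Gs u p) (clip t)) b (kint duh_ker \<sigma> (dGs b u p P) (clip t))"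
      by (rule kint_has_pd[OF kers(1) G dG[OF b] clip_in has_pd_Gs[OF g b]])
    moreover have "has_pd (heat0 \<sigma> h (clip t)) b (heat0 \<sigma> (h1 b) (clip t))"
      by (rule heat0_has_pd[OF h h1[OF b] dh[OF b]])
    ultimately show ?thesis
      unfolding has_pd_def stU_def stp_def by (auto intro!: has_vector_derivative_add)
  qed
  have 5: "has_pd (stp u p b t) a (stP u p P b a t)" if b: "b \<in> Basis" and a: "a \<in> Basis" for a b t
  proof -
    have "has_pd (kint (grad_ker \<sigma> b) \<sigma> (Gs u p) (clip t)) a (kint (grad_ker \<sigma> b) \<sigma> (dGs a u p P) (clip t))"
      by (rule kint_has_pd[OF kers(2)[OF b] G dG[OF a] clip_in has_pd_Gs[OF g a]])
    moreover have "has_pd (heat0 \<sigma> (h1 b) (clip t)) a (heat0 \<sigma> (h2 b a) (clip t))"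
      by (rule heat0_has_pd[OF h1[OF b] h2[OF b a] dh1[OF b a]])
    ultimately show ?thesis
      unfolding has_pd_def stp_def stP_def by (auto intro!: has_vector_derivative_add)
  qed
  show ?thesis
    unfolding good_def
    by (intro exI[of _ "max ?D1 ?D2"] conjI ballI allI 4 5 bcont_mono[OF 1 max.cobounded1]
        bcont_mono[OF 2 max.cobounded1] bcont_mono[OF 3 max.cobounded2])
qed

primrec it :: "nat \<Rightarrow> (real \<Rightarrow> 'a \<Rightarrow> 'a) \<times> ('a \<Rightarrow> real \<Rightarrow> 'a \<Rightarrow> 'a) \<times> ('a \<Rightarrow> 'a \<Rightarrow> real \<Rightarrow> 'a \<Rightarrow> 'a)" where
  "it 0 = (\<lambda>_ _. 0, \<lambda>_ _ _. 0, \<lambda>_ _ _ _. 0)"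
| "it (Suc n) = (stU (fst (it n)) (fst (snd (it n))), stp (fst (it n)) (fst (snd (it n))),
     stP (fst (it n)) (fst (snd (it n))) (snd (snd (it n))))"

definition "U n = fst (it n)"
definition "p1 n = fst (snd (it n))"
definition "P2 n = snd (snd (it n))"

lemma it_simps:
  "U 0 = (\<lambda>_ _. 0)" "p1 0 = (\<lambda>_ _ _. 0)" "P2 0 = (\<lambda>_ _ _ _. 0)"
  "U (Suc n) = stU (U n) (p1 n)" "p1 (Suc n) = stp (U n) (p1 n)" "P2 (Suc n) = stP (U n) (p1 n) (P2 n)"
  by (simp_all add: U_def p1_def P2_def)

lemma good_it: "\<exists>C. good C (U n) (p1 n) (P2 n)"
proof (induction n)
  case 0
  show ?case by (intro exI[of _ 0]) (simp add: it_simps good_def bcont_def has_pd_def)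
next
  case (Suc n)
  then show ?case using good_step by (auto simp: it_simps)
qed

text \<open>Transfers every estimate on [0,T] to all real times, where the uniform limits are
  taken.\<close>

lemma it_clip: "U n (clip t) = U n t" "p1 n b (clip t) = p1 n b t" "P2 n b a (clip t) = P2 n b a t"
proof -
  have "U n (clip t) = U n t \<and> p1 n b (clip t) = p1 n b t \<and> P2 n b a (clip t) = P2 n b a t"
  proof (cases n)
    case 0
    then show ?thesis by (simp add: it_simps)
  next
    case (Suc m)
    show ?thesis
      unfolding Suc it_simps by (intro conjI ext) (simp_all only: stU_def stp_def stP_def clip_clip)
  qed
  then show "U n (clip t) = U n t" "p1 n b (clip t) = p1 n b t" "P2 n b a (clip t) = P2 n b a t" by simp_all
qed

section \<open>Bounds uniform in the iteration\<close>

lemma step_bound: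
  assumes k: "bcont K (\<lambda>_. k)" and \<rho>: "ker T Wk \<rho>" and G: "bcont C0 (G :: real \<Rightarrow> 'a \<Rightarrow> 'a)" and l: "l > 0"
    and b: "\<And>s y. s \<in> {0..T} \<Longrightarrow> norm (G s y) \<le> C * exp (l * s)" and C: "kap * C \<le> sqrt l" and t: "t \<in> {0..T}"
  shows "norm (heat0 \<sigma> k (clip t) x + kint \<rho> \<sigma> G (clip t) x) \<le> (K + 1) * exp (l * t)"
proof -
  have e: "exp (l * t) \<ge> 1" using l t by simp
  have "norm (heat0 \<sigma> k (clip t) x) \<le> K * 1" using heat0_bound[OF k] by simp
  also have "\<dots> \<le> K * exp (l * t)" using e K0 by (intro mult_left_mono) auto
  finally have 1: "norm (heat0 \<sigma> k (clip t) x) \<le> K * exp (l * t)" .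
  have "norm (kint \<rho> \<sigma> G (clip t) x) \<le> kap * C / sqrt l * exp (l * t)"
    unfolding clip_id[OF t] by (rule kint_weighted[OF \<rho> G t l b])
  \<comment> \<open>The choice of l makes the Duhamel part cost at most 1 in the weighted norm,
    however large C is; hence the invariant radius K + 1.\<close>
  also have "\<dots> \<le> 1 * exp (l * t)" using C l by (intro mult_right_mono) (auto simp: divide_le_eq)
  finally show ?thesis using norm_triangle_mono[OF 1] by (simp add: distrib_right)
qed

lemma ex_rate: "\<exists>l>0. c \<le> sqrt l"
  by (rule exI[of _ "(\<bar>c\<bar> + 1)\<^sup>2"]) (auto intro: add_nonneg_pos simp: zero_less_power2)

text \<open>The bound (K+1) e^(l t) reproduces itself: since \<open>A\<close> is bounded, such a
  bound on the gradient gives \<open>Gs\<close> the bound C e^(l t), and l is chosen with kap C <=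
  sqrt l. As C depends only on K and the dimension, the argument covers all of [0,T] at
  once.\<close>

lemma bounds1: "\<exists>B\<ge>0. \<forall>n t x. norm (U n t x) \<le> B \<and> (\<forall>b\<in>Basis. norm (p1 n b t x) \<le> B)"
proof -
  define C where "C = DIM('a) * K * (K + 1) + K"
  obtain l where l: "l > 0" "kap * C \<le> sqrt l" using ex_rate by blast
  have main: "\<forall>t\<in>{0..T}. \<forall>x. norm (U n t x) \<le> (K + 1) * exp (l * t) \<and> (\<forall>b\<in>Basis. norm (p1 n b t x) \<le> (K + 1) * exp (l * t))" for n
  proof (induction n)
    case 0
    then show ?case using K0 by (simp add: it_simps)
  next
    case (Suc n)
    obtain C0 where g: "good C0 (U n) (p1 n) (P2 n)" using good_it by blast
    have G: "norm (Gs (U n) (p1 n) s y) \<le> C * exp (l * s)" if s: "s \<in> {0..T}" for s y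
    proof -
      have "norm (Gs (U n) (p1 n) s y) \<le> DIM('a) * K * ((K + 1) * exp (l * s)) + K"
        unfolding Gs_def by (rule Gf_bound) (use Suc s in auto)
      also have "\<dots> \<le> DIM('a) * K * ((K + 1) * exp (l * s)) + K * exp (l * s)"
        using l s mult_left_mono[of 1 "exp (l * s)" K] K0 by simp
      finally show ?thesis by (simp add: C_def algebra_simps)
    qed
    show ?case
      unfolding it_simps stU_def stp_def
      by (intro ballI allI conjI step_bound[OF h kers(1) bcont_Gs[OF g] l(1) G l(2)]
          step_bound[OF h1 kers(2) bcont_Gs[OF g] l(1) G l(2)])
  qed
  define B where "B = (K + 1) * exp (l * T)"
  have B: "(K + 1) * exp (l * clip t) \<le> B" for t
    unfolding B_def using K0 l clip_in[of t] by (intro mult_left_mono) auto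
  show ?thesis
  proof (intro exI[of _ B] conjI allI ballI)
    show "0 \<le> B" using K0 by (simp add: B_def)
    fix n t x
    show "norm (U n t x) \<le> B" using main[of n] clip_in[of t] B[of t] it_clip(1)[of n t] by (metis order_trans)
    show "norm (p1 n b t x) \<le> B" if "b \<in> Basis" for b
      using main[of n] clip_in[of t] B[of t] it_clip(2)[of n b t] that by (metis order_trans)
  qed
qed

text \<open>With the gradient already bounded by B1, \<open>dGs\<close> is affine in the Hessian and
  the argument of \<open>bounds1\<close> repeats, at a rate depending on B1. Run on all three fields
  together it would not close, because of the term quadratic in the gradient.\<close>

lemma bounds2: "\<exists>B. \<forall>n t x. \<forall>b\<in>Basis. \<forall>a\<in>Basis. norm (P2 n b a t x) \<le> B"
proof -
  obtain B1 where B10: "0 \<le> B1" and B1a: "\<forall>n t x. norm (U n t x) \<le> B1 \<and> (\<forall>b\<in>Basis. norm (p1 n b t x) \<le> B1)"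
    using bounds1 by (elim exE conjE)
  note B1 = B10 B1a[rule_format, THEN conjunct1] B1a[rule_format, THEN conjunct2, rule_format]
  define C where "C = DIM('a) * (K * (1 + B1)) * B1 + DIM('a) * K * (K + 1) + K * (1 + B1)"
  obtain l where l: "l > 0" "kap * C \<le> sqrt l" using ex_rate by blast
  have main: "\<forall>t\<in>{0..T}. \<forall>x. \<forall>b\<in>Basis. \<forall>a\<in>Basis. norm (P2 n b a t x) \<le> (K + 1) * exp (l * t)" for n
  proof (induction n)
    case 0
    then show ?case using K0 by (simp add: it_simps)
  next
    case (Suc n)
    obtain C0 where g: "good C0 (U n) (p1 n) (P2 n)" using good_it by blast
    have G: "norm (dGs a (U n) (p1 n) (P2 n) s y) \<le> C * exp (l * s)" if a: "a \<in> Basis" and s: "s \<in> {0..T}" for s y a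
    proof -
      have "norm (dGs a (U n) (p1 n) (P2 n) s y) \<le> DIM('a) * (K * (1 + B1)) * B1 + DIM('a) * K * ((K + 1) * exp (l * s)) + K * (1 + B1)"
        unfolding dGs_def by (rule dGf_bound[OF _ _ a]) (use Suc s B1 a in auto)
      also have "\<dots> \<le> (DIM('a) * (K * (1 + B1)) * B1) * exp (l * s) + DIM('a) * K * ((K + 1) * exp (l * s)) + (K * (1 + B1)) * exp (l * s)"
      proof -
        have e: "1 \<le> exp (l * s)" using l s by simp
        have le: "y \<le> y * exp (l * s)" if "0 \<le> y" for y
          using mult_left_mono[OF e that] by simp
        show ?thesis using K0 B10 by (intro add_mono le order_refl mult_nonneg_nonneg) auto
      qed
      finally show ?thesis by (simp add: C_def algebra_simps)
    qed
    show ?case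
      unfolding it_simps stP_def
      by (intro ballI allI step_bound[OF h2 kers(2) bcont_dGs[OF g] l(1) G l(2)])
  qed
  define B where "B = (K + 1) * exp (l * T)"
  have B: "(K + 1) * exp (l * clip t) \<le> B" for t
    unfolding B_def using K0 l clip_in[of t] by (intro mult_left_mono) auto
  show ?thesis
  proof (intro exI[of _ B] allI ballI)
    show "norm (P2 n b a t x) \<le> B" if "b \<in> Basis" "a \<in> Basis" for n t x b a
      using main[of n] clip_in[of t] B[of t] it_clip(3)[of n b a t] that by (metis order_trans)
  qed
qed

section \<open>Geometric convergence of the iterates\<close>

lemma bcont_diff:
  assumes "bcont C G" "bcont C' G'"
  shows "bcont (C + C') (\<lambda>s y. G s y - G' s y)"
  unfolding bcont_def
proof (intro conjI allI)
  show "continuous_on UNIV (\<lambda>(s, y). G s y - G' s y)"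
    using assms unfolding bcont_def case_prod_beta' by (intro continuous_on_diff) auto
  show "norm (G t x - G' t x) \<le> C + C'" for t x
    using norm_triangle_ineq4[of "G t x" "G' t x"] bcont_norm[OF assms(1), of t x] bcont_norm[OF assms(2), of t x] by linarith
qed

lemma kint_contract:
  assumes \<rho>: "ker T Wk \<rho>" and G: "bcont C (G :: real \<Rightarrow> 'a \<Rightarrow> 'a)" and G': "bcont C' G'" and l: "l > 0"
    and b: "\<And>s y. s \<in> {0..T} \<Longrightarrow> norm (G s y - G' s y) \<le> (L * d) * exp (l * s)"
    and L: "2 * kap * L \<le> sqrt l" and d: "d \<ge> 0" and t: "t \<in> {0..T}"
  shows "norm (kint \<rho> \<sigma> G t x - kint \<rho> \<sigma> G' t x) \<le> d / 2 * exp (l * t)"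
proof -
  have "norm (kint \<rho> \<sigma> G t x - kint \<rho> \<sigma> G' t x) \<le> kap * (L * d) / sqrt l * exp (l * t)"
    unfolding kint_diff[OF \<rho> G G' t] by (rule kint_weighted[OF \<rho> bcont_diff[OF G G'] t l b])
  also have "\<dots> \<le> d / 2 * exp (l * t)"
  proof (rule mult_right_mono)
    have "2 * kap * L * d \<le> sqrt l * d" using L d by (rule mult_right_mono)
    then show "kap * (L * d) / sqrt l \<le> d / 2" using l by (simp add: field_simps)
  qed simp
  finally show ?thesis .
qed

lemma it_Suc:
  "U (Suc n) t x = heat0 \<sigma> h (clip t) x + kint duh_ker \<sigma> (Gs (U n) (p1 n)) (clip t) x"
  "p1 (Suc n) b t x = heat0 \<sigma> (h1 b) (clip t) x + kint (grad_ker \<sigma> b) \<sigma> (Gs (U n) (p1 n)) (clip t) x"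
  "P2 (Suc n) b a t x = heat0 \<sigma> (h2 b a) (clip t) x + kint (grad_ker \<sigma> b) \<sigma> (dGs a (U n) (p1 n) (P2 n)) (clip t) x"
  by (simp_all only: it_simps stU_def stp_def stP_def)

text \<open>On fields bounded by B1 and B2 both \<open>Gs\<close> and \<open>dGs\<close> are
  Lipschitz in the whole triple, so 2 kap L <= sqrt l makes each step halve the differences in the
  weighted norm. The three differences are carried together, since that of \<open>dGs\<close>
  involves those of u and p.\<close>

lemma differences:
  "\<exists>D. \<forall>n t x. norm (U (Suc n) t x - U n t x) \<le> D * (1/2) ^ n \<and>
     (\<forall>b\<in>Basis. norm (p1 (Suc n) b t x - p1 n b t x) \<le> D * (1/2) ^ n \<and>
       (\<forall>a\<in>Basis. norm (P2 (Suc n) b a t x - P2 n b a t x) \<le> D * (1/2) ^ n))"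
proof -
  obtain B1 where B10: "0 \<le> B1" and B1a: "\<forall>n t x. norm (U n t x) \<le> B1 \<and> (\<forall>b\<in>Basis. norm (p1 n b t x) \<le> B1)"
    using bounds1 by (elim exE conjE)
  note B1 = B10 B1a[rule_format, THEN conjunct1] B1a[rule_format, THEN conjunct2, rule_format]
  obtain B2 where B2a: "\<forall>n t x. \<forall>b\<in>Basis. \<forall>a\<in>Basis. norm (P2 n b a t x) \<le> B2"
    using bounds2 by (elim exE)
  note B2 = B2a[rule_format]
  define L1 where "L1 = DIM('a) * K * B1 + DIM('a) * K + K"
  define L2 where "L2 = DIM('a) * (K * (2 + B1)) * B1 + DIM('a) * (K * (1 + B1)) + DIM('a) * K * B2 + DIM('a) * K + K * (2 + B1)"
  define L where "L = max L1 L2"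
  obtain l where l: "l > 0" "2 * kap * L \<le> sqrt l" using ex_rate by blast
  \<comment> \<open>The summands bound the first differences of u and of the gradient, and that of
    the Hessian. The absolute value keeps D nonnegative, as \<open>bounds2\<close> does not state
    the sign of its constant.\<close>
  define D where "D = 2 * B1 + 2 * \<bar>B2\<bar>"
  have D: "D \<ge> 0" using B1 by (simp add: D_def)
  let ?P = "\<lambda>n t x c. norm (U (Suc n) t x - U n t x) \<le> c \<and>
     (\<forall>b\<in>Basis. norm (p1 (Suc n) b t x - p1 n b t x) \<le> c \<and>
       (\<forall>a\<in>Basis. norm (P2 (Suc n) b a t x - P2 n b a t x) \<le> c))"
  have main: "\<forall>t\<in>{0..T}. \<forall>x. ?P n t x (D * (1/2) ^ n * exp (l * t))" for n
  proof (induction n)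
    case 0
    have e: "D \<le> D * (1/2) ^ 0 * exp (l * t)" if "t \<in> {0..T}" for t
      using D l that by (simp add: mult_le_cancel_left1)
    have 1: "norm (U (Suc 0) t x - U 0 t x) \<le> D" for t x
      using norm_triangle_ineq4[of "U (Suc 0) t x" "U 0 t x"] B1(2)[of "Suc 0" t x] B1(2)[of 0 t x]
      unfolding D_def by linarith
    have 2: "norm (p1 (Suc 0) b t x - p1 0 b t x) \<le> D" if "b \<in> Basis" for b t x
      using norm_triangle_ineq4[of "p1 (Suc 0) b t x" "p1 0 b t x"] B1(3)[OF that, of "Suc 0" t x] B1(3)[OF that, of 0 t x]
      unfolding D_def by linarith
    have 3: "norm (P2 (Suc 0) b a t x - P2 0 b a t x) \<le> D" if "b \<in> Basis" "a \<in> Basis" for b a t x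
      using norm_triangle_ineq4[of "P2 (Suc 0) b a t x" "P2 0 b a t x"] B2[OF that, of "Suc 0" t x] B2[OF that, of 0 t x] B1(1)
      unfolding D_def by linarith
    show ?case
      by (intro ballI allI conjI order_trans[OF 1 e] order_trans[OF 2 e] order_trans[OF 3 e])
  next
    case (Suc n)
    obtain C0 where g: "good C0 (U n) (p1 n) (P2 n)" using good_it by blast
    obtain C1 where g': "good C1 (U (Suc n)) (p1 (Suc n)) (P2 (Suc n))" using good_it by blast
    let ?d = "D * (1/2) ^ n"
    have d: "?d \<ge> 0" using D by simp
    have pos: "?d * exp (l * s) \<ge> 0" for s using d by simp
    have G: "norm (Gs (U (Suc n)) (p1 (Suc n)) s y - Gs (U n) (p1 n) s y) \<le> (L * ?d) * exp (l * s)" if s: "s \<in> {0..T}" for s y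
    proof -
      have "norm (Gs (U (Suc n)) (p1 (Suc n)) s y - Gs (U n) (p1 n) s y) \<le> L1 * (?d * exp (l * s))"
        unfolding Gs_def L1_def by (rule Gf_diff) (use Suc s B1 in auto)
      also have "\<dots> \<le> L * (?d * exp (l * s))" unfolding L_def by (rule mult_right_mono[OF _ pos]) simp
      finally show ?thesis by (simp add: mult.assoc)
    qed
    have dG: "norm (dGs a (U (Suc n)) (p1 (Suc n)) (P2 (Suc n)) s y - dGs a (U n) (p1 n) (P2 n) s y) \<le> (L * ?d) * exp (l * s)"
      if a: "a \<in> Basis" and s: "s \<in> {0..T}" for s y a
    proof -
      have "norm (dGs a (U (Suc n)) (p1 (Suc n)) (P2 (Suc n)) s y - dGs a (U n) (p1 n) (P2 n) s y) \<le> L2 * (?d * exp (l * s))"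
        unfolding dGs_def L2_def by (rule dGf_diff[OF _ _ _ _ _ _ a]) (use Suc s B1 B2 a in auto)
      also have "\<dots> \<le> L * (?d * exp (l * s))" unfolding L_def by (rule mult_right_mono[OF _ pos]) simp
      finally show ?thesis by (simp add: mult.assoc)
    qed
    have eU: "U (Suc (Suc n)) t x - U (Suc n) t x =
        kint duh_ker \<sigma> (Gs (U (Suc n)) (p1 (Suc n))) (clip t) x - kint duh_ker \<sigma> (Gs (U n) (p1 n)) (clip t) x" for t x
      by (simp only: it_Suc(1)[of "Suc n" t x] it_Suc(1)[of n t x] add_diff_cancel_left)
    have ep: "p1 (Suc (Suc n)) b t x - p1 (Suc n) b t x =
        kint (grad_ker \<sigma> b) \<sigma> (Gs (U (Suc n)) (p1 (Suc n))) (clip t) x - kint (grad_ker \<sigma> b) \<sigma> (Gs (U n) (p1 n)) (clip t) x" for b t x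
      by (simp only: it_Suc(2)[of "Suc n" b t x] it_Suc(2)[of n b t x] add_diff_cancel_left)
    have eP: "P2 (Suc (Suc n)) b a t x - P2 (Suc n) b a t x =
        kint (grad_ker \<sigma> b) \<sigma> (dGs a (U (Suc n)) (p1 (Suc n)) (P2 (Suc n))) (clip t) x -
        kint (grad_ker \<sigma> b) \<sigma> (dGs a (U n) (p1 n) (P2 n)) (clip t) x" for b a t x
      by (simp only: it_Suc(3)[of "Suc n" b a t x] it_Suc(3)[of n b a t x] add_diff_cancel_left)
    have half: "D * (1/2) ^ Suc n * exp (l * t) = ?d / 2 * exp (l * t)" for t by simp
    show ?case
      unfolding half eU ep eP
    proof (intro ballI allI conjI)
      fix t x assume t: "t \<in> {0..T}"
      note [simp] = clip_id[OF t]
      show "norm (kint duh_ker \<sigma> (Gs (U (Suc n)) (p1 (Suc n))) (clip t) x - kint duh_ker \<sigma> (Gs (U n) (p1 n)) (clip t) x) \<le> ?d / 2 * exp (l * t)"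
        using kint_contract[OF kers(1) bcont_Gs[OF g'] bcont_Gs[OF g] l(1) G l(2) d t] by simp
      fix b :: 'a assume b: "b \<in> Basis"
      show "norm (kint (grad_ker \<sigma> b) \<sigma> (Gs (U (Suc n)) (p1 (Suc n))) (clip t) x - kint (grad_ker \<sigma> b) \<sigma> (Gs (U n) (p1 n)) (clip t) x) \<le> ?d / 2 * exp (l * t)"
        using kint_contract[OF kers(2)[OF b] bcont_Gs[OF g'] bcont_Gs[OF g] l(1) G l(2) d t] by simp
      fix a :: 'a assume a: "a \<in> Basis"
      show "norm (kint (grad_ker \<sigma> b) \<sigma> (dGs a (U (Suc n)) (p1 (Suc n)) (P2 (Suc n))) (clip t) x - kint (grad_ker \<sigma> b) \<sigma> (dGs a (U n) (p1 n) (P2 n)) (clip t) x) \<le> ?d / 2 * exp (l * t)"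
        using kint_contract[OF kers(2)[OF b] bcont_dGs[OF g' a] bcont_dGs[OF g a] l(1) dG[OF a] l(2) d t] by simp
    qed
  qed
  have le: "D * (1/2) ^ n * exp (l * clip t) \<le> D * exp (l * T) * (1/2) ^ n" for n t
  proof -
    have "D * (1/2) ^ n * exp (l * clip t) \<le> D * (1/2) ^ n * exp (l * T)"
      using D l clip_in[of t] by (intro mult_left_mono) auto
    then show ?thesis by (simp add: mult_ac)
  qed
  have "?P n t x (D * exp (l * T) * (1/2) ^ n)" for n t x
  proof -
    have "?P n (clip t) x (D * (1/2) ^ n * exp (l * clip t))"
      by (rule main[of n, rule_format, OF clip_in])
    then have "?P n t x (D * (1/2) ^ n * exp (l * clip t))" unfolding it_clip .
    then show ?thesis using le[of n t] by (meson order_trans)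
  qed
  then show ?thesis by (intro exI[of _ "D * exp (l * T)"] allI)
qed


text \<open>Each iterate solves exactly a linear heat equation whose source is built from the
  previous one: the Hessian carries index n+1 and \<open>Gs\<close> index n. In this integrated form
  the equation passes to the limit under uniform convergence.\<close>

lemma it_integral:
  assumes t: "t \<in> {0..T}"
  shows "((\<lambda>s. (\<sigma>\<^sup>2 / 2) *\<^sub>R (\<Sum>b\<in>Basis. P2 (Suc n) b b s x) + Gs (U n) (p1 n) s x) has_integral (U (Suc n) t x - h x)) {0..t}"
proof -
  obtain C0 where g: "good C0 (U n) (p1 n) (P2 n)" using good_it by blast
  define C where "C = max (DIM('a) * K * C0 + K) (DIM('a) * (K * (1 + C0)) * C0 + DIM('a) * K * C0 + K * (1 + C0))"
  have G: "bcont C (Gs (U n) (p1 n))"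
    unfolding C_def by (rule bcont_mono[OF bcont_Gs[OF g] max.cobounded1])
  have dG: "bcont C (dGs a (U n) (p1 n) (P2 n))" if "a \<in> Basis" for a
    unfolding C_def by (rule bcont_mono[OF bcont_dGs[OF g that] max.cobounded2])
  have "((\<lambda>s. (\<sigma>\<^sup>2 / 2) *\<^sub>R (\<Sum>b\<in>Basis. heat0 \<sigma> (h2 b b) s x) +
      ((\<sigma>\<^sup>2 / 2) *\<^sub>R (\<Sum>b\<in>Basis. kint (grad_ker \<sigma> b) \<sigma> (dGs b (U n) (p1 n) (P2 n)) s x) + Gs (U n) (p1 n) s x))
      has_integral ((heat0 \<sigma> h t x - h x) + kint duh_ker \<sigma> (Gs (U n) (p1 n)) t x)) {0..t}"
  proof (rule has_integral_add)
    show "((\<lambda>s. (\<sigma>\<^sup>2 / 2) *\<^sub>R (\<Sum>b\<in>Basis. heat0 \<sigma> (h2 b b) s x)) has_integral (heat0 \<sigma> h t x - h x)) {0..t}"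
      using t by (intro heat0_integral[OF h h1 h2 dh dh1]) auto
    show "((\<lambda>s. (\<sigma>\<^sup>2 / 2) *\<^sub>R (\<Sum>b\<in>Basis. kint (grad_ker \<sigma> b) \<sigma> (dGs b (U n) (p1 n) (P2 n)) s x) + Gs (U n) (p1 n) s x)
      has_integral kint duh_ker \<sigma> (Gs (U n) (p1 n)) t x) {0..t}"
      by (rule duhamel_integral[OF G dG has_pd_Gs[OF g] t \<sigma>])
  qed
  also have "(heat0 \<sigma> h t x - h x) + kint duh_ker \<sigma> (Gs (U n) (p1 n)) t x = U (Suc n) t x - h x"
    by (simp add: it_simps stU_def clip_id[OF t])
  finally show ?thesis
  proof (rule has_integral_eq[rotated])
    fix s assume "s \<in> {0..t}"
    then have s: "clip s = s" using t by (intro clip_id) auto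
    show "(\<sigma>\<^sup>2 / 2) *\<^sub>R (\<Sum>b\<in>Basis. heat0 \<sigma> (h2 b b) s x) +
      ((\<sigma>\<^sup>2 / 2) *\<^sub>R (\<Sum>b\<in>Basis. kint (grad_ker \<sigma> b) \<sigma> (dGs b (U n) (p1 n) (P2 n)) s x) + Gs (U n) (p1 n) s x)
      = (\<sigma>\<^sup>2 / 2) *\<^sub>R (\<Sum>b\<in>Basis. P2 (Suc n) b b s x) + Gs (U n) (p1 n) s x"
      by (simp add: it_simps stP_def s sum.distrib scaleR_add_right)
  qed
qed

text \<open>All three fields converge uniformly, so the limits are again a function with its
  gradient and Hessian. The convergence of \<open>U\<close> is kept in the conclusion because
  measurability in \<omega> will be inherited from the iterates.\<close>

theorem solution_exists:
  "\<exists>u p P C. good C u p P \<and> (\<forall>t x. (\<lambda>n. U n t x) \<longlonglongrightarrow> u t x) \<and>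
     (\<forall>t\<in>{0..T}. \<forall>x. ((\<lambda>s. (\<sigma>\<^sup>2 / 2) *\<^sub>R (\<Sum>b\<in>Basis. P b b s x) + Gf s x (u s x) (\<lambda>b. p b s x))
        has_integral (u t x - h x)) {0..t})"
proof -
  obtain B1 where B10: "0 \<le> B1" and B1a: "\<forall>n t x. norm (U n t x) \<le> B1 \<and> (\<forall>b\<in>Basis. norm (p1 n b t x) \<le> B1)"
    using bounds1 by (elim exE conjE)
  note B1 = B10 B1a[rule_format, THEN conjunct1] B1a[rule_format, THEN conjunct2, rule_format]
  obtain B2 where B2a: "\<forall>n t x. \<forall>b\<in>Basis. \<forall>a\<in>Basis. norm (P2 n b a t x) \<le> B2"
    using bounds2 by (elim exE)
  note B2 = B2a[rule_format]
  obtain D where Da: "\<forall>n t x. norm (U (Suc n) t x - U n t x) \<le> D * (1/2) ^ n \<and>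
     (\<forall>b\<in>Basis. norm (p1 (Suc n) b t x - p1 n b t x) \<le> D * (1/2) ^ n \<and>
       (\<forall>a\<in>Basis. norm (P2 (Suc n) b a t x - P2 n b a t x) \<le> D * (1/2) ^ n))"
    using differences by (elim exE)
  note D = Da[rule_format, THEN conjunct1] Da[rule_format, THEN conjunct2, rule_format, THEN conjunct1]
    Da[rule_format, THEN conjunct2, rule_format, THEN conjunct2, rule_format]
  have good': "bcont B1 (U n)" "b \<in> Basis \<Longrightarrow> bcont B1 (p1 n b)" "b \<in> Basis \<Longrightarrow> a \<in> Basis \<Longrightarrow> bcont B2 (P2 n b a)"
    "b \<in> Basis \<Longrightarrow> has_pd (U n t) b (p1 n b t)" "b \<in> Basis \<Longrightarrow> a \<in> Basis \<Longrightarrow> has_pd (p1 n b t) a (P2 n b a t)" for n b a t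
    using good_it[of n] B1 B2 unfolding good_def bcont_def by auto
  have lim: "\<exists>F. uniform_limit UNIV (\<lambda>n q. f n (fst q) (snd q)) F sequentially"
    if "\<And>n t x. norm (f (Suc n) t x - f n t x) \<le> D * (1/2) ^ n" for f :: "nat \<Rightarrow> real \<Rightarrow> 'a \<Rightarrow> 'a"
    by (rule uniform_limit_geometric[where D=D]) (rule that)
  obtain Fu where Fu: "uniform_limit UNIV (\<lambda>n q. U n (fst q) (snd q)) Fu sequentially"
    using lim[of U, OF D(1)] by blast
  have "\<forall>b\<in>Basis. \<exists>F. uniform_limit UNIV (\<lambda>n q. p1 n b (fst q) (snd q)) F sequentially"
    by (intro ballI lim D(2))
  then obtain Fp where Fp: "\<And>b. b \<in> Basis \<Longrightarrow> uniform_limit UNIV (\<lambda>n q. p1 n b (fst q) (snd q)) (Fp b) sequentially"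
    by (auto dest!: bchoice)
  have "\<forall>ba\<in>Basis \<times> Basis. \<exists>F. uniform_limit UNIV (\<lambda>n q. P2 n (fst ba) (snd ba) (fst q) (snd q)) F sequentially"
    by (intro ballI lim D(3)) auto
  from bchoice[OF this]
  obtain FP where FP0: "\<forall>ba\<in>Basis \<times> Basis. uniform_limit UNIV (\<lambda>n q. P2 n (fst ba) (snd ba) (fst q) (snd q)) (FP ba) sequentially"
    by (elim exE)
  define u where "u t x = Fu (t, x)" for t x
  define p where "p b t x = Fp b (t, x)" for b t x
  define P where "P b a t x = FP (b, a) (t, x)" for b a t x
  have uu: "uniform_limit UNIV (\<lambda>n q. U n (fst q) (snd q)) (\<lambda>q. u (fst q) (snd q)) sequentially"
    using Fu by (simp add: u_def)
  have pp: "uniform_limit UNIV (\<lambda>n q. p1 n b (fst q) (snd q)) (\<lambda>q. p b (fst q) (snd q)) sequentially" if "b \<in> Basis" for b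
    using Fp[OF that] by (simp add: p_def)
  have PP: "uniform_limit UNIV (\<lambda>n q. P2 n b a (fst q) (snd q)) (\<lambda>q. P b a (fst q) (snd q)) sequentially"
    if "b \<in> Basis" "a \<in> Basis" for b a
    using FP0[rule_format, of "(b, a)"] that by (simp add: P_def)
  have pt: "(\<lambda>n. f n t x) \<longlonglongrightarrow> F t x"
    if "uniform_limit UNIV (\<lambda>n q. f n (fst q) (snd q)) (\<lambda>q. F (fst q) (snd q)) sequentially"
    for f and F :: "real \<Rightarrow> 'a \<Rightarrow> 'a" and t x
    using tendsto_uniform_limitI[OF that, of "(t, x)"] by simp
  have sl: "uniform_limit UNIV (\<lambda>n x. f n t x) (\<lambda>x. F t x) sequentially"
    if "uniform_limit UNIV (\<lambda>n q. f n (fst q) (snd q)) (\<lambda>q. F (fst q) (snd q)) sequentially"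
    for f and F :: "real \<Rightarrow> 'a \<Rightarrow> 'a" and t
    using uniform_limit_compose'[OF that, of "\<lambda>x. (t, x)" UNIV] by simp
  have bc: "bcont C F"
    if l: "uniform_limit UNIV (\<lambda>n q. f n (fst q) (snd q)) (\<lambda>q. F (fst q) (snd q)) sequentially"
      and b: "\<And>n. bcont C (f n)" for f and F :: "real \<Rightarrow> 'a \<Rightarrow> 'a" and C
    unfolding bcont_def
  proof (intro conjI allI)
    show "continuous_on UNIV (\<lambda>(t, x). F t x)"
      unfolding case_prod_beta'
    proof (rule uniform_limit_theorem[OF _ l])
      show "\<forall>\<^sub>F n in sequentially. continuous_on UNIV (\<lambda>q. f n (fst q) (snd q))"
        using b by (auto simp: bcont_def case_prod_beta' intro!: always_eventually)
    qed simp
    show "norm (F t x) \<le> C" for t x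
      by (rule Lim_norm_ubound[OF _ pt[OF l]]) (auto intro!: always_eventually bcont_norm[OF b])
  qed
  have u_lim: "(\<lambda>n. U n t x) \<longlonglongrightarrow> u t x" for t x by (rule pt[OF uu])
  have g: "good (max B1 B2) u p P"
    unfolding good_def
  proof (intro conjI ballI allI)
    show "bcont (max B1 B2) u" by (rule bcont_mono[OF bc[OF uu good'(1)]]) simp
    fix b :: 'a assume b: "b \<in> Basis"
    show "bcont (max B1 B2) (p b)" by (rule bcont_mono[OF bc[OF pp[OF b] good'(2)[OF b]]]) simp
    show "has_pd (u t) b (p b t)" for t
      by (rule has_pd_uniform_limit[OF good'(4)[OF b] u_lim sl[OF pp[OF b]]])
    fix a :: 'a assume a: "a \<in> Basis"
    show "bcont (max B1 B2) (P b a)" by (rule bcont_mono[OF bc[OF PP[OF b a] good'(3)[OF b a]]]) simp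
    show "has_pd (p b t) a (P b a t)" for t
      by (rule has_pd_uniform_limit[OF good'(5)[OF b a] pt[OF pp[OF b]] sl[OF PP[OF b a]]])
  qed
  have "((\<lambda>s. (\<sigma>\<^sup>2 / 2) *\<^sub>R (\<Sum>b\<in>Basis. P b b s x) + Gf s x (u s x) (\<lambda>b. p b s x))
        has_integral (u t x - h x)) {0..t}" if t: "t \<in> {0..T}" for t x
  proof -
    define f where "f n s = (\<sigma>\<^sup>2 / 2) *\<^sub>R (\<Sum>b\<in>Basis. P2 (Suc n) b b s x) + Gs (U n) (p1 n) s x" for n s
    define f0 where "f0 s = (\<sigma>\<^sup>2 / 2) *\<^sub>R (\<Sum>b\<in>Basis. P b b s x) + Gf s x (u s x) (\<lambda>b. p b s x)" for s
    have ul: "uniform_limit {0..t} f f0 sequentially"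
    proof (rule uniform_limitI)
      fix e :: real assume e: "e > 0"
      \<comment> \<open>L collects the factors with which an error d in the Hessian, the gradient
        and the function enters the integrand. The added 1 makes it positive, and d = e/(2L) keeps
        the total error at e/2.\<close>
      define L where "L = (\<sigma>\<^sup>2 / 2) * DIM('a) + (DIM('a) * K * B1 + DIM('a) * K + K) + 1"
      have L: "L > 0" unfolding L_def using K0 B1 by (intro add_nonneg_pos add_nonneg_nonneg mult_nonneg_nonneg) auto
      define d where "d = e / (2 * L)"
      have d: "d > 0" using e L by (simp add: d_def)
      have "\<forall>\<^sub>F n in sequentially. \<forall>q\<in>UNIV. dist (P2 (Suc n) b b (fst q) (snd q)) (P b b (fst q) (snd q)) < d" if "b \<in> Basis" for b
        using uniform_limitD[OF PP[OF that that] d]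
        by (subst eventually_sequentially_Suc[where P="\<lambda>n. \<forall>q\<in>UNIV. dist (P2 n b b (fst q) (snd q)) (P b b (fst q) (snd q)) < d"])
      then have E1: "\<forall>\<^sub>F n in sequentially. \<forall>b\<in>Basis. \<forall>q\<in>UNIV. dist (P2 (Suc n) b b (fst q) (snd q)) (P b b (fst q) (snd q)) < d"
        by (intro eventually_ball_finite) auto
      have E2: "\<forall>\<^sub>F n in sequentially. \<forall>b\<in>Basis. \<forall>q\<in>UNIV. dist (p1 n b (fst q) (snd q)) (p b (fst q) (snd q)) < d"
        using uniform_limitD[OF pp d] by (intro eventually_ball_finite) auto
      show "\<forall>\<^sub>F n in sequentially. \<forall>s\<in>{0..t}. dist (f n s) (f0 s) < e"
        using E1 E2 uniform_limitD[OF uu d]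
      proof eventually_elim
        case (elim n)
        show ?case
        proof
          fix s
          have 1: "norm (P2 (Suc n) b b s x - P b b s x) \<le> d" if "b \<in> Basis" for b
            using elim(1)[rule_format, OF that, of "(s, x)"] by (simp add: dist_norm)
          have 2: "norm (p1 n b s x - p b s x) \<le> d" if "b \<in> Basis" for b
            using elim(2)[rule_format, OF that, of "(s, x)"] by (simp add: dist_norm)
          have 3: "norm (U n s x - u s x) \<le> d"
            using elim(3)[rule_format, of "(s, x)"] by (simp add: dist_norm)
          have "norm (\<Sum>b\<in>Basis. P2 (Suc n) b b s x - P b b s x) \<le> (\<Sum>b\<in>(Basis::'a set). d)"
            by (rule order_trans[OF norm_sum sum_mono[OF 1]])
          then have "norm ((\<sigma>\<^sup>2 / 2) *\<^sub>R (\<Sum>b\<in>Basis. P2 (Suc n) b b s x - P b b s x)) \<le> (\<sigma>\<^sup>2 / 2) * (DIM('a) * d)"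
            by (simp add: mult_left_mono)
          moreover have "norm (Gf s x (U n s x) (\<lambda>b. p1 n b s x) - Gf s x (u s x) (\<lambda>b. p b s x)) \<le> (DIM('a) * K * B1 + DIM('a) * K + K) * d"
            by (rule Gf_diff[OF B1(3) 3 2])
          ultimately have "norm ((\<sigma>\<^sup>2 / 2) *\<^sub>R (\<Sum>b\<in>Basis. P2 (Suc n) b b s x - P b b s x) +
              (Gf s x (U n s x) (\<lambda>b. p1 n b s x) - Gf s x (u s x) (\<lambda>b. p b s x)))
              \<le> (\<sigma>\<^sup>2 / 2) * (DIM('a) * d) + (DIM('a) * K * B1 + DIM('a) * K + K) * d"
            by (rule norm_triangle_mono)
          also have "\<dots> \<le> L * d" using d by (simp add: L_def algebra_simps)
          also have "\<dots> < e" using e L by (simp add: d_def)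
          finally show "dist (f n s) (f0 s) < e"
            by (simp add: f_def f0_def dist_norm Gs_def sum_subtractf scaleR_diff_right algebra_simps)
        qed
      qed
    qed
    have cf: "continuous_on {0..t} (f n)" for n
    proof -
      obtain C0 where g: "good C0 (U n) (p1 n) (P2 n)" using good_it by blast
      show ?thesis
        unfolding f_def
        by (intro continuous_on_add continuous_on_scaleR continuous_on_const continuous_on_sum
            bcont_continuous[OF good'(3)] bcont_continuous[OF bcont_Gs[OF g]] continuous_on_id)
    qed
    obtain I J where IJ: "\<And>n. (f n has_integral I n) {0..t}" "(f0 has_integral J) {0..t}" "I \<longlonglongrightarrow> J"
      using uniform_limit_integral[OF ul cf] by auto
    have I: "I n = U (Suc n) t x - h x" for n
      using has_integral_unique[OF IJ(1)] it_integral[OF t, where n=n and x=x] unfolding f_def[abs_def] by blast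
    have "I \<longlonglongrightarrow> u t x - h x"
      unfolding I by (intro tendsto_intros LIMSEQ_Suc u_lim)
    then have "J = u t x - h x" by (rule LIMSEQ_unique[OF IJ(3)])
    then show ?thesis using IJ(2) by (simp add: f0_def[abs_def])
  qed
  then show ?thesis using g u_lim by blast
qed

end

section \<open>Maximum principle\<close>

text \<open>The maximum may sit at t = T, where only differences from the left are available; they
  yield a sign, not a vanishing derivative.\<close>

lemma deriv_nonneg_at_max:
  fixes f :: "real \<Rightarrow> real"
  assumes d: "(f has_real_derivative d) (at t within {0..T})" and t: "0 < t" "t \<le> T"
    and m: "\<And>s. s \<in> {0..T} \<Longrightarrow> f s \<le> f t"
  shows "0 \<le> d"
proof (rule ccontr)
  assume "\<not> 0 \<le> d"
  then obtain e where e: "e > 0" "\<And>h. h > 0 \<Longrightarrow> t - h \<in> {0..T} \<Longrightarrow> h < e \<Longrightarrow> f t < f (t - h)"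
    using has_real_derivative_neg_dec_left[OF d] by auto
  define h where "h = min (e / 2) t"
  have h: "h > 0" "h < e" "t - h \<in> {0..T}" using e(1) t by (auto simp: h_def min_def)
  from e(2)[OF h(1,3,2)] m[OF h(3)] show False by simp
qed

lemma second_deriv_at_max:
  fixes g g' :: "real \<Rightarrow> real"
  assumes d: "\<And>r. (g has_real_derivative g' r) (at r)" and d2: "(g' has_real_derivative k) (at 0)"
    and m: "\<And>r. g r \<le> g 0"
  shows "g' 0 = 0" "k \<le> 0"
proof -
  show 0: "g' 0 = 0" by (rule DERIV_local_max[OF d, of 1]) (use m in auto)
  show "k \<le> 0"
  proof (rule ccontr)
    assume "\<not> k \<le> 0"
    then obtain e where e: "e > 0" "\<And>h. 0 < h \<Longrightarrow> h < e \<Longrightarrow> g' 0 < g' (0 + h)"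
      using DERIV_pos_inc_right[OF d2] by auto
    obtain z where z: "0 < z" "z < e / 2" "g (e / 2) - g 0 = (e / 2 - 0) * g' z"
      using MVT2[of 0 "e/2" g g'] d e(1) by auto
    then have "g' z > 0" using e(2)[of z] 0 by auto
    then have "g (e / 2) > g 0" using z e(1) by (smt (verit) mult_pos_pos)
    then show False using m[of "e / 2"] by simp
  qed
qed

lemma inner_has_real_derivative:
  fixes v w :: "real \<Rightarrow> 'a::real_inner"
  assumes "(v has_vector_derivative v') (at r within S)" "(w has_vector_derivative w') (at r within S)"
  shows "((\<lambda>r. v r \<bullet> w r) has_real_derivative v' \<bullet> w r + v r \<bullet> w') (at r within S)"
proof -
  have "((\<lambda>r. v r \<bullet> w r) has_derivative (\<lambda>h. v r \<bullet> (h *\<^sub>R w') + (h *\<^sub>R v') \<bullet> w r)) (at r within S)"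
    using assms unfolding has_vector_derivative_def by (rule has_derivative_inner)
  moreover have "(\<lambda>h. v r \<bullet> (h *\<^sub>R w') + (h *\<^sub>R v') \<bullet> w r) = (*) (v' \<bullet> w r + v r \<bullet> w')"
    by (auto simp: algebra_simps)
  ultimately show ?thesis by (simp add: has_field_derivative_def)
qed

text \<open>The comparison function $\varepsilon e^{\kappa t}(1+|x|^2)$ forces the maximum of the
  penalised $e^{-ct}|w|^2$ to be attained although the domain is unbounded.\<close>

theorem maximum_principle:
  fixes w D R a :: "real \<Rightarrow> 'a::euclidean_space \<Rightarrow> 'a" and p P :: "'a \<Rightarrow> real \<Rightarrow> 'a \<Rightarrow> 'a"
  assumes nu: "\<nu> \<ge> 0" and c: "c \<ge> 0" and k: "k \<ge> 0"
    and cont: "continuous_on ({0..T} \<times> UNIV) (\<lambda>(t, x). w t x)"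
    and bd: "\<And>t x. t \<in> {0..T} \<Longrightarrow> norm (w t x) \<le> C"
    and dp: "\<And>t b. t \<in> {0..T} \<Longrightarrow> b \<in> Basis \<Longrightarrow> has_pd (w t) b (p b t)"
    and dP: "\<And>t b. t \<in> {0..T} \<Longrightarrow> b \<in> Basis \<Longrightarrow> has_pd (p b t) b (P b t)"
    and dt: "\<And>t x. t \<in> {0..T} \<Longrightarrow> ((\<lambda>s. w s x) has_vector_derivative D t x) (at t within {0..T})"
    and eq: "\<And>t x. t \<in> {0..T} \<Longrightarrow> D t x = \<nu> *\<^sub>R (\<Sum>b\<in>Basis. P b t x) - lin (a t x) (\<lambda>b. p b t x) + R t x"
    and a: "\<And>t x. t \<in> {0..T} \<Longrightarrow> norm (a t x) \<le> A0"
    and R: "\<And>t x. t \<in> {0..T} \<Longrightarrow> 2 * (w t x \<bullet> R t x) \<le> c * (norm (w t x))\<^sup>2 + k"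
    and init: "\<And>x. (norm (w 0 x))\<^sup>2 \<le> m"
    and t1: "t1 \<in> {0..T}"
  shows "(norm (w t1 x1))\<^sup>2 \<le> (m + k * t1) * exp (c * t1)"
proof (rule ccontr)
  assume "\<not> ?thesis"
  then have neg: "(m + k * t1) * exp (c * t1) < (norm (w t1 x1))\<^sup>2" by simp
  have A0: "A0 \<ge> 0" using a[OF t1, of x1] norm_ge_zero order_trans by blast
  \<comment> \<open>The summands absorb, in turn, the diffusion of the penalty, the transport field
    acting on it through 2 |a . x| <= A0 (1 + |x|^2), and leave a margin that makes the final
    inequality strict.\<close>
  define \<kappa> where "\<kappa> = 2 * \<nu> * DIM('a) + A0 + 1"
  have \<kappa>: "\<kappa> > 0" unfolding \<kappa>_def using nu A0 by (intro add_nonneg_pos) auto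
  define \<rho> where "\<rho> x = 1 + x \<bullet> x" for x :: 'a
  have \<rho>1: "\<rho> x \<ge> 1" for x by (simp add: \<rho>_def)
  define gap where "gap = exp (- (c * t1)) * (norm (w t1 x1))\<^sup>2 - m - k * t1"
  have gap: "gap > 0"
  proof -
    have "exp (- (c * t1)) * ((m + k * t1) * exp (c * t1)) < exp (- (c * t1)) * (norm (w t1 x1))\<^sup>2"
      using neg by (intro mult_strict_left_mono) auto
    moreover have "exp (- (c * t1)) * ((m + k * t1) * exp (c * t1)) = m + k * t1"
      by (simp add: exp_minus field_simps)
    ultimately show ?thesis by (simp add: gap_def)
  qed
  \<comment> \<open>Chosen so that the penalty at (t1, x1) is half the gap, which keeps \<psi>
    positive there.\<close>
  define \<epsilon> where "\<epsilon> = gap / (2 * exp (\<kappa> * t1) * \<rho> x1)"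
  have \<rho>pos: "\<rho> x > 0" for x using \<rho>1[of x] by linarith
  have \<epsilon>: "\<epsilon> > 0" unfolding \<epsilon>_def using gap \<rho>pos[of x1] by (intro divide_pos_pos mult_pos_pos) auto
  define \<psi> where "\<psi> t x = exp (- (c * t)) * (w t x \<bullet> w t x) - m - k * t - \<epsilon> * exp (\<kappa> * t) * \<rho> x" for t x
  have \<psi>1: "\<psi> t1 x1 > 0"
  proof -
    have "\<epsilon> * exp (\<kappa> * t1) * \<rho> x1 = gap / 2"
      using \<rho>pos[of x1] by (simp add: \<epsilon>_def)
    then show ?thesis using gap by (simp add: \<psi>_def gap_def power2_norm_eq_inner)
  qed
  have m0: "m \<ge> 0" using init[of 0] zero_le_power2 order_trans by blast
  \<comment> \<open>Beyond this radius the penalty exceeds C^2, the bound of |w|^2, so \<psi> is not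
    positive. The summand |x1| keeps the given point inside the ball, and the 1 gives |x| <= |x|^2
    outside it.\<close>
  define r where "r = C\<^sup>2 / \<epsilon> + norm x1 + 1"
  have far: "\<psi> t x \<le> 0" if t: "t \<in> {0..T}" and x: "norm x > r" for t x
  proof -
    have C0: "C\<^sup>2 / \<epsilon> \<ge> 0" using \<epsilon> by simp
    have n: "norm x > 1" "norm x > C\<^sup>2 / \<epsilon>" using x C0 norm_ge_zero[of x1] unfolding r_def by linarith+
    have "norm x * 1 \<le> norm x * norm x" using n by (intro mult_left_mono) auto
    then have "C\<^sup>2 / \<epsilon> < x \<bullet> x" using n unfolding power2_norm_eq_inner[symmetric] power2_eq_square by linarith
    then have "C\<^sup>2 < \<epsilon> * (x \<bullet> x)" using \<epsilon> by (simp add: divide_less_eq mult.commute)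
    also have "\<dots> \<le> \<epsilon> * (exp (\<kappa> * t) * \<rho> x)"
    proof (rule mult_left_mono)
      have "1 * (x \<bullet> x) \<le> exp (\<kappa> * t) * \<rho> x"
        using \<kappa> t by (intro mult_mono) (auto simp: \<rho>_def)
      then show "x \<bullet> x \<le> exp (\<kappa> * t) * \<rho> x" by simp
    qed (use \<epsilon> in simp)
    also have "\<dots> = \<epsilon> * exp (\<kappa> * t) * \<rho> x" by simp
    finally have "C\<^sup>2 < \<epsilon> * exp (\<kappa> * t) * \<rho> x" .
    moreover have "exp (- (c * t)) * (w t x \<bullet> w t x) \<le> 1 * C\<^sup>2"
    proof (rule mult_mono)
      show "exp (- (c * t)) \<le> 1" using c t by simp
      show "w t x \<bullet> w t x \<le> C\<^sup>2" using bd[OF t, of x] by (simp add: power2_norm_eq_inner[symmetric] power_mono)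
    qed auto
    moreover have "k * t \<ge> 0" using k t by simp
    ultimately show ?thesis unfolding \<psi>_def using m0 by linarith
  qed
  have c\<psi>: "continuous_on ({0..T} \<times> UNIV) (\<lambda>(t, x). \<psi> t x)"
    using cont unfolding \<psi>_def \<rho>_def case_prod_beta' by (intro continuous_intros)
  have "compact ({0..T} \<times> cball (0::'a) r)" by (intro compact_Times compact_Icc compact_cball)
  moreover have in1: "(t1, x1) \<in> {0..T} \<times> cball 0 r"
  proof -
    have "C\<^sup>2 / \<epsilon> \<ge> 0" using \<epsilon> by simp
    then show ?thesis using t1 by (simp add: r_def)
  qed
  moreover have "continuous_on ({0..T} \<times> cball 0 r) (\<lambda>(t, x). \<psi> t x)"
    by (rule continuous_on_subset[OF c\<psi>]) auto
  ultimately obtain q0 where q0: "q0 \<in> {0..T} \<times> cball 0 r" "\<forall>q\<in>{0..T} \<times> cball 0 r. (\<lambda>(t, x). \<psi> t x) q \<le> (\<lambda>(t, x). \<psi> t x) q0"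
    using continuous_attains_sup[of "{0..T} \<times> cball (0::'a) r" "\<lambda>(t, x). \<psi> t x"] by blast
  obtain t0 x0 where q0': "q0 = (t0, x0)" by (cases q0)
  have t0: "t0 \<in> {0..T}" and max0: "\<And>t x. t \<in> {0..T} \<Longrightarrow> norm x \<le> r \<Longrightarrow> \<psi> t x \<le> \<psi> t0 x0"
    using q0 by (auto simp: q0')
  have pos0: "\<psi> t0 x0 > 0"
    using \<psi>1 max0[of t1 x1] in1 by auto
  have mx: "\<psi> t x \<le> \<psi> t0 x0" if "t \<in> {0..T}" for t x
    using max0[OF that, of x] far[OF that, of x] pos0 by (cases "norm x \<le> r") auto
  have "t0 \<noteq> 0"
  proof
    assume "t0 = 0"
    then have "\<psi> t0 x0 = w 0 x0 \<bullet> w 0 x0 - m - \<epsilon> * \<rho> x0" by (simp add: \<psi>_def)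
    moreover have "w 0 x0 \<bullet> w 0 x0 \<le> m" using init[of x0] by (simp add: power2_norm_eq_inner)
    moreover have "\<epsilon> * \<rho> x0 > 0" using \<epsilon> \<rho>pos by simp
    ultimately show False using pos0 by linarith
  qed
  then have t0': "0 < t0" "t0 \<le> T" using t0 by auto
  let ?E = "exp (- (c * t0))" and ?K = "\<epsilon> * exp (\<kappa> * t0)" and ?w = "w t0 x0"
  have Kpos: "?K > 0" using \<epsilon> by simp
  have dtime: "0 \<le> ?E * (2 * (?w \<bullet> D t0 x0)) - c * ?E * (?w \<bullet> ?w) - k - \<kappa> * ?K * \<rho> x0"
  proof (rule deriv_nonneg_at_max[OF _ t0', of "\<lambda>t. \<psi> t x0"])
    have "((\<lambda>t. w t x0 \<bullet> w t x0) has_real_derivative 2 * (?w \<bullet> D t0 x0)) (at t0 within {0..T})"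
      using inner_has_real_derivative[OF dt[OF t0, of x0] dt[OF t0, of x0]] by (simp add: inner_commute)
    then show "((\<lambda>t. \<psi> t x0) has_real_derivative
        ?E * (2 * (?w \<bullet> D t0 x0)) - c * ?E * (?w \<bullet> ?w) - k - \<kappa> * ?K * \<rho> x0) (at t0 within {0..T})"
      unfolding \<psi>_def by (auto intro!: derivative_eq_intros simp: algebra_simps)
  qed (rule mx)
  \<comment> \<open>At the spatial maximum the gradient of e^(-ct)|w|^2 equals that of the penalty.
    This is how the transport term, in which only w . p b occurs, becomes a quantity of the order of
    the penalty. In the second-order condition |p b|^2 has the favourable sign and is
    dropped.\<close>
  have space: "?E * (?w \<bullet> p b t0 x0) = ?K * (x0 \<bullet> b)" "?E * (?w \<bullet> P b t0 x0) \<le> ?K" if b: "b \<in> Basis" for b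
  proof -
    let ?g = "\<lambda>r. \<psi> t0 (x0 + r *\<^sub>R b)"
    let ?y = "\<lambda>r. x0 + r *\<^sub>R b"
    let ?g' = "\<lambda>r. ?E * (2 * (w t0 (?y r) \<bullet> p b t0 (?y r))) - ?K * (2 * (?y r \<bullet> b))"
    let ?g2 = "?E * (2 * (p b t0 x0 \<bullet> p b t0 x0 + ?w \<bullet> P b t0 x0)) - ?K * 2"
    have y: "(?y has_vector_derivative b) (at r)" for r
      by (auto intro!: derivative_eq_intros)
    have w: "((\<lambda>r. w t0 (?y r)) has_vector_derivative p b t0 (?y r)) (at r)" for r
      by (rule has_pd_at[OF dp[OF t0 b]])
    have pb: "((\<lambda>r. p b t0 (?y r)) has_vector_derivative P b t0 (?y r)) (at r)" for r
      by (rule has_pd_at[OF dP[OF t0 b]])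
    have yb: "((\<lambda>r. ?y r \<bullet> b) has_real_derivative 1) (at r)" for r
      using b by (auto intro!: derivative_eq_intros simp: inner_add_left)
    have ww: "((\<lambda>r. w t0 (?y r) \<bullet> w t0 (?y r)) has_real_derivative 2 * (w t0 (?y r) \<bullet> p b t0 (?y r))) (at r)" for r
      using inner_has_real_derivative[OF w w] by (simp add: inner_commute)
    have yy: "((\<lambda>r. ?y r \<bullet> ?y r) has_real_derivative 2 * (?y r \<bullet> b)) (at r)" for r
      using inner_has_real_derivative[OF y y] by (simp add: inner_commute)
    have g: "(?g has_real_derivative ?g' r) (at r)" for r
      unfolding \<psi>_def \<rho>_def
      by (rule DERIV_cong, rule DERIV_diff[OF DERIV_diff[OF DERIV_diff[OF DERIV_cmult[OF ww] DERIV_const] DERIV_const]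
            DERIV_cmult[OF DERIV_add[OF DERIV_const yy]]]) simp
    have g2: "(?g' has_real_derivative ?g2) (at 0)"
      by (rule DERIV_cong, rule DERIV_diff[OF DERIV_cmult[OF DERIV_cmult[OF inner_has_real_derivative[OF w pb]]]
            DERIV_cmult[OF DERIV_cmult[OF yb]]]) (simp add: algebra_simps)
    have gm: "?g r \<le> ?g 0" for r using mx[OF t0] by simp
    have 1: "?g' 0 = 0" and 2: "?g2 \<le> 0" using second_deriv_at_max[OF g g2 gm] .
    show "?E * (?w \<bullet> p b t0 x0) = ?K * (x0 \<bullet> b)" using 1 by simp
    have "?E * (p b t0 x0 \<bullet> p b t0 x0) \<ge> 0" by simp
    moreover have "2 * (?E * (?w \<bullet> P b t0 x0)) + 2 * (?E * (p b t0 x0 \<bullet> p b t0 x0)) \<le> 2 * ?K"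
      using 2 by (simp add: algebra_simps)
    ultimately show "?E * (?w \<bullet> P b t0 x0) \<le> ?K" by linarith
  qed
  have s1: "?E * (?w \<bullet> (\<Sum>b\<in>Basis. P b t0 x0)) \<le> DIM('a) * ?K"
  proof -
    have "?E * (?w \<bullet> (\<Sum>b\<in>Basis. P b t0 x0)) = (\<Sum>b\<in>Basis. ?E * (?w \<bullet> P b t0 x0))"
      by (simp add: inner_sum_right sum_distrib_left)
    also have "\<dots> \<le> (\<Sum>b\<in>(Basis::'a set). ?K)" by (intro sum_mono space)
    finally show ?thesis by simp
  qed
  have s2: "?E * (?w \<bullet> lin (a t0 x0) (\<lambda>b. p b t0 x0)) = ?K * (a t0 x0 \<bullet> x0)"
  proof -
    have "?E * (?w \<bullet> lin (a t0 x0) (\<lambda>b. p b t0 x0)) = (\<Sum>b\<in>Basis. (a t0 x0 \<bullet> b) * (?E * (?w \<bullet> p b t0 x0)))"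
      by (simp add: lin_def inner_sum_right sum_distrib_left mult_ac)
    also have "\<dots> = (\<Sum>b\<in>Basis. (a t0 x0 \<bullet> b) * (?K * (x0 \<bullet> b)))"
      by (intro sum.cong refl) (simp only: space)
    also have "\<dots> = ?K * (\<Sum>b\<in>Basis. (a t0 x0 \<bullet> b) * (x0 \<bullet> b))" by (simp add: sum_distrib_left mult_ac)
    finally show ?thesis by (simp only: euclidean_inner[symmetric])
  qed
  have s3: "2 * (- (a t0 x0 \<bullet> x0)) \<le> A0 * \<rho> x0"
  proof -
    have "\<bar>a t0 x0 \<bullet> x0\<bar> \<le> A0 * norm x0"
      using Cauchy_Schwarz_ineq2[of "a t0 x0" x0] mult_right_mono[OF a[OF t0, of x0] norm_ge_zero[of x0]] by linarith
    moreover have "2 * norm x0 \<le> \<rho> x0"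
      using sum_squares_bound[of "norm x0" 1] by (simp add: \<rho>_def power2_norm_eq_inner)
    then have "A0 * (2 * norm x0) \<le> A0 * \<rho> x0" using A0 by (rule mult_left_mono)
    ultimately show ?thesis by linarith
  qed
  have s4: "?E * (2 * (?w \<bullet> R t0 x0)) \<le> c * ?E * (?w \<bullet> ?w) + k"
  proof -
    have "?E * (2 * (?w \<bullet> R t0 x0)) \<le> ?E * (c * (norm ?w)\<^sup>2 + k)" by (intro mult_left_mono R t0) simp
    also have "\<dots> = c * ?E * (?w \<bullet> ?w) + ?E * k" by (simp add: power2_norm_eq_inner algebra_simps)
    also have "?E * k \<le> 1 * k" using c t0' k by (intro mult_right_mono) auto
    finally show ?thesis by simp
  qed
  have "?E * (2 * (?w \<bullet> D t0 x0)) = 2 * \<nu> * (?E * (?w \<bullet> (\<Sum>b\<in>Basis. P b t0 x0)))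
      - 2 * (?E * (?w \<bullet> lin (a t0 x0) (\<lambda>b. p b t0 x0))) + ?E * (2 * (?w \<bullet> R t0 x0))"
    unfolding eq[OF t0] by (simp add: inner_diff_right inner_add_right algebra_simps)
  also have "\<dots> \<le> 2 * \<nu> * (DIM('a) * ?K) - 2 * (?K * (a t0 x0 \<bullet> x0)) + (c * ?E * (?w \<bullet> ?w) + k)"
    unfolding s2 using s4 mult_left_mono[OF s1, of "2 * \<nu>"] nu by (intro add_mono diff_mono) auto
  \<comment> \<open>The terms with c and k cancel against those from the time derivative of \<psi>;
    only multiples of the penalty remain, and \<kappa> makes their sum negative.\<close>
  finally have "0 \<le> 2 * \<nu> * (DIM('a) * ?K) - 2 * (?K * (a t0 x0 \<bullet> x0)) - \<kappa> * ?K * \<rho> x0"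
    using dtime by linarith
  also have "\<dots> = ?K * (2 * \<nu> * DIM('a) + 2 * (- (a t0 x0 \<bullet> x0)) - \<kappa> * \<rho> x0)" by (simp add: algebra_simps)
  also have "\<dots> < 0"
  proof (rule mult_pos_neg[OF Kpos])
    have "2 * \<nu> * DIM('a) * 1 \<le> 2 * \<nu> * DIM('a) * \<rho> x0" using nu \<rho>1[of x0] by (intro mult_left_mono) auto
    then show "2 * \<nu> * DIM('a) + 2 * (- (a t0 x0 \<bullet> x0)) - \<kappa> * \<rho> x0 < 0"
      using s3 \<rho>1[of x0] by (simp add: \<kappa>_def algebra_simps)
  qed
  finally show False by simp
qed

section \<open>Truncated coefficients\<close>

text \<open>A primitive of the positive part, hence C^1 with Lipschitz derivative. A pair of copies
  shifted by one forms the ramp that takes the slope of the truncation from 1 to 0 over a unit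
  interval.\<close>

definition pos_sq :: "real \<Rightarrow> real" where "pos_sq r = (max 0 r)\<^sup>2 / 2"

lemma pos_sq_deriv: "(pos_sq has_real_derivative max 0 r) (at r)"
proof -
  consider "r < 0" | "r = 0" | "r > 0" by linarith
  then show ?thesis
  proof cases
    case 1
    have "((\<lambda>r. 0) has_real_derivative max 0 r) (at r)" using 1 by (auto intro!: derivative_eq_intros)
    then show ?thesis
      by (rule DERIV_cong_ev[THEN iffD1, OF refl _ refl, rotated])
         (use 1 eventually_nhds_in_open[of "{..<0}" r] in \<open>auto elim!: eventually_mono simp: pos_sq_def max_def\<close>)
  next
    case 3
    have "((\<lambda>r. r\<^sup>2 / 2) has_real_derivative max 0 r) (at r)" using 3 by (auto intro!: derivative_eq_intros)
    then show ?thesis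
      by (rule DERIV_cong_ev[THEN iffD1, OF refl _ refl, rotated])
         (use 3 eventually_nhds_in_open[of "{0<..}" r] in \<open>auto elim!: eventually_mono simp: pos_sq_def max_def\<close>)
  next
    case 2
    have "((\<lambda>h. pos_sq h / h) \<longlongrightarrow> 0) (at 0)"
    proof (rule Lim_null_comparison)
      show "\<forall>\<^sub>F h in at 0. norm (pos_sq h / h) \<le> \<bar>h\<bar>"
        by (rule always_eventually) (auto simp: pos_sq_def max_def power2_eq_square)
      show "((\<lambda>h. \<bar>h\<bar>) \<longlongrightarrow> 0) (at (0::real))" by (rule tendsto_rabs_zero) simp
    qed
    then show ?thesis using 2 by (simp add: has_field_derivative_iff pos_sq_def)
  qed
qed

text \<open>A $C^{1,1}$ truncation: the identity on $[-R,R]$, constant outside $[-R-1,R+1]$.\<close>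

definition trunc :: "real \<Rightarrow> real \<Rightarrow> real" where
  "trunc R r = r - pos_sq (r - R) + pos_sq (r - (R + 1)) + pos_sq (- r - R) - pos_sq (- r - (R + 1))"

definition trunc' :: "real \<Rightarrow> real \<Rightarrow> real" where
  "trunc' R r = 1 - max 0 (r - R) + max 0 (r - (R + 1)) - max 0 (- r - R) + max 0 (- r - (R + 1))"

lemma trunc_deriv: "(trunc R has_real_derivative trunc' R r) (at r)"
proof -
  have 1: "((\<lambda>r. pos_sq (r - c)) has_real_derivative max 0 (r - c)) (at r)" for c
  proof -
    have "((\<lambda>r. r - c) has_real_derivative 1) (at r)" by (auto intro!: derivative_eq_intros)
    from DERIV_chain2[OF pos_sq_deriv this] show ?thesis by simp
  qed
  have 2: "((\<lambda>r. pos_sq (- r - c)) has_real_derivative - max 0 (- r - c)) (at r)" for c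
  proof -
    have "((\<lambda>r. - r - c) has_real_derivative - 1) (at r)" by (auto intro!: derivative_eq_intros)
    from DERIV_chain2[OF pos_sq_deriv this] show ?thesis by simp
  qed
  show ?thesis unfolding trunc_def[abs_def] trunc'_def
    by (rule DERIV_cong, rule DERIV_diff[OF DERIV_add[OF DERIV_add[OF DERIV_diff[OF DERIV_ident 1] 1] 2] 2]) simp
qed

lemma trunc'_range: "R \<ge> 0 \<Longrightarrow> 0 \<le> trunc' R r \<and> trunc' R r \<le> 1"
  unfolding trunc'_def max_def by auto

text \<open>The constant 4 counts the four positive parts, each of them 1-Lipschitz.\<close>

lemma trunc'_lipschitz: "\<bar>trunc' R r - trunc' R s\<bar> \<le> 4 * \<bar>r - s\<bar>"
  unfolding trunc'_def max_def by (auto simp: abs_if)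

lemma trunc_lipschitz:
  assumes R: "R \<ge> 0"
  shows "\<bar>trunc R r - trunc R s\<bar> \<le> \<bar>r - s\<bar>"
proof -
  have "norm (trunc R r - trunc R s) \<le> 1 * \<bar>r - s\<bar>"
  proof (rule norm_diff_le_vector_derivative)
    show "(trunc R has_vector_derivative trunc' R q) (at q)" for q
      using trunc_deriv[of R q] by (simp add: has_real_derivative_iff_has_vector_derivative)
    show "norm (trunc' R q) \<le> 1" for q using trunc'_range[OF R, of q] by simp
  qed
  then show ?thesis by simp
qed

lemma trunc_id: "\<bar>r\<bar> \<le> R \<Longrightarrow> trunc R r = r"
  unfolding trunc_def pos_sq_def max_def by auto

lemma trunc_le: "R \<ge> 0 \<Longrightarrow> \<bar>trunc R r\<bar> \<le> \<bar>r\<bar>"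
  using trunc_lipschitz[of R r 0] trunc_id[of 0 R] by simp

lemma trunc_bounded: "R \<ge> 0 \<Longrightarrow> \<bar>trunc R r\<bar> \<le> R + 1"
proof (cases "\<bar>r\<bar> \<le> R + 1")
  case True
  assume "R \<ge> 0" then show ?thesis using trunc_le[of R r] True by linarith
next
  case False
  assume R: "R \<ge> 0"
  \<comment> \<open>Beyond R + 1 the quadratic parts cancel, leaving the saturation value R +
    1/2.\<close>
  have "trunc R r = R + 1/2 \<or> trunc R r = - (R + 1/2)"
    using False R unfolding trunc_def pos_sq_def max_def
    by (cases "r \<ge> 0") (auto simp: power2_eq_square field_simps)
  then show ?thesis using R by auto
qed

text \<open>Truncating by components makes the derivative diagonal with entries in [0,1], so the map
  is nonexpansive, bounded, and still the identity on the ball of radius R.\<close>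

definition Tr :: "real \<Rightarrow> 'a::euclidean_space \<Rightarrow> 'a" where
  "Tr R u = (\<Sum>c\<in>Basis. trunc R (u \<bullet> c) *\<^sub>R c)"

definition dTr :: "real \<Rightarrow> 'a::euclidean_space \<Rightarrow> 'a \<Rightarrow> 'a" where
  "dTr R u w = (\<Sum>c\<in>Basis. (trunc' R (u \<bullet> c) * (w \<bullet> c)) *\<^sub>R c)"

lemma Tr_inner: "c \<in> Basis \<Longrightarrow> Tr R u \<bullet> c = trunc R (u \<bullet> c)"
  unfolding Tr_def by simp

lemma dTr_inner: "c \<in> Basis \<Longrightarrow> dTr R u w \<bullet> c = trunc' R (u \<bullet> c) * (w \<bullet> c)"
  unfolding dTr_def by simp

lemma Tr_norm: "R \<ge> 0 \<Longrightarrow> norm (Tr R u) \<le> norm u"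
  by (rule norm_le_componentwise) (simp add: Tr_inner trunc_le)

lemma Tr_bounded:
  fixes R :: real and u :: "'a::euclidean_space"
  assumes R: "R \<ge> 0"
  shows "norm (Tr R u) \<le> DIM('a) * (R + 1)"
proof -
  have "norm (Tr R u) \<le> (\<Sum>c\<in>Basis. \<bar>Tr R u \<bullet> c\<bar>)" by (rule norm_le_l1)
  also have "\<dots> \<le> (\<Sum>c\<in>(Basis::'a set). R + 1)" using R by (intro sum_mono) (simp add: Tr_inner trunc_bounded)
  finally show ?thesis by simp
qed

lemma Tr_lipschitz: "R \<ge> 0 \<Longrightarrow> norm (Tr R u - Tr R v) \<le> norm (u - v)"
  by (rule norm_le_componentwise) (simp add: Tr_inner inner_diff_left trunc_lipschitz)

lemma Tr_id: "norm u \<le> R \<Longrightarrow> Tr R u = u"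
  by (rule euclidean_eqI) (auto simp: Tr_inner intro!: trunc_id order_trans[OF Basis_le_norm])

lemma dTr_norm: "R \<ge> 0 \<Longrightarrow> norm (dTr R u w) \<le> norm w"
  using trunc'_range[of R]
  by (intro norm_le_componentwise) (auto simp: dTr_inner abs_mult intro!: mult_left_le_one_le)

text \<open>With \<open>dTr R v w\<close> inserted, the change of base point costs the Lipschitz
  constant 4 of the slope, while in the direction the map is linear and nonexpansive. This is where
  the C^{1,1} regularity of the truncation enters.\<close>

lemma dTr_diff: "R \<ge> 0 \<Longrightarrow> norm (dTr R u w - dTr R v w') \<le> norm (w - w') + 4 * norm (u - v) * norm w"
proof -
  assume R: "R \<ge> 0"
  have "norm (dTr R u w - dTr R v w) \<le> norm ((4 * norm (u - v)) *\<^sub>R w)"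
  proof (rule norm_le_componentwise)
    fix c :: 'a assume c: "c \<in> Basis"
    have "\<bar>trunc' R (u \<bullet> c) - trunc' R (v \<bullet> c)\<bar> \<le> 4 * \<bar>u \<bullet> c - v \<bullet> c\<bar>" by (rule trunc'_lipschitz)
    also have "\<dots> \<le> 4 * norm (u - v)" using Basis_le_norm[OF c, of "u - v"] by (simp add: inner_diff_left)
    finally have "\<bar>trunc' R (u \<bullet> c) - trunc' R (v \<bullet> c)\<bar> * \<bar>w \<bullet> c\<bar> \<le> 4 * norm (u - v) * \<bar>w \<bullet> c\<bar>"
      by (rule mult_right_mono) simp
    then show "\<bar>(dTr R u w - dTr R v w) \<bullet> c\<bar> \<le> \<bar>((4 * norm (u - v)) *\<^sub>R w) \<bullet> c\<bar>"
      using c by (simp add: dTr_inner inner_diff_left left_diff_distrib[symmetric] abs_mult)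
  qed
  moreover have "dTr R v w - dTr R v w' = dTr R v (w - w')"
    by (simp add: dTr_def sum_subtractf[symmetric] inner_diff_left right_diff_distrib scaleR_diff_left)
  then have "norm (dTr R v w - dTr R v w') \<le> norm (w - w')" using dTr_norm[OF R] by simp
  ultimately have "norm ((dTr R u w - dTr R v w) + (dTr R v w - dTr R v w')) \<le> 4 * norm (u - v) * norm w + norm (w - w')"
    by (intro norm_triangle_mono) (simp_all add: abs_mult)
  then show ?thesis by (simp add: add.commute)
qed

lemma Tr_chain:
  assumes "(v has_vector_derivative v') (at s)"
  shows "((\<lambda>r. Tr R (v r)) has_vector_derivative dTr R (v s) v') (at s)"
  unfolding Tr_def dTr_def
proof (rule has_vector_derivative_sum)
  fix c :: 'a
  have "((\<lambda>r. v r \<bullet> c) has_real_derivative v' \<bullet> c) (at s)"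
    unfolding has_real_derivative_iff_has_vector_derivative
    by (rule bounded_linear.has_vector_derivative[OF bounded_linear_inner_left assms])
  from DERIV_chain2[OF trunc_deriv this]
  have "((\<lambda>r. trunc R (v r \<bullet> c)) has_vector_derivative trunc' R (v s \<bullet> c) * (v' \<bullet> c)) (at s)"
    by (simp add: has_real_derivative_iff_has_vector_derivative)
  then show "((\<lambda>r. trunc R (v r \<bullet> c) *\<^sub>R c) has_vector_derivative (trunc' R (v s \<bullet> c) * (v' \<bullet> c)) *\<^sub>R c) (at s)"
    by (rule bounded_linear.has_vector_derivative[OF bounded_linear_scaleR_left])
qed

lemma trunc_continuous: "continuous_on S (trunc R)"
  by (rule continuous_at_imp_continuous_on) (auto intro: DERIV_isCont[OF trunc_deriv])

lemma Tr_continuous: "continuous_on S f \<Longrightarrow> continuous_on S (\<lambda>p. Tr R (f p))"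
  unfolding Tr_def
  by (intro continuous_intros continuous_on_compose2[OF trunc_continuous[of UNIV]]) auto

lemma dTr_continuous: "continuous_on S f \<Longrightarrow> continuous_on S g \<Longrightarrow> continuous_on S (\<lambda>p. dTr R (f p) (g p))"
  unfolding dTr_def trunc'_def by (intro continuous_intros)

section \<open>Closure properties of admissible coefficients\<close>

lemma coef_mono:
  assumes A: "coef K A A'" and K: "K \<le> K'"
  shows "coef K' A A'"
proof -
  have le: "K * y \<le> K' * y" if "y \<ge> 0" for y using K that by (rule mult_right_mono)
  show ?thesis
    using A unfolding coef_def
    apply (elim conjE)
    apply (intro conjI)
          apply assumption
         apply assumption
        apply (meson K order_trans)
       apply (meson le norm_ge_zero order_trans)
      apply (intro allI ballI, rule order_trans[OF _ le], blast, simp)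
     apply (intro allI ballI, rule order_trans[OF _ le], blast, simp)
    apply assumption
    done
qed

lemma coef_data:
  assumes E: "bcont K E" and dE: "\<And>a. a \<in> Basis \<Longrightarrow> bcont K (dE a)" and d: "\<And>a t. a \<in> Basis \<Longrightarrow> has_pd (E t) a (dE a t)"
  shows "coef K (\<lambda>t x u. E t x) (\<lambda>t x u a w. dE a t x)"
  unfolding coef_def
proof (intro conjI allI ballI impI)
  have K: "K \<ge> 0" by (rule bcont_nonneg[OF E])
  show "continuous_on UNIV (\<lambda>(t, x, u). E t x)"
    unfolding case_prod_beta' by (intro bcont_continuous[OF E] continuous_intros)
  show "continuous_on UNIV (\<lambda>(t, x, u, w). dE a t x)" if "a \<in> Basis" for a
    unfolding case_prod_beta' by (intro bcont_continuous[OF dE[OF that]] continuous_intros)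
  show "norm (E t x) \<le> K" for t x by (rule bcont_norm[OF E])
  show "norm (E t x - E t x) \<le> K * norm (u - u')" for t x and u u' :: 'a using K by simp
  show "norm (dE a t x) \<le> K * (1 + norm w)" if "a \<in> Basis" for t x a and w :: 'a
    using bcont_norm[OF dE[OF that], of t x] mult_left_mono[of 1 "1 + norm w" K] K by simp
  show "norm (dE a t x - dE a t x) \<le> K * (norm (w - w') + (1 + norm w) * norm (u - u'))" for t x a and u u' w w' :: 'a
    using K by simp
  show "((\<lambda>r. E t (x + r *\<^sub>R a)) has_vector_derivative dE a t x) (at 0)" if "a \<in> Basis" for t x a
    using d[OF that] by (simp add: has_pd_def)
qed

lemma coef_Tr:
  fixes R :: real
  assumes R: "R \<ge> 0"
  shows "coef (DIM('a) * (R + 1) + 4) (\<lambda>t x u. Tr R u) (\<lambda>t x u a w. dTr R (u::'a::euclidean_space) w)"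
  unfolding coef_def
proof (intro conjI allI ballI impI)
  let ?K = "DIM('a) * (R + 1) + 4"
  have K: "?K \<ge> 4" using R by simp
  show "continuous_on UNIV (\<lambda>(t, x, u). Tr R u)"
    unfolding case_prod_beta' by (intro Tr_continuous continuous_intros)
  show "continuous_on UNIV (\<lambda>(t, x, u, w). dTr R u w)"
    unfolding case_prod_beta' by (intro dTr_continuous continuous_intros)
  show "norm (Tr R u) \<le> ?K" for u :: 'a using Tr_bounded[OF R, of u] by simp
  show "norm (Tr R u - Tr R u') \<le> ?K * norm (u - u')" for u u' :: 'a
    using Tr_lipschitz[OF R, of u u'] mult_right_mono[of 1 ?K "norm (u - u')"] K by simp
  show "norm (dTr R u w) \<le> ?K * (1 + norm w)" for u w :: 'a
  proof -
    have "norm w \<le> ?K * norm w" using mult_right_mono[of 1 ?K "norm w"] K by simp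
    then show ?thesis using dTr_norm[OF R, of u w] K by (simp add: distrib_left)
  qed
  show "norm (dTr R u w - dTr R u' w') \<le> ?K * (norm (w - w') + (1 + norm w) * norm (u - u'))" for u u' w w' :: 'a
  proof -
    have 1: "1 * norm (w - w') \<le> ?K * norm (w - w')" using K by (intro mult_right_mono) auto
    have 2: "4 * norm (u - u') * norm w \<le> ?K * ((1 + norm w) * norm (u - u'))"
    proof -
      have "4 * (norm w * norm (u - u')) \<le> ?K * ((1 + norm w) * norm (u - u'))"
        using K by (intro mult_mono mult_right_mono) auto
      then show ?thesis by (simp add: mult_ac)
    qed
    show ?thesis using dTr_diff[OF R, of u w u' w'] 1 2 by (simp add: distrib_left)
  qed
  show "((\<lambda>r. Tr R (v r)) has_vector_derivative dTr R (v 0) v') (at 0)" if "(v has_vector_derivative v') (at 0)" for v and v' :: 'a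
    by (rule Tr_chain[OF that])
qed

lemma coef_add:
  assumes A: "coef K A A'" and B: "coef K B B'"
  shows "coef (2 * K) (\<lambda>t x u. A t x u + B t x u) (\<lambda>t x u a w. A' t x u a w + B' t x u a w)"
  unfolding coef_def
proof (intro conjI allI ballI impI)
  show "continuous_on UNIV (\<lambda>(t, x, u). A t x u + B t x u)"
    unfolding case_prod_beta' by (intro continuous_on_add coef_continuous[OF A] coef_continuous[OF B] continuous_intros)
  show "continuous_on UNIV (\<lambda>(t, x, u, w). A' t x u a w + B' t x u a w)" if "a \<in> Basis" for a
    unfolding case_prod_beta'
    by (intro continuous_on_add coef_continuous'[OF A that] coef_continuous'[OF B that] continuous_intros)
  show "norm (A t x u + B t x u) \<le> 2 * K" for t x u
    using norm_triangle_mono[OF coefD(1)[OF A] coefD(1)[OF B], of t x u t x u] by simp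
  show "norm (A t x u + B t x u - (A t x u' + B t x u')) \<le> 2 * K * norm (u - u')" for t x u u'
    using norm_triangle_mono[OF coefD(2)[OF A] coefD(2)[OF B], of t x u u' t x u u'] by (simp add: algebra_simps)
  show "norm (A' t x u a w + B' t x u a w) \<le> 2 * K * (1 + norm w)" if "a \<in> Basis" for t x u a w
    using norm_triangle_mono[OF coefD(3)[OF A that] coefD(3)[OF B that], of t x u w t x u w] by simp
  show "norm (A' t x u a w + B' t x u a w - (A' t x u' a w' + B' t x u' a w'))
      \<le> 2 * K * (norm (w - w') + (1 + norm w) * norm (u - u'))" if "a \<in> Basis" for t x u u' a w w'
    using norm_triangle_mono[OF coefD(4)[OF A that] coefD(4)[OF B that], of t x u w u' w' t x u w u' w'] by (simp add: add_diff_add)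
  show "((\<lambda>r. A t (x + r *\<^sub>R a) (v r) + B t (x + r *\<^sub>R a) (v r)) has_vector_derivative
      A' t x (v 0) a v' + B' t x (v 0) a v') (at 0)" if "a \<in> Basis" "(v has_vector_derivative v') (at 0)" for t x v v' a
    by (rule has_vector_derivative_add[OF coefD(5)[OF A that] coefD(5)[OF B that]])
qed

lemma coef_minus:
  assumes A: "coef K A A'"
  shows "coef K (\<lambda>t x u. - A t x u) (\<lambda>t x u a w. - A' t x u a w)"
  unfolding coef_def
proof (intro conjI allI ballI impI)
  show "continuous_on UNIV (\<lambda>(t, x, u). - A t x u)"
    unfolding case_prod_beta' by (intro continuous_on_minus coef_continuous[OF A] continuous_intros)
  show "continuous_on UNIV (\<lambda>(t, x, u, w). - A' t x u a w)" if "a \<in> Basis" for a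
    unfolding case_prod_beta' by (intro continuous_on_minus coef_continuous'[OF A that] continuous_intros)
  show "norm (- A t x u) \<le> K" for t x u using coefD(1)[OF A] by simp
  show "norm (- A t x u - - A t x u') \<le> K * norm (u - u')" for t x u u'
    using coefD(2)[OF A, of t x u u'] by (simp add: norm_minus_commute)
  show "norm (- A' t x u a w) \<le> K * (1 + norm w)" if "a \<in> Basis" for t x u a w
    using coefD(3)[OF A that] by simp
  show "norm (- A' t x u a w - - A' t x u' a w') \<le> K * (norm (w - w') + (1 + norm w) * norm (u - u'))" if "a \<in> Basis" for t x u u' a w w'
    using coefD(4)[OF A that, of t x u w u' w'] by (simp add: norm_minus_commute)
  show "((\<lambda>r. - A t (x + r *\<^sub>R a) (v r)) has_vector_derivative - A' t x (v 0) a v') (at 0)"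
    if "a \<in> Basis" "(v has_vector_derivative v') (at 0)" for t x v v' a
    by (rule has_vector_derivative_minus[OF coefD(5)[OF A that]])
qed

text \<open>Made for (\<eta> + u, \<nabla>)\<eta>, in which the gradient is a given field. The
  product rule yields two terms, each controlled by DIM K Q, whence the factor 2.\<close>

lemma coef_lin:
  fixes A :: "real \<Rightarrow> 'a::euclidean_space \<Rightarrow> 'a \<Rightarrow> 'a" and K Q :: real
  assumes A: "coef K A A'" and q: "\<And>b. b \<in> Basis \<Longrightarrow> bcont Q (q b)"
    and dq: "\<And>b a. b \<in> Basis \<Longrightarrow> a \<in> Basis \<Longrightarrow> bcont Q (dq b a)"
    and d: "\<And>b a t. b \<in> Basis \<Longrightarrow> a \<in> Basis \<Longrightarrow> has_pd (q b t) a (dq b a t)"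
  shows "coef (2 * (DIM('a) * K * Q)) (\<lambda>t x u. lin (A t x u) (\<lambda>b. q b t x))
     (\<lambda>t x u a w. lin (A' t x u a w) (\<lambda>b. q b t x) + lin (A t x u) (\<lambda>b. dq b a t x))"
  unfolding coef_def
proof (intro conjI allI ballI impI)
  let ?K = "DIM('a) * K * Q"
  have K: "K \<ge> 0" by (rule coefD(6)[OF A])
  obtain b0 :: 'a where b0: "b0 \<in> Basis" using nonempty_Basis by blast
  have Q: "Q \<ge> 0" using bcont_nonneg[OF q[OF b0]] .
  have KQ: "?K \<ge> 0" using K Q by simp
  have ql: "norm (q b t x) \<le> Q" if "b \<in> Basis" for b t x by (rule bcont_norm[OF q[OF that]])
  have dql: "norm (dq b a t x) \<le> Q" if "a \<in> Basis" "b \<in> Basis" for b a t x by (rule bcont_norm[OF dq[OF that(2,1)]])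
  show "continuous_on UNIV (\<lambda>(t, x, u). lin (A t x u) (\<lambda>b. q b t x))"
    unfolding case_prod_beta' lin_def
    by (intro continuous_on_sum continuous_on_scaleR continuous_on_inner coef_continuous[OF A] bcont_continuous[OF q] continuous_intros)
  show "continuous_on UNIV (\<lambda>(t, x, u, w). lin (A' t x u a w) (\<lambda>b. q b t x) + lin (A t x u) (\<lambda>b. dq b a t x))"
    if a: "a \<in> Basis" for a
    unfolding case_prod_beta' lin_def
    by (intro continuous_on_add continuous_on_sum continuous_on_scaleR continuous_on_inner
        coef_continuous[OF A] coef_continuous'[OF A a] bcont_continuous[OF q] bcont_continuous[OF dq] a continuous_intros)
  have lin_sub: "lin a p - lin b p = lin (a - b) p" for a b and p :: "'a \<Rightarrow> 'a"
    by (simp add: lin_def inner_diff_left scaleR_diff_left sum_subtractf)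
  show "norm (lin (A t x u) (\<lambda>b. q b t x)) \<le> 2 * ?K" for t x u
  proof -
    have "norm (lin (A t x u) (\<lambda>b. q b t x)) \<le> ?K" by (rule lin_bound[OF coefD(1)[OF A] ql])
    then show ?thesis using KQ by linarith
  qed
  show "norm (lin (A t x u) (\<lambda>b. q b t x) - lin (A t x u') (\<lambda>b. q b t x)) \<le> 2 * ?K * norm (u - u')" for t x u u'
  proof -
    have "norm (lin (A t x u - A t x u') (\<lambda>b. q b t x)) \<le> DIM('a) * (K * norm (u - u')) * Q"
      by (rule lin_bound[OF coefD(2)[OF A] ql])
    also have "\<dots> = ?K * norm (u - u')" by simp
    also have "\<dots> \<le> 2 * ?K * norm (u - u')" using KQ K Q by (intro mult_right_mono) auto
    finally show ?thesis unfolding lin_sub .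
  qed
  show "norm (lin (A' t x u a w) (\<lambda>b. q b t x) + lin (A t x u) (\<lambda>b. dq b a t x)) \<le> 2 * ?K * (1 + norm w)"
    if a: "a \<in> Basis" for t x u a w
  proof -
    have "norm (lin (A' t x u a w) (\<lambda>b. q b t x) + lin (A t x u) (\<lambda>b. dq b a t x)) \<le> DIM('a) * (K * (1 + norm w)) * Q + ?K"
      by (rule norm_triangle_mono[OF lin_bound[OF coefD(3)[OF A a] ql] lin_bound[OF coefD(1)[OF A] dql[OF a]]])
    also have "\<dots> = ?K * (1 + norm w) + ?K * 1" by simp
    also have "\<dots> \<le> ?K * (1 + norm w) + ?K * (1 + norm w)" using KQ K Q by (intro add_left_mono mult_left_mono) auto
    finally show ?thesis by (simp only: mult_2 distrib_right)
  qed
  show "norm (lin (A' t x u a w) (\<lambda>b. q b t x) + lin (A t x u) (\<lambda>b. dq b a t x) -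
      (lin (A' t x u' a w') (\<lambda>b. q b t x) + lin (A t x u') (\<lambda>b. dq b a t x)))
      \<le> 2 * ?K * (norm (w - w') + (1 + norm w) * norm (u - u'))" if a: "a \<in> Basis" for t x u u' a w w'
  proof -
    let ?d = "norm (w - w') + (1 + norm w) * norm (u - u')"
    have "norm (lin (A' t x u a w - A' t x u' a w') (\<lambda>b. q b t x) + lin (A t x u - A t x u') (\<lambda>b. dq b a t x))
      \<le> DIM('a) * (K * ?d) * Q + DIM('a) * (K * norm (u - u')) * Q"
      by (rule norm_triangle_mono[OF lin_bound[OF coefD(4)[OF A a] ql] lin_bound[OF coefD(2)[OF A] dql[OF a]]])
    also have "\<dots> = ?K * ?d + ?K * norm (u - u')" by simp
    also have "\<dots> \<le> ?K * ?d + ?K * ?d"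
      using KQ K Q by (intro add_left_mono mult_left_mono) (auto simp: distrib_right intro: add_nonneg_nonneg)
    finally show ?thesis unfolding add_diff_add lin_sub by (simp only: mult_2 distrib_right)
  qed
  show "((\<lambda>r. lin (A t (x + r *\<^sub>R a) (v r)) (\<lambda>b. q b t (x + r *\<^sub>R a))) has_vector_derivative
      lin (A' t x (v 0) a v') (\<lambda>b. q b t x) + lin (A t x (v 0)) (\<lambda>b. dq b a t x)) (at 0)"
    if a: "a \<in> Basis" and v: "(v has_vector_derivative v') (at 0)" for t x v v' a
  proof -
    have "((\<lambda>r. (A t (x + r *\<^sub>R a) (v r) \<bullet> b) *\<^sub>R q b t (x + r *\<^sub>R a)) has_vector_derivative
        (A' t x (v 0) a v' \<bullet> b) *\<^sub>R q b t x + (A t x (v 0) \<bullet> b) *\<^sub>R dq b a t x) (at 0)" if b: "b \<in> Basis" for b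
    proof -
      have 1: "((\<lambda>r. A t (x + r *\<^sub>R a) (v r) \<bullet> b) has_real_derivative A' t x (v 0) a v' \<bullet> b) (at 0)"
        unfolding has_real_derivative_iff_has_vector_derivative
        by (rule bounded_linear.has_vector_derivative[OF bounded_linear_inner_left coefD(5)[OF A a v]])
      have 2: "((\<lambda>r. q b t (x + r *\<^sub>R a)) has_vector_derivative dq b a t x) (at 0)"
        using d[OF b a] by (simp add: has_pd_def)
      from has_vector_derivative_scaleR[OF 1 2] show ?thesis by (simp add: add.commute)
    qed
    from has_vector_derivative_sum[OF this] show ?thesis by (simp add: lin_def sum.distrib)
  qed
qed

lemma partials_lipschitz:
  fixes \<phi> :: "'c::euclidean_space \<Rightarrow> 'b::euclidean_space" and B :: real
  assumes d: "\<And>b. b \<in> Basis \<Longrightarrow> has_pd \<phi> b (\<phi>' b)" and c: "\<And>b. b \<in> Basis \<Longrightarrow> continuous_on UNIV (\<phi>' b)"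
    and B: "\<And>b z. b \<in> Basis \<Longrightarrow> norm (\<phi>' b z) \<le> B"
  shows "norm (\<phi> y - \<phi> z) \<le> DIM('c) * B * norm (y - z)"
proof -
  have "norm (\<phi> (z + (1 * 1) *\<^sub>R (y - z)) - \<phi> (z + (1 * 0) *\<^sub>R (y - z))) \<le> (DIM('c) * norm (y - z) * B) * \<bar>1 - 0\<bar>"
  proof (rule norm_diff_le_vector_derivative[where f="\<lambda>q. \<phi> (z + (1 * q) *\<^sub>R (y - z))", OF line_has_vector_derivative[OF d c]])
    show "norm (\<Sum>b\<in>Basis. (1 * ((y - z) \<bullet> b)) *\<^sub>R \<phi>' b (z + (1 * r) *\<^sub>R (y - z))) \<le> DIM('c) * norm (y - z) * B" for r
      using lin_bound[of "y - z" "norm (y - z)" "\<lambda>b. \<phi>' b (z + r *\<^sub>R (y - z))" B] B by (simp add: lin_def)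
  qed auto
  then show ?thesis by (simp add: mult_ac)
qed

text \<open>Made for f(t, x, \<eta> + u), seen as a function on the product space evaluated at (x,
  Y(t,x,u)). The derivative of a coefficient must be Lipschitz in u; by the chain rule this asks for
  a Lipschitz gradient of F, which the bounded second derivatives \<open>ddF\<close> supply.\<close>

lemma coef_compose:
  fixes F :: "real \<Rightarrow> 'a::euclidean_space \<times> 'a \<Rightarrow> 'a"
  assumes Y: "coef K Y Y'" and F: "bcont Q F" and dF: "\<And>b. b \<in> Basis \<Longrightarrow> bcont Q (dF b)"
    and ddF: "\<And>b a. b \<in> Basis \<Longrightarrow> a \<in> Basis \<Longrightarrow> bcont Q (ddF b a)"
    and d: "\<And>b t. b \<in> Basis \<Longrightarrow> has_pd (F t) b (dF b t)"
    and dd: "\<And>b a t. b \<in> Basis \<Longrightarrow> a \<in> Basis \<Longrightarrow> has_pd (dF b t) a (ddF b a t)"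
  shows "\<exists>K'. coef K' (\<lambda>t x u. F t (x, Y t x u)) (\<lambda>t x u a w. lin (a, Y' t x u a w) (\<lambda>b. dF b t (x, Y t x u)))"
proof -
  let ?n = "real DIM('a \<times> 'a)"
  obtain b0 :: "'a \<times> 'a" where b0: "b0 \<in> Basis" using nonempty_Basis by blast
  have Q: "Q \<ge> 0" using bcont_nonneg[OF F] .
  have K: "K \<ge> 0" by (rule coefD(6)[OF Y])
  have n0: "?n \<ge> 0" by simp
  have pair: "norm (x, y) \<le> norm x + norm y" for x y :: 'a by (rule norm_Pair_le)
  have LF: "norm (F t (x, y) - F t (x, y')) \<le> ?n * Q * norm (y - y')" for t x y y'
    using partials_lipschitz[OF d bcont_slice[OF dF] bcont_norm[OF dF], of t "(x, y)" "(x, y')"] by simp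
  have LdF: "norm (dF b t (x, y) - dF b t (x, y')) \<le> ?n * Q * norm (y - y')" if "b \<in> Basis" for b t x y y'
    using partials_lipschitz[OF dd[OF that] bcont_slice[OF ddF[OF that]] bcont_norm[OF ddF[OF that]], of t "(x, y)" "(x, y')"] by simp
  have nA: "norm (a, Y' t x u a w) \<le> (1 + K) * (1 + norm w)" if a: "a \<in> Basis" for t x u a w
  proof -
    have "norm (a, Y' t x u a w) \<le> 1 + K * (1 + norm w)"
      using order_trans[OF pair[of a "Y' t x u a w"]] coefD(3)[OF Y a, of t x u w] a by (simp add: norm_Basis)
    also have "\<dots> \<le> (1 + K) * (1 + norm w)" by (simp add: algebra_simps)
    finally show ?thesis .
  qed
  \<comment> \<open>The summands are the size of F, its Lipschitz constant in u, the size of the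
    derivative, and the variation of \<open>dF\<close> between two base points.\<close>
  define K' where "K' = Q + ?n * Q * K + ?n * (1 + K) * Q + ?n * (1 + K) * (?n * Q * K)"
  have parts: "0 \<le> ?n * Q * K" "0 \<le> ?n * (1 + K) * Q" "0 \<le> ?n * (1 + K) * (?n * Q * K)"
    using Q K n0 by auto
  have "coef K' (\<lambda>t x u. F t (x, Y t x u)) (\<lambda>t x u a w. lin (a, Y' t x u a w) (\<lambda>b. dF b t (x, Y t x u)))"
    unfolding coef_def
  proof (intro conjI allI ballI impI)
    show "continuous_on UNIV (\<lambda>(t, x, u). F t (x, Y t x u))"
      unfolding case_prod_beta' by (intro bcont_continuous[OF F] coef_continuous[OF Y] continuous_intros)
    show "continuous_on UNIV (\<lambda>(t, x, u, w). lin (a, Y' t x u a w) (\<lambda>b. dF b t (x, Y t x u)))" if a: "a \<in> Basis" for a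
      unfolding case_prod_beta' lin_def
      by (intro continuous_on_sum continuous_on_scaleR continuous_on_inner bcont_continuous[OF dF]
          continuous_on_Pair coef_continuous[OF Y] coef_continuous'[OF Y a] continuous_intros)
    show "norm (F t (x, Y t x u)) \<le> K'" for t x u
      using bcont_norm[OF F, of t "(x, Y t x u)"] parts unfolding K'_def by linarith
    show "norm (F t (x, Y t x u) - F t (x, Y t x u')) \<le> K' * norm (u - u')" for t x u u'
    proof -
      have "norm (F t (x, Y t x u) - F t (x, Y t x u')) \<le> ?n * Q * norm (Y t x u - Y t x u')" by (rule LF)
      also have "\<dots> \<le> ?n * Q * (K * norm (u - u'))" using Q by (intro mult_left_mono coefD(2)[OF Y]) auto
      also have "\<dots> = ?n * Q * K * norm (u - u')" by simp
      also have "\<dots> \<le> K' * norm (u - u')" using parts Q unfolding K'_def by (intro mult_right_mono) auto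
      finally show ?thesis .
    qed
    show "norm (lin (a, Y' t x u a w) (\<lambda>b. dF b t (x, Y t x u))) \<le> K' * (1 + norm w)" if a: "a \<in> Basis" for t x u a w
    proof -
      have "norm (lin (a, Y' t x u a w) (\<lambda>b. dF b t (x, Y t x u))) \<le> ?n * ((1 + K) * (1 + norm w)) * Q"
        by (rule lin_bound[OF nA[OF a] bcont_norm[OF dF]])
      also have "\<dots> = ?n * (1 + K) * Q * (1 + norm w)" by simp
      also have "\<dots> \<le> K' * (1 + norm w)" using parts Q unfolding K'_def by (intro mult_right_mono) auto
      finally show ?thesis .
    qed
    show "norm (lin (a, Y' t x u a w) (\<lambda>b. dF b t (x, Y t x u)) - lin (a, Y' t x u' a w') (\<lambda>b. dF b t (x, Y t x u')))
        \<le> K' * (norm (w - w') + (1 + norm w) * norm (u - u'))" if a: "a \<in> Basis" for t x u u' a w w'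
    proof -
      let ?d = "norm (w - w') + (1 + norm w) * norm (u - u')"
      have d0: "?d \<ge> 0" by simp
      have 1: "norm ((a, Y' t x u' a w') - (a, Y' t x u a w)) \<le> K * ?d"
        using coefD(4)[OF Y a, of t x u w u' w'] by (simp add: norm_minus_commute)
      have 2: "norm (dF b t (x, Y t x u') - dF b t (x, Y t x u)) \<le> ?n * Q * K * norm (u - u')" if "b \<in> Basis" for b
      proof -
        have "norm (dF b t (x, Y t x u') - dF b t (x, Y t x u)) \<le> ?n * Q * norm (Y t x u' - Y t x u)" by (rule LdF[OF that])
        also have "\<dots> \<le> ?n * Q * (K * norm (u' - u))" using Q by (intro mult_left_mono coefD(2)[OF Y]) auto
        finally show ?thesis by (simp add: norm_minus_commute)
      qed
      have "norm (lin (a, Y' t x u' a w') (\<lambda>b. dF b t (x, Y t x u')) - lin (a, Y' t x u a w) (\<lambda>b. dF b t (x, Y t x u)))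
        \<le> ?n * (K * ?d) * Q + ?n * ((1 + K) * (1 + norm w)) * (?n * Q * K * norm (u - u'))"
        by (rule lin_diff[OF 1 nA[OF a] bcont_norm[OF dF] 2])
      also have "\<dots> = ?n * Q * K * ?d + ?n * (1 + K) * (?n * Q * K) * ((1 + norm w) * norm (u - u'))" by (simp add: mult_ac)
      also have "\<dots> \<le> ?n * Q * K * ?d + ?n * (1 + K) * (?n * Q * K) * ?d"
        using parts by (intro add_left_mono mult_left_mono) auto
      also have "\<dots> \<le> K' * ?d"
        unfolding distrib_right[symmetric] using parts Q d0 unfolding K'_def by (intro mult_right_mono) auto
      finally show ?thesis by (simp add: norm_minus_commute)
    qed
    show "((\<lambda>r. F t (x + r *\<^sub>R a, Y t (x + r *\<^sub>R a) (v r))) has_vector_derivative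
        lin (a, Y' t x (v 0) a v') (\<lambda>b. dF b t (x, Y t x (v 0)))) (at 0)"
      if a: "a \<in> Basis" and v: "(v has_vector_derivative v') (at 0)" for t x v v' a
    proof -
      let ?z = "\<lambda>r. (x + r *\<^sub>R a, Y t (x + r *\<^sub>R a) (v r))"
      have 1: "(?z has_derivative (\<lambda>h. h *\<^sub>R (a, Y' t x (v 0) a v'))) (at 0)"
      proof -
        have "((\<lambda>r. x + r *\<^sub>R a) has_derivative (\<lambda>h. h *\<^sub>R a)) (at 0)" by (auto intro!: derivative_eq_intros)
        moreover have "((\<lambda>r. Y t (x + r *\<^sub>R a) (v r)) has_derivative (\<lambda>h. h *\<^sub>R Y' t x (v 0) a v')) (at 0)"
          using coefD(5)[OF Y a v] by (simp add: has_vector_derivative_def)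
        ultimately show ?thesis unfolding scaleR_Pair by (rule has_derivative_Pair)
      qed
      have 2: "(F t has_derivative (\<lambda>h. \<Sum>b\<in>Basis. (h \<bullet> b) *\<^sub>R dF b t (?z 0))) (at (?z 0))"
        using bcont_slice[OF dF] by (intro has_derivative_from_partials d) (auto simp: continuous_on_eq_continuous_at)
      have 3: "(\<Sum>b\<in>Basis. ((h *\<^sub>R (a, Y' t x (v 0) a v')) \<bullet> b) *\<^sub>R dF b t (?z 0)) = h *\<^sub>R lin (a, Y' t x (v 0) a v') (\<lambda>b. dF b t (x, Y t x (v 0)))" for h
        by (simp only: lin_def inner_scaleR_left scaleR_scaleR[symmetric] scaleR_sum_right[symmetric]) simp
      from diff_chain_at[OF 1 2] show ?thesis
        unfolding has_vector_derivative_def o_def 3 .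
    qed
  qed
  then show ?thesis by blast
qed

section \<open>Spatial derivatives and the truncated Burgers coefficients\<close>

text \<open>The vector form of the componentwise \<open>Dl\<close>. Through \<open>lap_VD\<close>
  and \<open>adv_VD\<close> the operators of the equation take the shape used by
  \<open>has_pd\<close> and \<open>lin\<close>.\<close>

definition VD :: "'a::euclidean_space list \<Rightarrow> ('a \<Rightarrow> 'b::euclidean_space) \<Rightarrow> 'a \<Rightarrow> 'b" where
  "VD bs u x = (\<Sum>c\<in>Basis. Dl bs (\<lambda>z. u z \<bullet> c) x *\<^sub>R c)"

lemma VD_inner: "c \<in> Basis \<Longrightarrow> VD bs u x \<bullet> c = Dl bs (\<lambda>z. u z \<bullet> c) x"
  unfolding VD_def by simp

lemma VD_Nil: "VD [] u = u"
  by (rule ext) (simp add: VD_def euclidean_representation)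

lemma lap_VD: "lap u x = (\<Sum>b\<in>Basis. VD [b, b] u x)"
  unfolding lap_def VD_def scaleR_sum_left by (rule sum.swap)

lemma adv_VD: "adv w v x = lin w (\<lambda>b. VD [b] v x)"
proof -
  have "adv w v x = (\<Sum>c\<in>Basis. \<Sum>b\<in>Basis. ((w \<bullet> b) * Dl [b] (\<lambda>z. v z \<bullet> c) x) *\<^sub>R c)"
    unfolding adv_def scaleR_sum_left ..
  also have "\<dots> = (\<Sum>b\<in>Basis. \<Sum>c\<in>Basis. ((w \<bullet> b) * Dl [b] (\<lambda>z. v z \<bullet> c) x) *\<^sub>R c)" by (rule sum.swap)
  finally show ?thesis unfolding lin_def VD_def by (simp add: scaleR_sum_right)
qed

lemma VD_bound:
  fixes u :: "'a::euclidean_space \<Rightarrow> 'b::euclidean_space" and K :: real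
  assumes "\<And>c. c \<in> Basis \<Longrightarrow> \<bar>Dl bs (\<lambda>z. u z \<bullet> c) x\<bar> \<le> K"
  shows "norm (VD bs u x) \<le> DIM('b) * K"
proof -
  have "norm (VD bs u x) \<le> (\<Sum>c\<in>Basis. \<bar>VD bs u x \<bullet> c\<bar>)" by (rule norm_le_l1)
  also have "\<dots> \<le> (\<Sum>c\<in>(Basis::'b set). K)" by (intro sum_mono) (simp add: VD_inner assms)
  finally show ?thesis by simp
qed

lemma C0l_b_has_pd:
  assumes u: "C0l_b l T u" and bs: "set bs \<subseteq> Basis" "length bs < l" and t: "t \<in> {0..T}" and b: "b \<in> Basis"
  shows "has_pd (VD bs (u t)) b (VD (b # bs) (u t))"
  unfolding has_pd_def
proof
  fix x
  show "((\<lambda>r. VD bs (u t) (x + r *\<^sub>R b)) has_vector_derivative VD (b # bs) (u t) x) (at 0)"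
    unfolding VD_def
  proof (rule has_vector_derivative_sum)
    fix c :: 'b assume c: "c \<in> Basis"
    have "((\<lambda>r. Dl bs (\<lambda>z. u t z \<bullet> c) (x + r *\<^sub>R b)) has_real_derivative Dl (b # bs) (\<lambda>z. u t z \<bullet> c) x) (at 0)"
      using u c bs t b less_imp_le[OF bs(2)] unfolding C0l_b_def by blast
    then show "((\<lambda>r. Dl bs (\<lambda>z. u t z \<bullet> c) (x + r *\<^sub>R b) *\<^sub>R c) has_vector_derivative Dl (b # bs) (\<lambda>z. u t z \<bullet> c) x *\<^sub>R c) (at 0)"
      unfolding has_real_derivative_iff_has_vector_derivative
      by (rule bounded_linear.has_vector_derivative[OF bounded_linear_scaleR_left])
  qed
qed

lemma C0l_b_continuous:
  assumes u: "C0l_b l T u" and bs: "set bs \<subseteq> Basis" "length bs \<le> l"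
  shows "continuous_on ({0..T} \<times> UNIV) (\<lambda>(t, x). VD bs (u t) x)"
  unfolding VD_def case_prod_beta'
proof (intro continuous_on_sum continuous_on_scaleR continuous_on_const)
  fix c :: 'b assume "c \<in> Basis"
  then have "continuous_on ({0..T} \<times> UNIV) (\<lambda>(t, x). Dl bs (\<lambda>z. u t z \<bullet> c) x)"
    using u bs unfolding C0l_b_def by blast
  then show "continuous_on ({0..T} \<times> UNIV) (\<lambda>p. Dl bs (\<lambda>z. u (fst p) z \<bullet> c) (snd p))"
    by (simp add: case_prod_beta')
qed

text \<open>There are finitely many lists of basis directions of bounded length and finitely many
  components, so the sum of the separate bounds is a common one.\<close>

lemma C0l_b_bound:
  fixes u :: "real \<Rightarrow> 'a::euclidean_space \<Rightarrow> 'b::euclidean_space"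
  assumes u: "C0l_b l T u"
  shows "\<exists>C. \<forall>bs. set bs \<subseteq> Basis \<and> length bs \<le> l \<longrightarrow> (\<forall>t\<in>{0..T}. \<forall>x. norm (VD bs (u t) x) \<le> C)"
proof -
  let ?S = "{bs::'a list. set bs \<subseteq> Basis \<and> length bs \<le> l} \<times> (Basis :: 'b set)"
  have fin: "finite ?S" by (intro finite_cartesian_product finite_lists_length_le finite_Basis)
  have "\<forall>q\<in>?S. \<exists>K. \<forall>t\<in>{0..T}. \<forall>x. \<bar>Dl (fst q) (\<lambda>z. u t z \<bullet> snd q) x\<bar> \<le> K"
  proof
    fix q assume "q \<in> ?S"
    then have "bounded ((\<lambda>(t, x). Dl (fst q) (\<lambda>z. u t z \<bullet> snd q) x) ` ({0..T} \<times> UNIV))"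
      using u unfolding C0l_b_def by auto
    then show "\<exists>K. \<forall>t\<in>{0..T}. \<forall>x. \<bar>Dl (fst q) (\<lambda>z. u t z \<bullet> snd q) x\<bar> \<le> K"
      by (auto simp: bounded_iff)
  qed
  from bchoice[OF this] obtain K where K: "\<forall>q\<in>?S. \<forall>t\<in>{0..T}. \<forall>x. \<bar>Dl (fst q) (\<lambda>z. u t z \<bullet> snd q) x\<bar> \<le> K q"
    by (elim exE)
  define K0 where "K0 = (\<Sum>q\<in>?S. \<bar>K q\<bar>)"
  have KK0: "K q \<le> K0" if "q \<in> ?S" for q
    using member_le_sum[OF that, of "\<lambda>q. \<bar>K q\<bar>"] fin unfolding K0_def by force
  have K0: "\<bar>Dl bs (\<lambda>z. u t z \<bullet> c) x\<bar> \<le> K0" if "set bs \<subseteq> Basis" "length bs \<le> l" "t \<in> {0..T}" "c \<in> Basis" for bs t x c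
  proof -
    have q: "(bs, c) \<in> ?S" using that by simp
    have "\<bar>Dl (fst (bs, c)) (\<lambda>z. u t z \<bullet> snd (bs, c)) x\<bar> \<le> K (bs, c)"
      using K[rule_format, OF q that(3)] .
    also have "\<dots> \<le> K0" by (rule KK0[OF q])
    finally show ?thesis by simp
  qed
  show ?thesis
  proof (intro exI[of _ "DIM('b) * K0"] allI impI ballI)
    fix bs :: "'a list" and t x assume "set bs \<subseteq> Basis \<and> length bs \<le> l" "t \<in> {0..T}"
    then show "norm (VD bs (u t) x) \<le> DIM('b) * K0" by (intro VD_bound K0) simp_all
  qed
qed

lemma C0l_b_of_Cl_b:
  assumes "Cl_b l u"
  shows "C0l_b l T (\<lambda>_. u)"
  unfolding C0l_b_def
proof (intro ballI allI impI)
  fix c :: 'b and bs :: "'a list" assume c: "c \<in> Basis" and bs: "set bs \<subseteq> Basis \<and> length bs \<le> l"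
  note * = assms[unfolded Cl_b_def, rule_format, OF c bs]
  note c1 = *[THEN conjunct2, THEN conjunct1] and c2 = *[THEN conjunct2, THEN conjunct2]
  have d1: "continuous_on ({0..T} \<times> UNIV) (\<lambda>(t, x). Dl bs (\<lambda>z. u z \<bullet> c) x)"
    unfolding case_prod_beta'
    by (rule continuous_on_compose2[OF c1 continuous_on_snd[OF continuous_on_id] subset_UNIV])
  have d2: "bounded ((\<lambda>(t, x). Dl bs (\<lambda>z. u z \<bullet> c) x) ` ({0..T} \<times> UNIV))"
    by (rule bounded_subset[OF c2]) auto
  show "(length bs < l \<longrightarrow> (\<forall>t\<in>{0..T}. \<forall>x. \<forall>b\<in>Basis.
      ((\<lambda>r. Dl bs (\<lambda>z. u z \<bullet> c) (x + r *\<^sub>R b)) has_real_derivative Dl (b # bs) (\<lambda>z. u z \<bullet> c) x) (at 0))) \<and>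
      continuous_on ({0..T} \<times> UNIV) (\<lambda>(t, x). Dl bs (\<lambda>z. u z \<bullet> c) x) \<and>
      bounded ((\<lambda>(t, x). Dl bs (\<lambda>z. u z \<bullet> c) x) ` ({0..T} \<times> UNIV))"
    using *[THEN conjunct1] d1 d2 by simp
qed

lemma Dl_of_has_pd:
  assumes "has_pd v b v'"
  shows "Dl [b] (\<lambda>z. v z \<bullet> c) = (\<lambda>x. v' x \<bullet> c)"
    "((\<lambda>r. v (x + r *\<^sub>R b) \<bullet> c) has_real_derivative v' x \<bullet> c) (at 0)"
proof -
  show *: "((\<lambda>r. v (x + r *\<^sub>R b) \<bullet> c) has_real_derivative v' x \<bullet> c) (at 0)" for x
    unfolding has_real_derivative_iff_has_vector_derivative
    by (rule bounded_linear.has_vector_derivative[OF bounded_linear_inner_left]) (use assms in \<open>simp add: has_pd_def\<close>)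
  show "Dl [b] (\<lambda>z. v z \<bullet> c) = (\<lambda>x. v' x \<bullet> c)"
    by (rule ext) (simp add: pd_def DERIV_imp_deriv[OF *])
qed

lemma VD_of_has_pd: "has_pd v b v' \<Longrightarrow> VD [b] v = v'"
  unfolding VD_def by (rule ext) (simp only: Dl_of_has_pd(1) euclidean_representation)

lemma Dl2_of_has_pd:
  assumes "has_pd v b v'" "has_pd v' a v''"
  shows "Dl [a, b] (\<lambda>z. v z \<bullet> c) = (\<lambda>x. v'' x \<bullet> c)"
proof -
  have "Dl [a, b] (\<lambda>z. v z \<bullet> c) = Dl [a] (Dl [b] (\<lambda>z. v z \<bullet> c))" by simp
  also have "\<dots> = (\<lambda>x. v'' x \<bullet> c)" unfolding Dl_of_has_pd(1)[OF assms(1)] by (rule Dl_of_has_pd(1)[OF assms(2)])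
  finally show ?thesis .
qed

lemma VD2_of_has_pd: "has_pd v b v' \<Longrightarrow> has_pd v' a v'' \<Longrightarrow> VD [a, b] v = v''"
  unfolding VD_def by (rule ext) (simp only: Dl2_of_has_pd euclidean_representation)

text \<open>A field satisfying \<open>has_pd\<close> determines the value of \<open>deriv\<close>,
  so the conditions on lists of length 0, 1, 2 become conditions on u, p and P. The list [a, b]
  differentiates by \<open>b\<close> first, hence it corresponds to \<open>P b a\<close>.\<close>

lemma C0l_b_2I:
  fixes u :: "real \<Rightarrow> 'a::euclidean_space \<Rightarrow> 'b::euclidean_space"
  assumes u: "continuous_on ({0..T} \<times> UNIV) (\<lambda>(t, x). u t x)" "\<And>t x. t \<in> {0..T} \<Longrightarrow> norm (u t x) \<le> C"
    and p: "\<And>b. b \<in> Basis \<Longrightarrow> continuous_on ({0..T} \<times> UNIV) (\<lambda>(t, x). p b t x)"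
      "\<And>b t x. b \<in> Basis \<Longrightarrow> t \<in> {0..T} \<Longrightarrow> norm (p b t x) \<le> C"
    and P: "\<And>b a. b \<in> Basis \<Longrightarrow> a \<in> Basis \<Longrightarrow> continuous_on ({0..T} \<times> UNIV) (\<lambda>(t, x). P b a t x)"
      "\<And>b a t x. b \<in> Basis \<Longrightarrow> a \<in> Basis \<Longrightarrow> t \<in> {0..T} \<Longrightarrow> norm (P b a t x) \<le> C"
    and dp: "\<And>b t. b \<in> Basis \<Longrightarrow> t \<in> {0..T} \<Longrightarrow> has_pd (u t) b (p b t)"
    and dP: "\<And>b a t. b \<in> Basis \<Longrightarrow> a \<in> Basis \<Longrightarrow> t \<in> {0..T} \<Longrightarrow> has_pd (p b t) a (P b a t)"
  shows "C0l_b 2 T u"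
  unfolding C0l_b_def
proof (intro ballI allI impI)
  fix c :: 'b and bs :: "'a list" assume c: "c \<in> Basis" and bs: "set bs \<subseteq> Basis \<and> length bs \<le> 2"
  have cb: "continuous_on ({0..T} \<times> UNIV) (\<lambda>(t, x). D t x) \<and> bounded ((\<lambda>(t, x). D t x) ` ({0..T} \<times> UNIV))"
    if v: "continuous_on ({0..T} \<times> UNIV) (\<lambda>(t, x). v t x)" "\<And>t x. t \<in> {0..T} \<Longrightarrow> norm (v t x) \<le> C"
      and D: "\<And>t x. t \<in> {0..T} \<Longrightarrow> D t x = v t x \<bullet> c" for D and v :: "real \<Rightarrow> 'a \<Rightarrow> 'b"
  proof
    have "continuous_on ({0..T} \<times> UNIV) (\<lambda>q. v (fst q) (snd q) \<bullet> c)"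
      using v(1) by (intro continuous_intros) (simp add: case_prod_beta')
    then show "continuous_on ({0..T} \<times> UNIV) (\<lambda>(t, x). D t x)"
      by (rule continuous_on_cong[THEN iffD1, rotated -1]) (auto simp: D)
    have "\<bar>D t x\<bar> \<le> C" if "t \<in> {0..T}" for t x
      using Basis_le_norm[OF c, of "v t x"] v(2)[OF that, of x] D[OF that, of x] by linarith
    then show "bounded ((\<lambda>(t, x). D t x) ` ({0..T} \<times> UNIV))" by (auto simp: bounded_iff intro!: exI[of _ C])
  qed
  consider "bs = []" | b where "bs = [b]" "b \<in> Basis" | a b where "bs = [a, b]" "a \<in> Basis" "b \<in> Basis"
    using bs by (cases bs; cases "tl bs"; cases "tl (tl bs)") auto
  then show "(length bs < 2 \<longrightarrow> (\<forall>t\<in>{0..T}. \<forall>x. \<forall>b\<in>Basis.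
      ((\<lambda>r. Dl bs (\<lambda>z. u t z \<bullet> c) (x + r *\<^sub>R b)) has_real_derivative Dl (b # bs) (\<lambda>z. u t z \<bullet> c) x) (at 0))) \<and>
      continuous_on ({0..T} \<times> UNIV) (\<lambda>(t, x). Dl bs (\<lambda>z. u t z \<bullet> c) x) \<and>
      bounded ((\<lambda>(t, x). Dl bs (\<lambda>z. u t z \<bullet> c) x) ` ({0..T} \<times> UNIV))"
  proof cases
    case 1
    have "((\<lambda>r. Dl [] (\<lambda>z. u t z \<bullet> c) (x + r *\<^sub>R b)) has_real_derivative Dl [b] (\<lambda>z. u t z \<bullet> c) x) (at 0)"
      if "t \<in> {0..T}" "b \<in> Basis" for t x b
      unfolding Dl_of_has_pd(1)[OF dp[OF that(2,1)]] unfolding Dl.simps by (rule Dl_of_has_pd(2)[OF dp[OF that(2,1)]])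
    then show ?thesis unfolding 1 using cb[OF u, of "\<lambda>t. Dl [] (\<lambda>z. u t z \<bullet> c)"] by auto
  next
    case (2 b)
    have "((\<lambda>r. Dl [b] (\<lambda>z. u t z \<bullet> c) (x + r *\<^sub>R a)) has_real_derivative Dl [a, b] (\<lambda>z. u t z \<bullet> c) x) (at 0)"
      if t: "t \<in> {0..T}" and a: "a \<in> Basis" for t x a
      unfolding Dl2_of_has_pd[OF dp[OF 2(2) t] dP[OF 2(2) a t]] Dl_of_has_pd(1)[OF dp[OF 2(2) t]]
      by (rule Dl_of_has_pd(2)[OF dP[OF 2(2) a t]])
    moreover have "Dl [b] (\<lambda>z. u t z \<bullet> c) x = p b t x \<bullet> c" if "t \<in> {0..T}" for t x
      unfolding Dl_of_has_pd(1)[OF dp[OF 2(2) that]] ..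
    ultimately show ?thesis unfolding 2(1) using cb[OF p(1)[OF 2(2)] p(2)[OF 2(2)], of "\<lambda>t. Dl [b] (\<lambda>z. u t z \<bullet> c)"] by blast
  next
    case (3 a b)
    have "Dl [a, b] (\<lambda>z. u t z \<bullet> c) x = P b a t x \<bullet> c" if t: "t \<in> {0..T}" for t x
      unfolding Dl2_of_has_pd[OF dp[OF 3(3) t] dP[OF 3(3) 3(2) t]] ..
    then show ?thesis unfolding 3(1) using cb[OF P(1)[OF 3(3,2)] P(2)[OF 3(3,2)], of "\<lambda>t. Dl [a, b] (\<lambda>z. u t z \<bullet> c)"] by simp
  qed
qed

text \<open>The data are given on [0,T] while \<open>coef\<close> asks for continuity on the whole
  line; they are extended by their end values.\<close>

definition clp :: "real \<Rightarrow> real \<Rightarrow> real" where "clp T t = max 0 (min T t)"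

lemma clp_in: "T \<ge> 0 \<Longrightarrow> clp T t \<in> {0..T}" by (auto simp: clp_def)
lemma clp_id: "t \<in> {0..T} \<Longrightarrow> clp T t = t" by (auto simp: clp_def)

lemma bcont_clp:
  assumes T: "T \<ge> 0" and c: "continuous_on ({0..T} \<times> UNIV) (\<lambda>(t, x). v t x)"
    and b: "\<And>t x. t \<in> {0..T} \<Longrightarrow> norm (v t x) \<le> C"
  shows "bcont C (\<lambda>t x. v (clp T t) x)"
  unfolding bcont_def
proof (intro conjI allI)
  have "continuous_on UNIV (\<lambda>p::real \<times> 'a. (clp T (fst p), snd p))"
    unfolding clp_def by (intro continuous_intros)
  from continuous_on_compose2[OF c this] clp_in[OF T]
  show "continuous_on UNIV (\<lambda>(t, x). v (clp T t) x)" by (force simp: case_prod_beta')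
  show "norm (v (clp T t) x) \<le> C" for t x by (rule b[OF clp_in[OF T]])
qed

text \<open>In reversed time the system reads u_t = \<nu>\<Delta>u - (\<eta> + u, \<nabla>)u + F.
  The locale adds \<open>lin (A t x u) p\<close>, so the velocity enters with a minus sign. Every
  undifferentiated u, in the velocity and in the source, is truncated.\<close>

definition burgers_drift where "burgers_drift R T e t x u = - (e (clp T t) x + Tr R u)"
definition burgers_drift' where "burgers_drift' R T e t x u a w = - (VD [a] (e (clp T t)) x + dTr R u w)"
definition burgers_source where "burgers_source R T \<nu> f e t x u = f (clp T t) x (e (clp T t) x + Tr R u) + \<nu> *\<^sub>R lap (e (clp T t)) x
    - lin (e (clp T t) x + Tr R u) (\<lambda>b. VD [b] (e (clp T t)) x)"
definition burgers_source' where "burgers_source' R T \<nu> f e t x u a w =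
    lin (a, VD [a] (e (clp T t)) x + dTr R u w) (\<lambda>b. VD [b] (\<lambda>xy. f (clp T t) (fst xy) (snd xy)) (x, e (clp T t) x + Tr R u))
    + \<nu> *\<^sub>R (\<Sum>b\<in>Basis. VD [a, b, b] (e (clp T t)) x)
    + - (lin (VD [a] (e (clp T t)) x + dTr R u w) (\<lambda>b. VD [b] (e (clp T t)) x)
       + lin (e (clp T t) x + Tr R u) (\<lambda>b. VD [a, b] (e (clp T t)) x))"

text \<open>Velocity and source are assembled by the closure rules. The x-derivative of
  \<nu>\<Delta>\<eta> uses third derivatives of \<eta>, and the second derivatives of f make its
  gradient Lipschitz. The constant depends on R and on the path; it governs the convergence of the
  iteration but not the final bound on the solution.\<close>

lemma burgers_coefs:
  fixes f :: "real \<Rightarrow> 'a::euclidean_space \<Rightarrow> 'a \<Rightarrow> 'a"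
  assumes T: "T \<ge> 0" and R: "R \<ge> 0" and f: "C0l_b 2 T (\<lambda>t xy. f t (fst xy) (snd xy))" and e: "C0l_b 4 T e"
  shows "\<exists>K. coef K (burgers_drift R T e) (burgers_drift' R T e) \<and> coef K (burgers_source R T \<nu> f e) (burgers_source' R T \<nu> f e)"
proof -
  obtain C where C: "\<forall>bs. set bs \<subseteq> Basis \<and> length bs \<le> 4 \<longrightarrow> (\<forall>t\<in>{0..T}. \<forall>x. norm (VD bs (e t) x) \<le> C)"
    using C0l_b_bound[OF e] by (elim exE)
  obtain Cf where Cf: "\<forall>bs. set bs \<subseteq> Basis \<and> length bs \<le> 2 \<longrightarrow> (\<forall>t\<in>{0..T}. \<forall>x. norm (VD bs (\<lambda>xy. f t (fst xy) (snd xy)) x) \<le> Cf)"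
    using C0l_b_bound[OF f] by (elim exE)
  have eb: "bcont C (\<lambda>t x. VD bs (e (clp T t)) x)" if "set bs \<subseteq> Basis" "length bs \<le> 4" for bs
    by (rule bcont_clp[OF T C0l_b_continuous[OF e that], of C]) (use C that in auto)
  have ed: "has_pd (VD bs (e (clp T t))) b (VD (b # bs) (e (clp T t)))" if "set bs \<subseteq> Basis" "length bs < 4" "b \<in> Basis" for bs t b
    by (rule C0l_b_has_pd[OF e that(1,2) clp_in[OF T] that(3)])
  have fb: "bcont Cf (\<lambda>t x. VD bs (\<lambda>xy. f (clp T t) (fst xy) (snd xy)) x)" if "set bs \<subseteq> Basis" "length bs \<le> 2" for bs
    by (rule bcont_clp[OF T C0l_b_continuous[OF f that], of Cf]) (use Cf that in auto)
  have fd: "has_pd (VD bs (\<lambda>xy. f (clp T t) (fst xy) (snd xy))) b (VD (b # bs) (\<lambda>xy. f (clp T t) (fst xy) (snd xy)))"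
    if "set bs \<subseteq> Basis" "length bs < 2" "b \<in> Basis" for bs t b
    by (rule C0l_b_has_pd[OF f that(1,2) clp_in[OF T] that(3)])
  have cE: "coef C (\<lambda>t x u. e (clp T t) x) (\<lambda>t x u a w. VD [a] (e (clp T t)) x)"
    using coef_data[OF eb[of "[]"] eb ed[of "[]"]] by (simp add: VD_Nil)
  define K1 where "K1 = max C (DIM('a) * (R + 1) + 4)"
  have cY: "coef (2 * K1) (\<lambda>t x u. e (clp T t) x + Tr R u) (\<lambda>t x u a w. VD [a] (e (clp T t)) x + dTr R u w)"
    by (rule coef_add[OF coef_mono[OF cE] coef_mono[OF coef_Tr[OF R]]]) (auto simp: K1_def)
  have cA: "coef (2 * K1) (burgers_drift R T e) (burgers_drift' R T e)"
    using coef_minus[OF cY] unfolding burgers_drift_def[abs_def] burgers_drift'_def[abs_def] .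
  obtain K2 where cF: "coef K2 (\<lambda>t x u. f (clp T t) x (e (clp T t) x + Tr R u))
     (\<lambda>t x u a w. lin (a, VD [a] (e (clp T t)) x + dTr R u w) (\<lambda>b. VD [b] (\<lambda>xy. f (clp T t) (fst xy) (snd xy)) (x, e (clp T t) x + Tr R u)))"
    using coef_compose[OF cY fb[of "[]"] fb fb fd[of "[]"] fd] by (auto simp: VD_Nil)
  have cL: "coef (\<bar>\<nu>\<bar> * (DIM('a) * C)) (\<lambda>t x u. \<nu> *\<^sub>R lap (e (clp T t)) x) (\<lambda>t x u a w. \<nu> *\<^sub>R (\<Sum>b\<in>Basis. VD [a, b, b] (e (clp T t)) x))"
  proof (rule coef_data)
    have *: "bcont (\<bar>\<nu>\<bar> * (DIM('a) * C)) (\<lambda>t x. \<nu> *\<^sub>R (\<Sum>b\<in>Basis. q b t x))" if q: "\<And>b. b \<in> Basis \<Longrightarrow> bcont C (q b)" for q :: "'a \<Rightarrow> real \<Rightarrow> 'a \<Rightarrow> 'a"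
      unfolding bcont_def
    proof (intro conjI allI)
      show "continuous_on UNIV (\<lambda>(t, x). \<nu> *\<^sub>R (\<Sum>b\<in>Basis. q b t x))"
        unfolding case_prod_beta' by (intro continuous_intros bcont_continuous[OF q])
      show "norm (\<nu> *\<^sub>R (\<Sum>b\<in>Basis. q b t x)) \<le> \<bar>\<nu>\<bar> * (DIM('a) * C)" for t x
        unfolding norm_scaleR
        by (intro mult_left_mono order_trans[OF norm_sum] order_trans[OF sum_mono[OF bcont_norm[OF q]]]) auto
    qed
    show "bcont (\<bar>\<nu>\<bar> * (DIM('a) * C)) (\<lambda>t x. \<nu> *\<^sub>R lap (e (clp T t)) x)"
      unfolding lap_VD by (intro * eb) auto
    show "bcont (\<bar>\<nu>\<bar> * (DIM('a) * C)) (\<lambda>t x. \<nu> *\<^sub>R (\<Sum>b\<in>Basis. VD [a, b, b] (e (clp T t)) x))" if "a \<in> Basis" for a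
      by (intro * eb) (use that in auto)
    show "has_pd (\<lambda>x. \<nu> *\<^sub>R lap (e (clp T t)) x) a (\<lambda>x. \<nu> *\<^sub>R (\<Sum>b\<in>Basis. VD [a, b, b] (e (clp T t)) x))" if a: "a \<in> Basis" for a t
      unfolding has_pd_def lap_VD
    proof
      fix x
      have "((\<lambda>r. VD [b, b] (e (clp T t)) (x + r *\<^sub>R a)) has_vector_derivative VD [a, b, b] (e (clp T t)) x) (at 0)" if "b \<in> Basis" for b
        using ed[of "[b, b]" a t] that a by (simp add: has_pd_def)
      from bounded_linear.has_vector_derivative[OF bounded_linear_scaleR_right has_vector_derivative_sum[OF this]]
      show "((\<lambda>r. \<nu> *\<^sub>R (\<Sum>b\<in>Basis. VD [b, b] (e (clp T t)) (x + r *\<^sub>R a))) has_vector_derivative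
          \<nu> *\<^sub>R (\<Sum>b\<in>Basis. VD [a, b, b] (e (clp T t)) x)) (at 0)" .
    qed
  qed
  have cV: "coef (2 * (DIM('a) * (2 * K1) * C)) (\<lambda>t x u. lin (e (clp T t) x + Tr R u) (\<lambda>b. VD [b] (e (clp T t)) x))
     (\<lambda>t x u a w. lin (VD [a] (e (clp T t)) x + dTr R u w) (\<lambda>b. VD [b] (e (clp T t)) x)
       + lin (e (clp T t) x + Tr R u) (\<lambda>b. VD [a, b] (e (clp T t)) x))"
    by (rule coef_lin[OF cY, where q="\<lambda>b t x. VD [b] (e (clp T t)) x" and dq="\<lambda>b a t x. VD [a, b] (e (clp T t)) x"])
       (auto intro!: eb ed)
  define K3 where "K3 = max (max K2 (\<bar>\<nu>\<bar> * (DIM('a) * C))) (2 * (DIM('a) * (2 * K1) * C))"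
  have K3: "coef K3 A A'" if "coef K2 A A' \<or> coef (\<bar>\<nu>\<bar> * (DIM('a) * C)) A A' \<or> coef (2 * (DIM('a) * (2 * K1) * C)) A A'" for A A'
    using that by (elim disjE) (erule coef_mono, simp add: K3_def)+
  have K30: "K3 \<ge> 0" using coefD(6)[OF K3[OF disjI1[OF cF]]] .
  have cH: "coef (2 * (2 * K3)) (burgers_source R T \<nu> f e) (burgers_source' R T \<nu> f e)"
    unfolding burgers_source_def[abs_def] burgers_source'_def[abs_def] diff_conv_add_uminus
    by (rule coef_add[OF coef_add[OF K3[OF disjI1[OF cF]] K3[OF disjI2[OF disjI1[OF cL]]]]
          coef_mono[OF coef_minus[OF K3[OF disjI2[OF disjI2[OF cV]]]]]]) (use K30 in simp)
  show ?thesis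
    by (rule exI[of _ "max (2 * K1) (2 * (2 * K3))"]) (auto intro!: coef_mono[OF cA] coef_mono[OF cH])
qed

lemma burgers_semilinear:
  fixes f :: "real \<Rightarrow> 'a::euclidean_space \<Rightarrow> 'a \<Rightarrow> 'a"
  assumes T: "T > 0" and nu: "\<nu> > 0" and R: "R \<ge> 0" and f: "C0l_b 2 T (\<lambda>t xy. f t (fst xy) (snd xy))" and e: "C0l_b 4 T e"
    and h: "Cl_b 2 h"
  shows "\<exists>K. semilinear T (sqrt (2 * \<nu>)) K (burgers_drift R T e) (burgers_source R T \<nu> f e) (burgers_drift' R T e) (burgers_source' R T \<nu> f e) h (\<lambda>b. VD [b] h) (\<lambda>b a. VD [a, b] h)"
proof -
  have T0: "T \<ge> 0" using T by simp
  have h0: "C0l_b 2 T (\<lambda>_. h)" by (rule C0l_b_of_Cl_b[OF h])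
  obtain K1 where K1: "coef K1 (burgers_drift R T e) (burgers_drift' R T e)" "coef K1 (burgers_source R T \<nu> f e) (burgers_source' R T \<nu> f e)"
    using burgers_coefs[OF T0 R f e] by blast
  obtain C where C: "\<forall>bs. set bs \<subseteq> Basis \<and> length bs \<le> 2 \<longrightarrow> (\<forall>t\<in>{0..T}. \<forall>x. norm (VD bs h x) \<le> C)"
    using C0l_b_bound[OF h0] by (elim exE)
  have hb: "bcont C (\<lambda>_. VD bs h)" if "set bs \<subseteq> Basis" "length bs \<le> 2" for bs
    by (rule bcont_clp[OF T0 C0l_b_continuous[OF h0 that], of C]) (use C that in auto)
  have hd: "has_pd (VD bs h) b (VD (b # bs) h)" if "set bs \<subseteq> Basis" "length bs < 2" "b \<in> Basis" for bs b
    using C0l_b_has_pd[OF h0 that(1,2) _ that(3), of 0] T0 by simp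
  show ?thesis
  proof (rule exI[of _ "max K1 C"], rule semilinear.intro)
    show "coef (max K1 C) (burgers_drift R T e) (burgers_drift' R T e)" "coef (max K1 C) (burgers_source R T \<nu> f e) (burgers_source' R T \<nu> f e)"
      by (auto intro: coef_mono[OF K1(1)] coef_mono[OF K1(2)])
    show "bcont (max K1 C) (\<lambda>_. h)" using bcont_mono[OF hb[of "[]"], of "max K1 C"] by (simp add: VD_Nil)
    show "bcont (max K1 C) (\<lambda>_. VD [b] h)" if "b \<in> Basis" for b
      using bcont_mono[OF hb[of "[b]"], of "max K1 C"] that by simp
    show "bcont (max K1 C) (\<lambda>_. VD [a, b] h)" if "b \<in> Basis" "a \<in> Basis" for a b
      using bcont_mono[OF hb[of "[a, b]"], of "max K1 C"] that by simp
    show "has_pd h b (VD [b] h)" if "b \<in> Basis" for b using hd[of "[]" b] that by (simp add: VD_Nil)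
    show "has_pd (VD [b] h) a (VD [a, b] h)" if "b \<in> Basis" "a \<in> Basis" for a b using hd[of "[b]" a] that by simp
  qed (use T nu in auto)
qed

section \<open>The backward Burgers system along a fixed path\<close>

lemma continuous_on_strip:
  assumes v: "continuous_on ({0..T} \<times> UNIV) (\<lambda>(t, x). v t x)" and g: "continuous_on S g" "continuous_on S k"
    and S: "\<And>s. s \<in> S \<Longrightarrow> g s \<in> {0..T}"
  shows "continuous_on S (\<lambda>s. v (g s) (k s))"
proof -
  have "continuous_on S (\<lambda>s. (g s, k s))" by (intro continuous_on_Pair g)
  moreover have "(\<lambda>s. (g s, k s)) ` S \<subseteq> {0..T} \<times> UNIV" using S by auto
  ultimately show ?thesis using continuous_on_compose2[OF v, of S "\<lambda>s. (g s, k s)"] by simp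
qed

lemma lin_minus: "lin (- a) p = - lin a p"
  by (simp add: lin_def sum_negf)

lemma lin_diff_left: "lin (a - b) p = lin a p - lin b p"
  by (simp add: lin_def inner_diff_left scaleR_diff_left sum_subtractf)

lemma lin_diff_right: "lin a (\<lambda>b. p b - q b) = lin a p - lin a q"
  by (simp add: lin_def scaleR_diff_right sum_subtractf)

definition bw_rhs where
  "bw_rhs T \<nu> f e y s x = \<nu> *\<^sub>R lap (y s) x - adv (e (T - s) x + y s x) (y s) x + Fterm f \<nu> e (T - s) x (y s x)"

text \<open>In this class the integrand is continuous in s, so the integral equation can be
  differentiated; this is what makes the maximum principle applicable to an arbitrary
  solution.\<close>

lemma bw_derivative:
  fixes f :: "real \<Rightarrow> 'a::euclidean_space \<Rightarrow> 'a \<Rightarrow> 'a"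
  assumes f: "C0l_b 2 T (\<lambda>t xy. f t (fst xy) (snd xy))" and e: "C0l_b 4 T e" and y: "C0l_b 2 T y"
    and s: "solves_bw T \<nu> f e h y" and t: "t \<in> {0..T}"
  shows "((\<lambda>s. y s x) has_vector_derivative - bw_rhs T \<nu> f e y t x) (at t within {0..T})"
proof -
  have c1: "continuous_on {0..T} (\<lambda>s. VD bs (y s) x)" if "set bs \<subseteq> Basis" "length bs \<le> 2" for bs
    by (rule continuous_on_strip[OF C0l_b_continuous[OF y that]]) (auto intro: continuous_intros)
  have c2: "continuous_on {0..T} (\<lambda>s. VD bs (e (T - s)) x)" if "set bs \<subseteq> Basis" "length bs \<le> 4" for bs
    by (rule continuous_on_strip[OF C0l_b_continuous[OF e that], of "{0..T}" "\<lambda>s. T - s"]) (auto intro: continuous_intros)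
  have c3: "continuous_on {0..T} (\<lambda>s. y s x)" using c1[of "[]"] by (simp add: VD_Nil)
  have c4: "continuous_on {0..T} (\<lambda>s. e (T - s) x)" using c2[of "[]"] by (simp add: VD_Nil)
  have c5: "continuous_on {0..T} (\<lambda>s. f (T - s) x (y s x + e (T - s) x))"
  proof -
    have "continuous_on ({0..T} \<times> UNIV) (\<lambda>(t, xy). f t (fst xy) (snd xy))"
      using C0l_b_continuous[OF f, of "[]"] by (simp add: VD_Nil)
    moreover have "continuous_on {0..T} (\<lambda>s. T - s)" by (intro continuous_intros)
    moreover have "continuous_on {0..T} (\<lambda>s. (x, y s x + e (T - s) x))" by (intro continuous_intros c3 c4)
    ultimately have "continuous_on {0..T} (\<lambda>s. f (T - s) (fst (x, y s x + e (T - s) x)) (snd (x, y s x + e (T - s) x)))"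
      by (rule continuous_on_strip) auto
    then show ?thesis by simp
  qed
  have "continuous_on {0..T} (\<lambda>s. bw_rhs T \<nu> f e y s x)"
    unfolding bw_rhs_def Fterm_def lap_VD adv_VD lin_def
    by (intro continuous_on_add continuous_on_diff continuous_on_scaleR continuous_on_sum continuous_on_const
        continuous_on_inner c1 c2 c3 c4 c5) auto
  from integral_has_vector_derivative'[OF this t]
  have "((\<lambda>t. h x + integral {t..T} (\<lambda>s. bw_rhs T \<nu> f e y s x)) has_vector_derivative (0 + - bw_rhs T \<nu> f e y t x)) (at t within {0..T})"
    by (intro has_vector_derivative_add has_vector_derivative_const)
  moreover have "y t x = h x + integral {t..T} (\<lambda>s. bw_rhs T \<nu> f e y s x)" if "t \<in> {0..T}" for t
    using s that unfolding solves_bw_def bw_rhs_def by blast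
  ultimately show ?thesis
    using t by (auto intro: has_vector_derivative_transform[of t "{0..T}" "\<lambda>t. y t x"])
qed

lemma reverse_time:
  fixes v :: "real \<Rightarrow> 'b::real_normed_vector"
  assumes "\<And>s. s \<in> {0..T} \<Longrightarrow> (v has_vector_derivative g s) (at s within {0..T})" and t: "t \<in> {0..T}"
  shows "((\<lambda>s. v (T - s)) has_vector_derivative - g (T - t)) (at t within {0..T})"
proof -
  have 1: "((\<lambda>s. T - s) has_vector_derivative - 1) (at t within {0..T})"
    by (auto intro!: derivative_eq_intros)
  have "(\<lambda>s. T - s) ` {0..T} \<subseteq> {0..T}" by auto
  then have 2: "(v has_vector_derivative g (T - t)) (at (T - t) within (\<lambda>s. T - s) ` {0..T})"
    using assms(1)[of "T - t"] t by (auto intro: has_vector_derivative_within_subset)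
  from vector_diff_chain_within[OF 1 2] show ?thesis by (simp add: o_def)
qed

text \<open>In reversed time the difference w of two solutions is transported by \<eta> + z, and the
  remaining terms are at most linear in w, with the gradients of y and \<eta> and the Lipschitz
  constant of f as factors. With zero initial value and k = 0 the maximum principle forces w =
  0.\<close>

theorem burgers_unique:
  fixes f :: "real \<Rightarrow> 'a::euclidean_space \<Rightarrow> 'a \<Rightarrow> 'a"
  assumes nu: "\<nu> \<ge> 0" and f: "C0l_b 2 T (\<lambda>t xy. f t (fst xy) (snd xy))"
    and lip: "\<forall>t\<in>{0..T}. \<forall>x y y'. norm (f t x y - f t x y') \<le> L * norm (y - y')"
    and e: "C0l_b 4 T e" and y: "C0l_b 2 T y" "solves_bw T \<nu> f e h y" and z: "C0l_b 2 T z" "solves_bw T \<nu> f e h z"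
    and t: "t \<in> {0..T}"
  shows "z t x = y t x"
proof -
  obtain Ce where Ce: "\<forall>bs. set bs \<subseteq> Basis \<and> length bs \<le> 4 \<longrightarrow> (\<forall>t\<in>{0..T}. \<forall>x. norm (VD bs (e t) x) \<le> Ce)"
    using C0l_b_bound[OF e] by (elim exE)
  obtain Cy where Cy: "\<forall>bs. set bs \<subseteq> Basis \<and> length bs \<le> 2 \<longrightarrow> (\<forall>t\<in>{0..T}. \<forall>x. norm (VD bs (y t) x) \<le> Cy)"
    using C0l_b_bound[OF y(1)] by (elim exE)
  obtain Cz where Cz: "\<forall>bs. set bs \<subseteq> Basis \<and> length bs \<le> 2 \<longrightarrow> (\<forall>t\<in>{0..T}. \<forall>x. norm (VD bs (z t) x) \<le> Cz)"
    using C0l_b_bound[OF z(1)] by (elim exE)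
  have Ce0: "norm (e t x) \<le> Ce" if "t \<in> {0..T}" for t x using Ce[rule_format, of "[]" t x] that by (simp add: VD_Nil)
  have Cy0: "norm (y t x) \<le> Cy" if "t \<in> {0..T}" for t x using Cy[rule_format, of "[]" t x] that by (simp add: VD_Nil)
  have Cz0: "norm (z t x) \<le> Cz" if "t \<in> {0..T}" for t x using Cz[rule_format, of "[]" t x] that by (simp add: VD_Nil)
  have rt: "T - s \<in> {0..T}" if "s \<in> {0..T}" for s using that by auto
  define w where "w s x = z (T - s) x - y (T - s) x" for s x
  define p where "p b s x = VD [b] (z (T - s)) x - VD [b] (y (T - s)) x" for b s x
  define P where "P b s x = VD [b, b] (z (T - s)) x - VD [b, b] (y (T - s)) x" for b s x
  define a where "a s x = e s x + z (T - s) x" for s x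
  \<comment> \<open>The splitting (\<eta>+z, \<nabla>)z - (\<eta>+y, \<nabla>)y = (\<eta>+z,
    \<nabla>)w + (w, \<nabla>)y leaves the second term here; the other two are the differences of f
    and of the term with \<nabla>\<eta>.\<close>
  define R where "R s x = f s x (z (T - s) x + e s x) - f s x (y (T - s) x + e s x)
     - lin (w s x) (\<lambda>b. VD [b] (y (T - s)) x) - lin (w s x) (\<lambda>b. VD [b] (e s) x)" for s x
  define D where "D s x = bw_rhs T \<nu> f e z (T - s) x - bw_rhs T \<nu> f e y (T - s) x" for s x
  define \<beta> where "\<beta> = \<bar>L\<bar> + DIM('a) * \<bar>Cy\<bar> + DIM('a) * \<bar>Ce\<bar>"
  have "(norm (w (T - t) x))\<^sup>2 \<le> (0 + 0 * (T - t)) * exp (2 * \<beta> * (T - t))"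
  proof (rule maximum_principle[where w=w and ?t1.0="T - t" and ?x1.0=x and c="2 * \<beta>" and k=0 and m=0 and C="Cz + Cy" and p=p and P=P and a=a and R=R and D=D and T=T and \<nu>=\<nu> and ?A0.0="Ce + Cz"])
    show "0 \<le> \<nu>" by (rule nu)
    show "0 \<le> 2 * \<beta>" by (simp add: \<beta>_def)
    show "continuous_on ({0..T} \<times> UNIV) (\<lambda>(t, x). w t x)"
    proof -
      have 1: "continuous_on ({0..T} \<times> UNIV) (\<lambda>(t, x). z t x)" using C0l_b_continuous[OF z(1), of "[]"] by (simp add: VD_Nil)
      have 2: "continuous_on ({0..T} \<times> UNIV) (\<lambda>(t, x). y t x)" using C0l_b_continuous[OF y(1), of "[]"] by (simp add: VD_Nil)
      show ?thesis unfolding w_def case_prod_beta'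
        by (intro continuous_on_diff continuous_on_strip[OF 1] continuous_on_strip[OF 2] continuous_intros) auto
    qed
    fix s x assume s: "s \<in> {0..T}"
    note s' = rt[OF s]
    show "norm (w s x) \<le> Cz + Cy"
      unfolding w_def using norm_triangle_ineq4[of "z (T - s) x" "y (T - s) x"] Cz0[OF s', of x] Cy0[OF s', of x] by linarith
    show "norm (a s x) \<le> Ce + Cz"
      unfolding a_def by (rule norm_triangle_mono[OF Ce0[OF s] Cz0[OF s']])
    show "has_pd (w s) b (p b s)" if "b \<in> Basis" for b
      using C0l_b_has_pd[OF z(1) _ _ s' that, of "[]"] C0l_b_has_pd[OF y(1) _ _ s' that, of "[]"]
      unfolding has_pd_def w_def p_def by (auto simp: VD_Nil intro!: has_vector_derivative_diff)
    show "has_pd (p b s) b (P b s)" if "b \<in> Basis" for b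
      using C0l_b_has_pd[OF z(1) _ _ s' that, of "[b]"] C0l_b_has_pd[OF y(1) _ _ s' that, of "[b]"] that
      unfolding has_pd_def p_def P_def by (auto intro!: has_vector_derivative_diff)
    show "((\<lambda>s. w s x) has_vector_derivative D s x) (at s within {0..T})"
      using has_vector_derivative_diff[OF reverse_time[OF bw_derivative[OF f e z] s, of x] reverse_time[OF bw_derivative[OF f e y] s, of x]]
      unfolding w_def D_def by simp
    show "D s x = \<nu> *\<^sub>R (\<Sum>b\<in>Basis. P b s x) - lin (a s x) (\<lambda>b. p b s x) + R s x"
    proof -
      have 1: "lin (a s x) (\<lambda>b. p b s x) = lin (a s x) (\<lambda>b. VD [b] (z (T - s)) x) - lin (a s x) (\<lambda>b. VD [b] (y (T - s)) x)"
        unfolding p_def by (rule lin_diff_right)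
      have "lin (e s x + z (T - s) x - (e s x + y (T - s) x)) (\<lambda>b. VD [b] (y (T - s)) x)
         = lin (e s x + z (T - s) x) (\<lambda>b. VD [b] (y (T - s)) x) - lin (e s x + y (T - s) x) (\<lambda>b. VD [b] (y (T - s)) x)"
        by (rule lin_diff_left)
      then have 2: "lin (w s x) (\<lambda>b. VD [b] (y (T - s)) x) = lin (a s x) (\<lambda>b. VD [b] (y (T - s)) x) - lin (e s x + y (T - s) x) (\<lambda>b. VD [b] (y (T - s)) x)"
        by (simp add: w_def a_def)
      have "lin (z (T - s) x + e s x - (y (T - s) x + e s x)) (\<lambda>b. VD [b] (e s) x)
         = lin (z (T - s) x + e s x) (\<lambda>b. VD [b] (e s) x) - lin (y (T - s) x + e s x) (\<lambda>b. VD [b] (e s) x)"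
        by (rule lin_diff_left)
      then have 3: "lin (w s x) (\<lambda>b. VD [b] (e s) x) = lin (z (T - s) x + e s x) (\<lambda>b. VD [b] (e s) x) - lin (y (T - s) x + e s x) (\<lambda>b. VD [b] (e s) x)"
        by (simp add: w_def)
      have 4: "\<nu> *\<^sub>R (\<Sum>b\<in>Basis. P b s x) = \<nu> *\<^sub>R (\<Sum>b\<in>Basis. VD [b, b] (z (T - s)) x) - \<nu> *\<^sub>R (\<Sum>b\<in>Basis. VD [b, b] (y (T - s)) x)"
        by (simp add: P_def sum_subtractf scaleR_diff_right)
      show ?thesis
        unfolding D_def bw_rhs_def Fterm_def R_def lap_VD adv_VD 1 2 3 4 by (simp add: a_def)
    qed
    show "2 * (w s x \<bullet> R s x) \<le> 2 * \<beta> * (norm (w s x))\<^sup>2 + 0"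
    proof -
      have w: "norm (w s x) \<le> norm (w s x)" ..
      have f1: "norm (f s x (z (T - s) x + e s x) - f s x (y (T - s) x + e s x)) \<le> \<bar>L\<bar> * norm (w s x)"
      proof -
        have "norm (f s x (z (T - s) x + e s x) - f s x (y (T - s) x + e s x)) \<le> L * norm (w s x)"
          using lip s unfolding w_def by (metis add_diff_cancel_right)
        also have "\<dots> \<le> \<bar>L\<bar> * norm (w s x)" by (intro mult_right_mono) auto
        finally show ?thesis .
      qed
      have f2: "norm (lin (w s x) (\<lambda>b. VD [b] (y (T - s)) x)) \<le> DIM('a) * norm (w s x) * \<bar>Cy\<bar>"
        by (rule lin_bound[OF w]) (use Cy s' in \<open>auto intro: order_trans[OF _ abs_ge_self]\<close>)
      have f3: "norm (lin (w s x) (\<lambda>b. VD [b] (e s) x)) \<le> DIM('a) * norm (w s x) * \<bar>Ce\<bar>"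
        by (rule lin_bound[OF w]) (use Ce s in \<open>auto intro: order_trans[OF _ abs_ge_self]\<close>)
      have "norm (R s x) \<le> \<bar>L\<bar> * norm (w s x) + DIM('a) * norm (w s x) * \<bar>Cy\<bar> + DIM('a) * norm (w s x) * \<bar>Ce\<bar>"
        unfolding R_def by (intro order_trans[OF norm_triangle_ineq4] add_mono f1 f2 f3)
      also have "\<dots> = \<beta> * norm (w s x)" by (simp add: \<beta>_def algebra_simps)
      finally have "norm (w s x) * norm (R s x) \<le> norm (w s x) * (\<beta> * norm (w s x))" by (intro mult_left_mono) auto
      then show ?thesis using norm_cauchy_schwarz[of "w s x" "R s x"] by (simp add: power2_eq_square mult_ac)
    qed
  next
    fix x
    show "(norm (w 0 x))\<^sup>2 \<le> 0"
    proof -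
      have "T \<in> {0..T}" using t by auto
      then have "y T x = h x" "z T x = h x" using y(2) z(2) unfolding solves_bw_def by auto
      then show ?thesis by (simp add: w_def)
    qed
  qed (use t in auto)
  then show ?thesis by (simp add: w_def)
qed

text \<open>The locale constant \<open>K\<close> is not among the arguments, so the iterates are one
  expression in the data although each \<omega> may come with its own \<open>K\<close>. This is what
  allows them to be treated as functions of \<omega>.\<close>

definition burgers_it where
  "burgers_it R T \<nu> f e h n = semilinear.U T (sqrt (2 * \<nu>)) (burgers_drift R T e) (burgers_source R T \<nu> f e) (burgers_drift' R T e) (burgers_source' R T \<nu> f e) h (\<lambda>b. VD [b] h) (\<lambda>b a. VD [a, b] h) n"

definition burgers_it1 where
  "burgers_it1 R T \<nu> f e h n = semilinear.p1 T (sqrt (2 * \<nu>)) (burgers_drift R T e) (burgers_source R T \<nu> f e) (burgers_drift' R T e) (burgers_source' R T \<nu> f e) h (\<lambda>b. VD [b] h) (\<lambda>b a. VD [a, b] h) n"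

text \<open>The problem truncated at level R is solved first. Since \<open>Tr\<close> does not
  increase norms, the bound from the maximum principle is free of R; the condition \<open>RR\<close>
  says that at time T it is at most R^2. The solution then stays where the truncation is the
  identity.\<close>

theorem burgers_exists:
  fixes f :: "real \<Rightarrow> 'a::euclidean_space \<Rightarrow> 'a \<Rightarrow> 'a" and Ke :: real
  assumes T: "T > 0" and nu: "\<nu> > 0" and R: "R \<ge> 0" and f: "C0l_b 2 T (\<lambda>t xy. f t (fst xy) (snd xy))"
    and e: "C0l_b 4 T e" and h: "Cl_b 2 h"
    and Kf: "\<And>t x y. t \<in> {0..T} \<Longrightarrow> norm (f t x y) \<le> Kf"
    and Ke: "\<And>t x. t \<in> {0..T} \<Longrightarrow> norm (e t x) \<le> Ke" "\<And>t x b. t \<in> {0..T} \<Longrightarrow> b \<in> Basis \<Longrightarrow> norm (VD [b] (e t) x) \<le> Ke"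
    and Kl: "\<And>t x. t \<in> {0..T} \<Longrightarrow> norm (lap (e t) x) \<le> Kl"
    and Kh: "\<And>x. norm (h x) \<le> Kh"
    and RR: "(Kh\<^sup>2 + (Kf + \<nu> * Kl + DIM('a) * Ke * Ke)\<^sup>2 * T) * exp ((1 + 2 * (DIM('a) * Ke)) * T) \<le> R\<^sup>2"
  shows "\<exists>u. (\<forall>t x. (\<lambda>n. burgers_it R T \<nu> f e h n t x) \<longlonglongrightarrow> u t x) \<and>
     C12_b T (\<lambda>t x. u (T - t) x) \<and> solves_bw T \<nu> f e h (\<lambda>t x. u (T - t) x)"
proof -
  obtain K where "semilinear T (sqrt (2 * \<nu>)) K (burgers_drift R T e) (burgers_source R T \<nu> f e) (burgers_drift' R T e) (burgers_source' R T \<nu> f e) h (\<lambda>b. VD [b] h) (\<lambda>b a. VD [a, b] h)"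
    using burgers_semilinear[OF T nu R f e h] by (elim exE)
  then interpret S: semilinear T "sqrt (2 * \<nu>)" K "burgers_drift R T e" "burgers_source R T \<nu> f e" "burgers_drift' R T e" "burgers_source' R T \<nu> f e" h "\<lambda>b. VD [b] h" "\<lambda>b a. VD [a, b] h" .
  obtain u p P C where g: "S.good C u p P" and lim: "\<forall>t x. (\<lambda>n. S.U n t x) \<longlonglongrightarrow> u t x"
    and int: "\<forall>t\<in>{0..T}. \<forall>x. ((\<lambda>s. ((sqrt (2 * \<nu>))\<^sup>2 / 2) *\<^sub>R (\<Sum>b\<in>Basis. P b b s x) + S.Gf s x (u s x) (\<lambda>b. p b s x))
        has_integral (u t x - h x)) {0..t}"
    using S.solution_exists by (elim exE conjE)
  define gg where "gg s x = \<nu> *\<^sub>R (\<Sum>b\<in>Basis. P b b s x) + S.Gs u p s x" for s x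
  have int': "((\<lambda>s. gg s x) has_integral (u t x - h x)) {0..t}" if "t \<in> {0..T}" for t x
    using int[rule_format, OF that, of x] nu by (simp add: gg_def[abs_def] S.Gs_def)
  note gD = S.goodD[OF g]
  have cgg: "continuous_on S (\<lambda>q. gg (k q) (l q))" if "continuous_on S k" "continuous_on S l"
    for S :: "'c::topological_space set" and k l
    unfolding gg_def
    by (intro continuous_on_add continuous_on_scaleR continuous_on_const continuous_on_sum
        bcont_continuous[OF gD(3)] bcont_continuous[OF S.bcont_Gs[OF g]] that)
  obtain Cg where Cg: "norm (gg s x) \<le> Cg" for s x
  proof
    fix s x
    show "norm (gg s x) \<le> \<bar>\<nu>\<bar> * (DIM('a) * C) + (DIM('a) * K * C + K)"
      unfolding gg_def
    proof (rule norm_triangle_mono)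
      show "norm (\<nu> *\<^sub>R (\<Sum>b\<in>Basis. P b b s x)) \<le> \<bar>\<nu>\<bar> * (DIM('a) * C)"
        unfolding norm_scaleR
        by (intro mult_left_mono order_trans[OF norm_sum] order_trans[OF sum_mono[OF bcont_norm[OF gD(3)]]]) auto
      show "norm (S.Gs u p s x) \<le> DIM('a) * K * C + K" by (rule bcont_norm[OF S.bcont_Gs[OF g]])
    qed
  qed
  have u0: "u 0 x = h x" for x
  proof -
    have "integral {0..0} (\<lambda>s. gg s x) = u 0 x - h x"
      using T by (intro integral_unique int') simp
    moreover have "integral {0..0} (\<lambda>s. gg s x) = 0"
      unfolding box_real(2)[symmetric] by (rule integral_refl)
    ultimately show ?thesis by (metis eq_iff_diff_eq_0)
  qed
  have du: "((\<lambda>s. u s x) has_vector_derivative gg t x) (at t within {0..T})" if t: "t \<in> {0..T}" for t x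
  proof -
    have "continuous_on {0..T} (\<lambda>s. gg s x)" by (intro cgg continuous_intros)
    from integral_has_vector_derivative[OF this t]
    have "((\<lambda>t. h x + integral {0..t} (\<lambda>s. gg s x)) has_vector_derivative (0 + gg t x)) (at t within {0..T})"
      by (intro has_vector_derivative_add has_vector_derivative_const)
    moreover have "u t x = h x + integral {0..t} (\<lambda>s. gg s x)" if "t \<in> {0..T}" for t
      using integral_unique[OF int'[OF that, of x]] by simp
    ultimately show ?thesis
      using t by (auto intro: has_vector_derivative_transform[of t "{0..T}" "\<lambda>t. u t x"])
  qed
  have "norm (e 0 0) \<le> Ke" using T by (intro Ke(1)) simp
  from order_trans[OF norm_ge_zero this] have Ke0: "Ke \<ge> 0" .
  \<comment> \<open>The part of the source bound that is free of u. The source is at most \<alpha> +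
    DIM Ke |u|, and 2 |u| \<alpha> <= |u|^2 + \<alpha>^2 yields the rate 1 + 2 DIM Ke and the
    constant \<alpha>^2.\<close>
  define \<alpha> where "\<alpha> = Kf + \<nu> * Kl + DIM('a) * Ke * Ke"
  have ub: "norm (u t1 x1) \<le> R" if t1: "t1 \<in> {0..T}" for t1 x1
  proof -
    define a where "a s x = e s x + Tr R (u s x)" for s x
    have "(norm (u t1 x1))\<^sup>2 \<le> (Kh\<^sup>2 + \<alpha>\<^sup>2 * t1) * exp ((1 + 2 * (DIM('a) * Ke)) * t1)"
    proof (rule maximum_principle[where w=u and ?t1.0=t1 and ?x1.0=x1 and c="1 + 2 * (DIM('a) * Ke)" and k="\<alpha>\<^sup>2" and m="Kh\<^sup>2" and C=C and p=p and P="\<lambda>b. P b b" and a=a and R="\<lambda>s x. burgers_source R T \<nu> f e s x (u s x)"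
          and D=gg and T=T and \<nu>=\<nu> and ?A0.0="Ke + DIM('a) * (R + 1)"])
      show "continuous_on ({0..T} \<times> UNIV) (\<lambda>(t, x). u t x)"
        using gD(1) unfolding bcont_def by (auto intro: continuous_on_subset)
      fix s x assume s: "s \<in> {0..T}"
      show "norm (u s x) \<le> C" by (rule bcont_norm[OF gD(1)])
      show "norm (a s x) \<le> Ke + DIM('a) * (R + 1)"
        unfolding a_def by (rule norm_triangle_mono[OF Ke(1)[OF s] Tr_bounded[OF R]])
      show "((\<lambda>s. u s x) has_vector_derivative gg s x) (at s within {0..T})" by (rule du[OF s])
      show "gg s x = \<nu> *\<^sub>R (\<Sum>b\<in>Basis. P b b s x) - lin (a s x) (\<lambda>b. p b s x) + burgers_source R T \<nu> f e s x (u s x)"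
        unfolding gg_def S.Gs_def S.Gf_def burgers_drift_def clp_id[OF s] lin_minus a_def by simp
      show "2 * (u s x \<bullet> burgers_source R T \<nu> f e s x (u s x)) \<le> (1 + 2 * (DIM('a) * Ke)) * (norm (u s x))\<^sup>2 + \<alpha>\<^sup>2"
      proof -
        let ?n = "norm (u s x)"
        have "norm (e s x + Tr R (u s x)) \<le> Ke + ?n" by (rule norm_triangle_mono[OF Ke(1)[OF s] Tr_norm[OF R]])
        from lin_bound[OF this Ke(2)[OF s]]
        have 1: "norm (lin (e s x + Tr R (u s x)) (\<lambda>b. VD [b] (e s) x)) \<le> DIM('a) * (Ke + ?n) * Ke" .
        have 2: "norm (\<nu> *\<^sub>R lap (e s) x) \<le> \<nu> * Kl" using nu Kl[OF s, of x] by (simp add: mult_left_mono)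
        have "norm (burgers_source R T \<nu> f e s x (u s x)) \<le> Kf + \<nu> * Kl + DIM('a) * (Ke + ?n) * Ke"
          unfolding burgers_source_def clp_id[OF s]
          by (intro order_trans[OF norm_triangle_ineq4] add_mono norm_triangle_mono Kf[OF s] 1 2)
        also have "\<dots> = \<alpha> + DIM('a) * Ke * ?n" by (simp add: \<alpha>_def algebra_simps)
        finally have "?n * norm (burgers_source R T \<nu> f e s x (u s x)) \<le> ?n * (\<alpha> + DIM('a) * Ke * ?n)" by (rule mult_left_mono) simp
        then have "2 * (u s x \<bullet> burgers_source R T \<nu> f e s x (u s x)) \<le> 2 * ?n * \<alpha> + 2 * (DIM('a) * Ke) * ?n\<^sup>2"
          using norm_cauchy_schwarz[of "u s x" "burgers_source R T \<nu> f e s x (u s x)"] by (simp add: power2_eq_square algebra_simps)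
        moreover have "2 * ?n * \<alpha> \<le> ?n\<^sup>2 + \<alpha>\<^sup>2" by (rule sum_squares_bound)
        ultimately show ?thesis by (simp add: algebra_simps)
      qed
      show "has_pd (u s) b (p b s)" if "b \<in> Basis" for b by (rule gD(4)[OF that])
      show "has_pd (p b s) b (P b b s)" if "b \<in> Basis" for b by (rule gD(5)[OF that that])
    next
      show "(norm (u 0 x))\<^sup>2 \<le> Kh\<^sup>2" for x unfolding u0 by (intro power_mono Kh) simp
    qed (use nu Ke0 t1 in auto)
    also have "\<dots> \<le> (Kh\<^sup>2 + \<alpha>\<^sup>2 * T) * exp ((1 + 2 * (DIM('a) * Ke)) * T)"
    proof (rule mult_mono)
      show "Kh\<^sup>2 + \<alpha>\<^sup>2 * t1 \<le> Kh\<^sup>2 + \<alpha>\<^sup>2 * T" using t1 by (intro add_left_mono mult_left_mono) auto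
      have "(1 + 2 * (DIM('a) * Ke)) * t1 \<le> (1 + 2 * (DIM('a) * Ke)) * T"
        using t1 Ke0 by (intro mult_left_mono) auto
      then show "exp ((1 + 2 * (DIM('a) * Ke)) * t1) \<le> exp ((1 + 2 * (DIM('a) * Ke)) * T)" by simp
    qed (use T in auto)
    also have "\<dots> \<le> R\<^sup>2" using RR by (simp add: \<alpha>_def)
    finally show ?thesis using R by (rule power2_le_imp_le)
  qed
  define y where "y t x = u (T - t) x" for t x
  have rt: "T - s \<in> {0..T}" if "s \<in> {0..T}" for s using that by auto
  have VDy: "VD [b] (y t) = p b (T - t)" "VD [b, b] (y t) = P b b (T - t)" if "b \<in> Basis" for b t
  proof -
    have yt: "y t = u (T - t)" by (rule ext) (simp add: y_def)
    show "VD [b] (y t) = p b (T - t)" "VD [b, b] (y t) = P b b (T - t)"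
      unfolding yt by (rule VD_of_has_pd[OF gD(4)[OF that]], rule VD2_of_has_pd[OF gD(4)[OF that] gD(5)[OF that that]])
  qed
  have rhs: "bw_rhs T \<nu> f e y s x = gg (T - s) x" if s: "s \<in> {0..T}" for s x
  proof -
    have l1: "lin w (\<lambda>b. VD [b] (y s) x) = lin w (\<lambda>b. p b (T - s) x)" for w
      unfolding lin_def by (intro sum.cong refl) (simp add: VDy)
    have l2: "lap (y s) x = (\<Sum>b\<in>Basis. P b b (T - s) x)"
      unfolding lap_VD by (intro sum.cong refl) (simp add: VDy)
    \<comment> \<open>Here the truncation disappears and the truncated equation becomes the original
      one.\<close>
    have Tr: "Tr R (u (T - s) x) = u (T - s) x" by (rule Tr_id[OF ub[OF rt[OF s]]])
    show ?thesis
      unfolding bw_rhs_def Fterm_def gg_def S.Gs_def S.Gf_def burgers_drift_def burgers_source_def clp_id[OF rt[OF s]] Tr lin_minus adv_VD l1 l2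
      by (simp add: y_def add.commute[of "u (T - s) x"])
  qed
  have dy: "((\<lambda>s. y s x) has_vector_derivative - gg (T - t) x) (at t within {0..T})" if "t \<in> {0..T}" for t x
    unfolding y_def by (rule reverse_time[OF du that])
  have "C12_b T y"
    unfolding C12_b_def
  proof (intro conjI exI[of _ "\<lambda>t x. - gg (T - t) x"])
    show "C0l_b 2 T y"
    proof (rule C0l_b_2I[where p="\<lambda>b t x. p b (T - t) x" and P="\<lambda>b a t x. P b a (T - t) x" and C=C])
      show "continuous_on ({0..T} \<times> UNIV) (\<lambda>(t, x). y t x)"
        unfolding y_def case_prod_beta' by (intro bcont_continuous[OF gD(1)] continuous_intros)
      show "continuous_on ({0..T} \<times> UNIV) (\<lambda>(t, x). p b (T - t) x)" if "b \<in> Basis" for b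
        unfolding case_prod_beta' by (intro bcont_continuous[OF gD(2)[OF that]] continuous_intros)
      show "continuous_on ({0..T} \<times> UNIV) (\<lambda>(t, x). P b a (T - t) x)" if "b \<in> Basis" "a \<in> Basis" for b a
        unfolding case_prod_beta' by (intro bcont_continuous[OF gD(3)[OF that]] continuous_intros)
      show "norm (y t x) \<le> C" for t x unfolding y_def by (rule bcont_norm[OF gD(1)])
      show "norm (p b (T - t) x) \<le> C" if "b \<in> Basis" for b t x by (rule bcont_norm[OF gD(2)[OF that]])
      show "norm (P b a (T - t) x) \<le> C" if "b \<in> Basis" "a \<in> Basis" for b a t x by (rule bcont_norm[OF gD(3)[OF that]])
      show "has_pd (y t) b (\<lambda>x. p b (T - t) x)" if "b \<in> Basis" for b t
        unfolding y_def[abs_def] by (rule gD(4)[OF that])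
      show "has_pd (\<lambda>x. p b (T - t) x) a (\<lambda>x. P b a (T - t) x)" if "b \<in> Basis" "a \<in> Basis" for b a t
        by (rule gD(5)[OF that])
    qed
    show "\<forall>t\<in>{0..T}. \<forall>x. ((\<lambda>s. y s x) has_vector_derivative - gg (T - t) x) (at t within {0..T})" using dy by blast
    show "continuous_on ({0..T} \<times> UNIV) (\<lambda>(t, x). - gg (T - t) x)"
      unfolding case_prod_beta' by (intro continuous_on_minus cgg continuous_intros)
    show "bounded ((\<lambda>(t, x). - gg (T - t) x) ` ({0..T} \<times> UNIV))"
      using Cg by (auto simp: bounded_iff intro!: exI[of _ Cg])
  qed
  moreover have "solves_bw T \<nu> f e h y"
    unfolding solves_bw_def
  proof (intro ballI allI)
    fix t x assume t: "t \<in> {0..T}"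
    have "((\<lambda>s. - gg (T - s) x) has_integral (y T x - y t x)) {t..T}"
      using t by (intro fundamental_theorem_of_calculus has_vector_derivative_within_subset[OF dy]) auto
    from has_integral_neg[OF this]
    have "((\<lambda>s. gg (T - s) x) has_integral (y t x - y T x)) {t..T}" by simp
    then have "((\<lambda>s. bw_rhs T \<nu> f e y s x) has_integral (y t x - y T x)) {t..T}"
      by (rule has_integral_eq[rotated]) (use t in \<open>simp add: rhs\<close>)
    from integral_unique[OF this]
    show "y t x = h x + integral {t..T} (\<lambda>s. \<nu> *\<^sub>R lap (y s) x - adv (e (T - s) x + y s x) (y s) x + Fterm f \<nu> e (T - s) x (y s x))"
      unfolding bw_rhs_def by (simp add: y_def u0)
  qed
  moreover have "\<forall>t x. (\<lambda>n. burgers_it R T \<nu> f e h n t x) \<longlonglongrightarrow> u t x"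
    unfolding burgers_it_def using lim by simp
  ultimately show ?thesis unfolding y_def[abs_def] by blast
qed

section \<open>Measurability of the iterates\<close>

text \<open>The parameter is replaced by the first member of a dense sequence within distance
  1/(k+1). The resulting functions use countably many parameter values, hence are jointly
  measurable, and continuity in p gives convergence.\<close>

lemma caratheodory_measurable:
  fixes \<phi> :: "'p::{metric_space,second_countable_topology} \<Rightarrow> 'w \<Rightarrow> 'b::euclidean_space"
  assumes c: "\<And>\<omega>. \<omega> \<in> space N \<Longrightarrow> continuous_on UNIV (\<lambda>p. \<phi> p \<omega>)" and m: "\<And>p. \<phi> p \<in> borel_measurable N"
  shows "(\<lambda>q. \<phi> (fst q) (snd q)) \<in> borel_measurable (borel \<Otimes>\<^sub>M N)"
proof -
  obtain D :: "'p set" where D: "countable D" "\<And>X. open X \<Longrightarrow> X \<noteq> {} \<Longrightarrow> \<exists>d\<in>D. d \<in> X"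
    using countable_dense_exists by blast
  have Dne: "D \<noteq> {}" using D(2)[of UNIV] by auto
  define d where "d = from_nat_into D"
  have dn: "\<exists>n. dist (d n) p < \<epsilon>" if "\<epsilon> > 0" for p \<epsilon>
  proof -
    have "ball p \<epsilon> \<noteq> {}" using that by simp
    from D(2)[OF open_ball this] obtain z where z: "z \<in> D" "z \<in> ball p \<epsilon>" by (elim bexE)
    obtain n where "d n = z" using from_nat_into_surj[OF D(1) z(1)] unfolding d_def by (elim exE)
    then show ?thesis using z(2) by (auto simp: dist_commute)
  qed
  define g where "g k p = (LEAST n. dist (d n) p < 1 / real (Suc k))" for k p
  have g: "dist (d (g k p)) p < 1 / real (Suc k)" for k p
    unfolding g_def by (rule LeastI_ex) (rule dn, simp)
  have gm: "(\<lambda>q. g k (fst q)) \<in> measurable (borel \<Otimes>\<^sub>M N) (count_space UNIV)" for k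
  proof -
    have "g k \<in> measurable borel (count_space UNIV)"
      unfolding g_def by measurable
    then show ?thesis by measurable
  qed
  have "(\<lambda>q. \<phi> (d (g k (fst q))) (snd q)) \<in> borel_measurable (borel \<Otimes>\<^sub>M N)" for k
    by (rule measurable_compose_countable[OF _ gm]) (use m in measurable)
  moreover have "(\<lambda>k. \<phi> (d (g k (fst q))) (snd q)) \<longlonglongrightarrow> \<phi> (fst q) (snd q)" if "q \<in> space (borel \<Otimes>\<^sub>M N)" for q
  proof -
    have "(\<lambda>k. d (g k (fst q))) \<longlonglongrightarrow> fst q"
    proof (rule tendsto_dist_iff[THEN iffD2], rule Lim_null_comparison[OF _ LIMSEQ_inverse_real_of_nat])
      show "\<forall>\<^sub>F k in sequentially. norm (dist (d (g k (fst q))) (fst q)) \<le> inverse (real (Suc k))"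
      proof (rule always_eventually, rule allI)
        show "norm (dist (d (g k (fst q))) (fst q)) \<le> inverse (real (Suc k))" for k
          using less_imp_le[OF g[of k "fst q"]]
          by (simp only: real_norm_def abs_of_nonneg[OF zero_le_dist] inverse_eq_divide)
      qed
    qed
    moreover have "continuous_on UNIV (\<lambda>p. \<phi> p (snd q))" using c that by (auto simp: space_pair_measure)
    ultimately show ?thesis
      by (auto simp: continuous_on_sequentially o_def)
  qed
  ultimately show ?thesis by (rule borel_measurable_LIMSEQ_metric)
qed

lemma integral_caratheodory_measurable:
  fixes \<phi> :: "'p::euclidean_space \<Rightarrow> 'w \<Rightarrow> 'b::euclidean_space"
  assumes P: "prob_space Q" and c: "\<And>\<omega>. \<omega> \<in> space N \<Longrightarrow> continuous_on UNIV (\<lambda>p. \<phi> p \<omega>)"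
    and m: "\<And>p. \<phi> p \<in> borel_measurable N" and k: "k \<in> measurable Q borel" and r: "r \<in> borel_measurable Q"
  shows "(\<lambda>\<omega>. \<integral>\<zeta>. r \<zeta> *\<^sub>R \<phi> (k \<zeta>) \<omega> \<partial>Q) \<in> borel_measurable N"
proof -
  interpret Q: prob_space Q by (rule P)
  note [measurable] = k r
  have "(\<lambda>q. (k (snd q), fst q)) \<in> measurable (N \<Otimes>\<^sub>M Q) (borel \<Otimes>\<^sub>M N)" by measurable
  from measurable_compose[OF this caratheodory_measurable[OF c m]]
  have [measurable]: "(\<lambda>q. \<phi> (k (snd q)) (fst q)) \<in> borel_measurable (N \<Otimes>\<^sub>M Q)" by simp
  have "(\<lambda>q. r (snd q) *\<^sub>R \<phi> (k (snd q)) (fst q)) \<in> borel_measurable (N \<Otimes>\<^sub>M Q)" by measurable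
  then show ?thesis
    by (intro Q.borel_measurable_lebesgue_integral) (simp add: case_prod_beta')
qed

text \<open>The source of adaptedness: the times t(1-\<theta>^2) lie in [0,t], so it is enough that
  \<open>G\<close> be measurable at those times. The field \<open>\<phi>\<close> freezes
  \<open>G\<close> after time t; it is continuous, measurable at every parameter value, and has the
  same integral.\<close>

lemma kint_measurable:
  fixes G :: "real \<Rightarrow> 'a::euclidean_space \<Rightarrow> 'w \<Rightarrow> 'b::euclidean_space"
  assumes t: "t \<ge> 0" and \<rho>: "ker T W \<rho>" and c: "\<And>\<omega>. \<omega> \<in> space N \<Longrightarrow> \<exists>C. bcont C (\<lambda>s y. G s y \<omega>)"
    and m: "\<And>s y. s \<in> {0..t} \<Longrightarrow> (\<lambda>\<omega>. G s y \<omega>) \<in> borel_measurable N"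
  shows "(\<lambda>\<omega>. kint \<rho> \<sigma> (\<lambda>s y. G s y \<omega>) t x) \<in> borel_measurable N"
proof -
  define \<phi> where "\<phi> p \<omega> = G (clp t (fst p)) (snd p) \<omega>" for p \<omega>
  have c\<phi>: "continuous_on UNIV (\<lambda>p. \<phi> p \<omega>)" if w: "\<omega> \<in> space N" for \<omega>
  proof -
    obtain C where C: "bcont C (\<lambda>s y. G s y \<omega>)" using c[OF w] by (elim exE)
    show ?thesis unfolding \<phi>_def clp_def by (intro bcont_continuous[OF C] continuous_intros)
  qed
  have m\<phi>: "\<phi> p \<in> borel_measurable N" for p
    unfolding \<phi>_def[abs_def] by (rule m[OF clp_in[OF t]])
  have k: "(\<lambda>\<zeta>. (t * (1 - (fst \<zeta>)\<^sup>2), x + (\<sigma> * sqrt t * fst \<zeta>) *\<^sub>R snd \<zeta>)) \<in> measurable (ugauss :: (real \<times> 'a) measure) borel"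
    by (intro measurable_ugauss borel_measurable_continuous_onI continuous_intros)
  have r: "(\<lambda>\<zeta>. \<rho> t (fst \<zeta>) (snd \<zeta>)) \<in> borel_measurable ugauss"
    by (intro measurable_ugauss borel_measurable_continuous_onI ker_continuous[OF \<rho>] continuous_intros)
  have "(\<lambda>\<omega>. \<integral>\<zeta>. \<rho> t (fst \<zeta>) (snd \<zeta>) *\<^sub>R \<phi> (t * (1 - (fst \<zeta>)\<^sup>2), x + (\<sigma> * sqrt t * fst \<zeta>) *\<^sub>R snd \<zeta>) \<omega> \<partial>ugauss) \<in> borel_measurable N"
    by (rule integral_caratheodory_measurable[OF prob_space_ugauss c\<phi> m\<phi> k r])
  moreover have "(\<integral>\<zeta>. \<rho> t (fst \<zeta>) (snd \<zeta>) *\<^sub>R \<phi> (t * (1 - (fst \<zeta>)\<^sup>2), x + (\<sigma> * sqrt t * fst \<zeta>) *\<^sub>R snd \<zeta>) \<omega> \<partial>ugauss)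
      = kint \<rho> \<sigma> (\<lambda>s y. G s y \<omega>) t x" for \<omega>
    unfolding kint_def
  proof (rule Bochner_Integration.integral_cong[OF refl])
    fix \<zeta> :: "real \<times> 'a" assume "\<zeta> \<in> space ugauss"
    then have th: "fst \<zeta> \<in> {0..1}" by auto
    then have "(fst \<zeta>)\<^sup>2 \<le> 1" by (auto intro!: power_le_one)
    then have "t * (1 - (fst \<zeta>)\<^sup>2) \<in> {0..t}"
      using t by (auto intro!: mult_nonneg_nonneg mult_left_le)
    then show "\<rho> t (fst \<zeta>) (snd \<zeta>) *\<^sub>R \<phi> (t * (1 - (fst \<zeta>)\<^sup>2), x + (\<sigma> * sqrt t * fst \<zeta>) *\<^sub>R snd \<zeta>) \<omega>
      = \<rho> t (fst \<zeta>) (snd \<zeta>) *\<^sub>R G (t * (1 - (fst \<zeta>)\<^sup>2)) (x + (\<sigma> * sqrt t * fst \<zeta>) *\<^sub>R snd \<zeta>) \<omega>"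
      by (simp add: \<phi>_def clp_id)
  qed
  ultimately show ?thesis by simp
qed

lemma heat0_measurable:
  fixes h :: "'a::euclidean_space \<Rightarrow> 'w \<Rightarrow> 'b::euclidean_space"
  assumes c: "\<And>\<omega>. \<omega> \<in> space N \<Longrightarrow> continuous_on UNIV (\<lambda>x. h x \<omega>)" and m: "\<And>x. h x \<in> borel_measurable N"
  shows "(\<lambda>\<omega>. heat0 \<sigma> (\<lambda>x. h x \<omega>) t x) \<in> borel_measurable N"
proof -
  have k: "(\<lambda>z. x + (\<sigma> * sqrt t) *\<^sub>R z) \<in> measurable (gauss :: 'a measure) borel"
    unfolding measurable_cong_sets[OF sets_gauss refl] by (intro borel_measurable_continuous_onI continuous_intros)
  from integral_caratheodory_measurable[OF prob_space_gauss c m k borel_measurable_const[of 1]]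
  show ?thesis by (simp add: heat0_def)
qed

text \<open>By induction on the list, each derivative is a pointwise limit of difference quotients
  with steps 1/(n+1).\<close>

lemma Dl_measurable:
  fixes v :: "'a::euclidean_space \<Rightarrow> 'w \<Rightarrow> real"
  assumes m: "\<And>x. v x \<in> borel_measurable N"
    and d: "\<And>\<omega> bs' b x. \<omega> \<in> space N \<Longrightarrow> set bs' \<subseteq> Basis \<Longrightarrow> b \<in> Basis \<Longrightarrow> length bs' < l \<Longrightarrow>
      ((\<lambda>r. Dl bs' (\<lambda>z. v z \<omega>) (x + r *\<^sub>R b)) has_real_derivative Dl (b # bs') (\<lambda>z. v z \<omega>) x) (at 0)"
  shows "set bs \<subseteq> Basis \<Longrightarrow> length bs \<le> l \<Longrightarrow> (\<lambda>\<omega>. Dl bs (\<lambda>z. v z \<omega>) x) \<in> borel_measurable N"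
proof (induction bs arbitrary: x)
  case Nil
  then show ?case using m by simp
next
  case (Cons b bs)
  then have b: "b \<in> Basis" and bs: "set bs \<subseteq> Basis" "length bs < l" by auto
  define s where "s n = inverse (real (Suc n))" for n
  have "s \<longlonglongrightarrow> 0" unfolding s_def[abs_def] by (rule LIMSEQ_inverse_real_of_nat)
  then have s: "filterlim s (at 0) sequentially"
    unfolding filterlim_at by (auto simp: s_def)
  show ?case
  proof (rule borel_measurable_LIMSEQ_metric)
    show "(\<lambda>\<omega>. (Dl bs (\<lambda>z. v z \<omega>) (x + s n *\<^sub>R b) - Dl bs (\<lambda>z. v z \<omega>) x) / s n) \<in> borel_measurable N" for n
      using Cons.IH[OF bs(1) less_imp_le[OF bs(2)]] by simp
    fix \<omega> assume w: "\<omega> \<in> space N"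
    have "((\<lambda>h. (Dl bs (\<lambda>z. v z \<omega>) (x + (0 + h) *\<^sub>R b) - Dl bs (\<lambda>z. v z \<omega>) (x + 0 *\<^sub>R b)) / h) \<longlongrightarrow> Dl (b # bs) (\<lambda>z. v z \<omega>) x) (at 0)"
      using d[OF w bs(1) b bs(2), of x] unfolding DERIV_def .
    from filterlim_compose[OF this s]
    show "(\<lambda>n. (Dl bs (\<lambda>z. v z \<omega>) (x + s n *\<^sub>R b) - Dl bs (\<lambda>z. v z \<omega>) x) / s n) \<longlonglongrightarrow> Dl (b # bs) (\<lambda>z. v z \<omega>) x"
      by simp
  qed
qed

lemma VD_measurable:
  fixes e :: "real \<Rightarrow> 'a::euclidean_space \<Rightarrow> 'w \<Rightarrow> 'b::euclidean_space"
  assumes m: "\<And>x. (\<lambda>\<omega>. e s x \<omega>) \<in> borel_measurable N" and s: "s \<in> {0..T}"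
    and e: "\<And>\<omega>. \<omega> \<in> space N \<Longrightarrow> C0l_b l T (\<lambda>t x. e t x \<omega>)" and bs: "set bs \<subseteq> Basis" "length bs \<le> l"
  shows "(\<lambda>\<omega>. VD bs (\<lambda>z. e s z \<omega>) x) \<in> borel_measurable N"
  unfolding VD_def
proof (intro borel_measurable_sum borel_measurable_scaleR borel_measurable_const)
  fix c :: 'b assume c: "c \<in> Basis"
  show "(\<lambda>\<omega>. Dl bs (\<lambda>z. e s z \<omega> \<bullet> c) x) \<in> borel_measurable N"
  proof (rule Dl_measurable[of "\<lambda>z \<omega>. e s z \<omega> \<bullet> c", OF _ _ bs])
    show "(\<lambda>\<omega>. e s x \<omega> \<bullet> c) \<in> borel_measurable N" for x using m[of x] by simp
    fix \<omega> and x b :: 'a and bs' :: "'a list"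
    assume w: "\<omega> \<in> space N" "set bs' \<subseteq> Basis" "b \<in> Basis" "length bs' < l"
    have "set bs' \<subseteq> Basis \<and> length bs' \<le> l" using w by simp
    from e[OF w(1), unfolded C0l_b_def, rule_format, OF c this, THEN conjunct1, rule_format, OF w(4) s w(3)]
    show "((\<lambda>r. Dl bs' (\<lambda>z. e s z \<omega> \<bullet> c) (x + r *\<^sub>R b)) has_real_derivative Dl (b # bs') (\<lambda>z. e s z \<omega> \<bullet> c) x) (at 0)" .
  qed
qed

text \<open>\<open>N\<close> is any \<sigma>-algebra for which \<eta> up to time t and h are
  measurable; it will be the trace on \<open>\<Omega>0\<close> of the filtration at one instant. The
  gradient iterates take part in the induction because \<open>Gs\<close> contains them.\<close>

theorem burgers_it_measurable:
  fixes f :: "real \<Rightarrow> 'a::euclidean_space \<Rightarrow> 'a \<Rightarrow> 'a" and e :: "real \<Rightarrow> 'a \<Rightarrow> 'w \<Rightarrow> 'a" and h :: "'a \<Rightarrow> 'w \<Rightarrow> 'a"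
  assumes T: "T > 0" and nu: "\<nu> > 0" and R: "R \<ge> 0" and f: "C0l_b 2 T (\<lambda>t xy. f t (fst xy) (snd xy))"
    and e: "\<And>\<omega>. \<omega> \<in> space N \<Longrightarrow> C0l_b 4 T (\<lambda>t x. e t x \<omega>)" and h: "\<And>\<omega>. \<omega> \<in> space N \<Longrightarrow> Cl_b 2 (\<lambda>x. h x \<omega>)"
    and t: "t \<in> {0..T}" and me: "\<And>s x. s \<in> {0..t} \<Longrightarrow> (\<lambda>\<omega>. e s x \<omega>) \<in> borel_measurable N"
    and mh: "\<And>x. (\<lambda>\<omega>. h x \<omega>) \<in> borel_measurable N"
  shows "s \<in> {0..t} \<Longrightarrow> (\<lambda>\<omega>. burgers_it R T \<nu> f (\<lambda>s z. e s z \<omega>) (\<lambda>z. h z \<omega>) n s x) \<in> borel_measurable N"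
proof -
  let ?U = "\<lambda>n s x \<omega>. burgers_it R T \<nu> f (\<lambda>s z. e s z \<omega>) (\<lambda>z. h z \<omega>) n s x"
  let ?p = "\<lambda>n b s x \<omega>. burgers_it1 R T \<nu> f (\<lambda>s z. e s z \<omega>) (\<lambda>z. h z \<omega>) n b s x"
  let ?\<sigma> = "sqrt (2 * \<nu>)"
  define G where "G n s y \<omega> = lin (burgers_drift R T (\<lambda>s z. e s z \<omega>) s y (?U n s y \<omega>)) (\<lambda>b. ?p n b s y \<omega>) + burgers_source R T \<nu> f (\<lambda>s z. e s z \<omega>) s y (?U n s y \<omega>)" for n s y \<omega>
  have T0: "T \<ge> 0" using T by simp
  have tT: "s \<in> {0..T}" if "s \<in> {0..t}" for s using that t by auto
  have \<sigma>: "?\<sigma> > 0" using nu by simp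
  \<comment> \<open>The locale is interpreted for each \<omega> separately, with its own constant;
    only formulas free of that constant leave the block.\<close>
  have facts: "?U 0 s x \<omega> = 0" "?p 0 b s x \<omega> = 0"
    "s \<in> {0..T} \<Longrightarrow> ?U (Suc n) s x \<omega> = heat0 ?\<sigma> (\<lambda>z. h z \<omega>) s x + kint duh_ker ?\<sigma> (\<lambda>s y. G n s y \<omega>) s x"
    "s \<in> {0..T} \<Longrightarrow> ?p (Suc n) b s x \<omega> = heat0 ?\<sigma> (VD [b] (\<lambda>z. h z \<omega>)) s x + kint (grad_ker ?\<sigma> b) ?\<sigma> (\<lambda>s y. G n s y \<omega>) s x"
    "\<exists>C. bcont C (\<lambda>s y. G n s y \<omega>)" if w: "\<omega> \<in> space N" for s x \<omega> n b
  proof -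
    obtain K where "semilinear T ?\<sigma> K (burgers_drift R T (\<lambda>s z. e s z \<omega>)) (burgers_source R T \<nu> f (\<lambda>s z. e s z \<omega>)) (burgers_drift' R T (\<lambda>s z. e s z \<omega>)) (burgers_source' R T \<nu> f (\<lambda>s z. e s z \<omega>)) (\<lambda>z. h z \<omega>) (\<lambda>b. VD [b] (\<lambda>z. h z \<omega>)) (\<lambda>b a. VD [a, b] (\<lambda>z. h z \<omega>))"
      using burgers_semilinear[OF T nu R f e[OF w] h[OF w]] by (elim exE)
    then interpret S: semilinear T ?\<sigma> K "burgers_drift R T (\<lambda>s z. e s z \<omega>)" "burgers_source R T \<nu> f (\<lambda>s z. e s z \<omega>)" "burgers_drift' R T (\<lambda>s z. e s z \<omega>)" "burgers_source' R T \<nu> f (\<lambda>s z. e s z \<omega>)" "\<lambda>z. h z \<omega>" "\<lambda>b. VD [b] (\<lambda>z. h z \<omega>)" "\<lambda>b a. VD [a, b] (\<lambda>z. h z \<omega>)" .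
    have GS: "(\<lambda>s y. G n s y \<omega>) = S.Gs (S.U n) (S.p1 n)" for n
      by (intro ext) (simp add: G_def S.Gs_def S.Gf_def burgers_it_def burgers_it1_def)
    show "?U 0 s x \<omega> = 0" "?p 0 b s x \<omega> = 0" by (simp_all add: burgers_it_def burgers_it1_def S.it_simps)
    show "?U (Suc n) s x \<omega> = heat0 ?\<sigma> (\<lambda>z. h z \<omega>) s x + kint duh_ker ?\<sigma> (\<lambda>s y. G n s y \<omega>) s x" if "s \<in> {0..T}"
      unfolding burgers_it_def GS S.it_Suc(1) S.clip_id[OF that] ..
    show "?p (Suc n) b s x \<omega> = heat0 ?\<sigma> (VD [b] (\<lambda>z. h z \<omega>)) s x + kint (grad_ker ?\<sigma> b) ?\<sigma> (\<lambda>s y. G n s y \<omega>) s x" if "s \<in> {0..T}"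
      unfolding burgers_it1_def GS S.it_Suc(2) S.clip_id[OF that] ..
    obtain C0 where g: "S.good C0 (S.U n) (S.p1 n) (S.P2 n)" using S.good_it by blast
    show "\<exists>C. bcont C (\<lambda>s y. G n s y \<omega>)" unfolding GS using S.bcont_Gs[OF g] by blast
  qed
  have hC: "C0l_b 2 T (\<lambda>_ x. h x \<omega>)" if "\<omega> \<in> space N" for \<omega> by (rule C0l_b_of_Cl_b[OF h[OF that]])
  have hc: "continuous_on UNIV (VD bs (\<lambda>z. h z \<omega>))" if "\<omega> \<in> space N" "set bs \<subseteq> Basis" "length bs \<le> 2" for \<omega> bs
    using continuous_on_strip[OF C0l_b_continuous[OF hC[OF that(1)] that(2,3)], of UNIV "\<lambda>_. 0" "\<lambda>x. x"] T by (simp add: continuous_intros)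
  have mVh: "(\<lambda>\<omega>. VD bs (\<lambda>z. h z \<omega>) x) \<in> borel_measurable N" if "set bs \<subseteq> Basis" "length bs \<le> 2" for bs x
    by (rule VD_measurable[where e="\<lambda>_. h" and s=0 and T=T, OF mh _ hC that]) (use T in auto)
  have mVe: "(\<lambda>\<omega>. VD bs (\<lambda>z. e s z \<omega>) x) \<in> borel_measurable N" if "s \<in> {0..t}" "set bs \<subseteq> Basis" "length bs \<le> 4" for bs x s
    by (rule VD_measurable[OF me[OF that(1)] tT[OF that(1)] e that(2,3)])
  have mTr: "(\<lambda>\<omega>. Tr R (v \<omega>)) \<in> borel_measurable N" if "v \<in> borel_measurable N" for v :: "'w \<Rightarrow> 'a"
    using measurable_compose[OF that, of "Tr R" borel] borel_measurable_continuous_onI[OF Tr_continuous[of UNIV "\<lambda>u. u" R]]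
    by (simp add: continuous_intros)
  have mG: "(\<lambda>\<omega>. G n s y \<omega>) \<in> borel_measurable N"
    if s: "s \<in> {0..t}" and U: "(\<lambda>\<omega>. ?U n s y \<omega>) \<in> borel_measurable N" and p: "\<And>b. b \<in> Basis \<Longrightarrow> (\<lambda>\<omega>. ?p n b s y \<omega>) \<in> borel_measurable N" for n s y
  proof -
    note [measurable] = me[OF s] U mTr[OF U]
    have [measurable]: "(\<lambda>\<omega>. e s y \<omega> + Tr R (?U n s y \<omega>)) \<in> borel_measurable N" by measurable
    have cf: "continuous_on UNIV (\<lambda>z. f s y z)"
    proof -
      have "continuous_on ({0..T} \<times> UNIV) (\<lambda>(t, xy). f t (fst xy) (snd xy))"
        using C0l_b_continuous[OF f, of "[]"] by (simp add: VD_Nil)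
      from continuous_on_strip[OF this, of UNIV "\<lambda>_. s" "\<lambda>z. (y, z)"] show ?thesis
        using tT[OF s] by (simp add: continuous_intros)
    qed
    have [measurable]: "(\<lambda>\<omega>. f s y (e s y \<omega> + Tr R (?U n s y \<omega>))) \<in> borel_measurable N"
      by (rule measurable_compose[OF _ borel_measurable_continuous_onI[OF cf]]) measurable
    have [measurable]: "(\<lambda>\<omega>. lap (\<lambda>z. e s z \<omega>) y) \<in> borel_measurable N"
      unfolding lap_VD by (intro borel_measurable_sum mVe[OF s]) auto
    have l: "(\<lambda>\<omega>. lin (v \<omega>) (\<lambda>b. q b \<omega>)) \<in> borel_measurable N"
      if [measurable]: "v \<in> borel_measurable N" and q: "\<And>b. b \<in> Basis \<Longrightarrow> q b \<in> borel_measurable N" for v and q :: "'a \<Rightarrow> 'w \<Rightarrow> 'a"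
      unfolding lin_def by (intro borel_measurable_sum borel_measurable_scaleR q) auto
    have [measurable]: "(\<lambda>\<omega>. lin (e s y \<omega> + Tr R (?U n s y \<omega>)) (\<lambda>b. VD [b] (\<lambda>z. e s z \<omega>) y)) \<in> borel_measurable N"
      by (rule l) (auto intro!: mVe[OF s])
    have [measurable]: "(\<lambda>\<omega>. lin (- (e s y \<omega> + Tr R (?U n s y \<omega>))) (\<lambda>b. ?p n b s y \<omega>)) \<in> borel_measurable N"
      by (rule l) (auto intro!: p)
    show ?thesis unfolding G_def burgers_drift_def burgers_source_def clp_id[OF tT[OF s]] by measurable
  qed
  have main: "\<forall>s\<in>{0..t}. \<forall>x. (\<lambda>\<omega>. ?U n s x \<omega>) \<in> borel_measurable N \<and> (\<forall>b\<in>Basis. (\<lambda>\<omega>. ?p n b s x \<omega>) \<in> borel_measurable N)" for n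
  proof (induction n)
    case 0
    have "(\<lambda>\<omega>. ?U 0 s x \<omega>) \<in> borel_measurable N \<longleftrightarrow> (\<lambda>\<omega>. 0::'a) \<in> borel_measurable N" for s x
      by (rule measurable_cong) (rule facts(1))
    moreover have "(\<lambda>\<omega>. ?p 0 b s x \<omega>) \<in> borel_measurable N \<longleftrightarrow> (\<lambda>\<omega>. 0::'a) \<in> borel_measurable N" for b s x
      by (rule measurable_cong) (rule facts(2))
    ultimately show ?case by simp
  next
    case (Suc n)
    have mGn: "(\<lambda>\<omega>. G n s y \<omega>) \<in> borel_measurable N" if "s \<in> {0..t}" for s y
      using Suc that by (intro mG) auto
    show ?case
    proof (intro ballI allI conjI)
      fix s x assume s: "s \<in> {0..t}"
      have s0: "s \<ge> 0" using s by auto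
      have mGs: "(\<lambda>\<omega>. G n r y \<omega>) \<in> borel_measurable N" if "r \<in> {0..s}" for r y using that s by (intro mGn) auto
      have 1: "(\<lambda>\<omega>. heat0 ?\<sigma> (\<lambda>z. h z \<omega>) s x + kint duh_ker ?\<sigma> (\<lambda>s y. G n s y \<omega>) s x) \<in> borel_measurable N"
        using hc[of _ "[]"] by (intro borel_measurable_add heat0_measurable kint_measurable[OF s0 ker_duh[OF T0 \<sigma>] facts(5) mGs] mh) (auto simp: VD_Nil)
      show "(\<lambda>\<omega>. ?U (Suc n) s x \<omega>) \<in> borel_measurable N"
        by (rule measurable_cong[THEN iffD2, OF facts(3)[OF _ tT[OF s]] 1])
      fix b :: 'a assume b: "b \<in> Basis"
      have "(\<lambda>\<omega>. heat0 ?\<sigma> (\<lambda>z. VD [b] (\<lambda>z. h z \<omega>) z) s x) \<in> borel_measurable N"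
        using hc[of _ "[b]"] mVh[of "[b]"] b by (intro heat0_measurable) auto
      then have 2: "(\<lambda>\<omega>. heat0 ?\<sigma> (VD [b] (\<lambda>z. h z \<omega>)) s x + kint (grad_ker ?\<sigma> b) ?\<sigma> (\<lambda>s y. G n s y \<omega>) s x) \<in> borel_measurable N"
        by (intro borel_measurable_add kint_measurable[OF s0 ker_grad[OF T0 \<sigma> b] facts(5) mGs]) auto
      show "(\<lambda>\<omega>. ?p (Suc n) b s x \<omega>) \<in> borel_measurable N"
        by (rule measurable_cong[THEN iffD2, OF facts(4)[OF _ tT[OF s]] 2])
    qed
  qed
  show "s \<in> {0..t} \<Longrightarrow> (\<lambda>\<omega>. ?U n s x \<omega>) \<in> borel_measurable N" using main by blast
qed

section \<open>Adaptedness and the main theorem\<close>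

lemma sets_FB:
  assumes "F0 \<subseteq> sets M"
  shows "sets (sigma (space M) (FB M B F0 t)) = FB M B F0 t"
proof -
  have g: "(\<Union>r\<in>{0..t}. gen_sets M (B r)) \<union> F0 \<union> null_sets M \<subseteq> Pow (space M)"
    using assms sets.space_closed[of M] by (auto simp: gen_sets_def null_sets_def)
  have "FB M B F0 t \<subseteq> Pow (space M)"
    unfolding FB_def using sigma_sets_into_sp[OF g] by blast
  then show ?thesis
    by (simp add: sets_measure_of) (simp add: FB_def sigma_sets_sigma_sets_eq[OF g])
qed

lemma FB_mono: "s \<le> t \<Longrightarrow> FB M B F0 s \<subseteq> FB M B F0 t"
  unfolding FB_def by (rule sigma_sets_mono') auto

lemma FB_subset_sets:
  assumes "F0 \<subseteq> sets M" and B: "\<And>r. 0 \<le> r \<Longrightarrow> B r \<in> borel_measurable M"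
  shows "FB M B F0 t \<subseteq> sets M"
  unfolding FB_def
proof (rule sets.sigma_sets_subset)
  show "(\<Union>r\<in>{0..t}. gen_sets M (B r)) \<union> F0 \<union> null_sets M \<subseteq> sets M"
    using assms(1) measurable_sets[OF B] by (auto simp: gen_sets_def null_sets_def)
qed

lemma measurable_FB_mono:
  assumes F0: "F0 \<subseteq> sets M" and X: "X \<in> measurable (sigma (space M) (FB M B F0 s)) N" and st: "s \<le> t"
  shows "X \<in> measurable (sigma (space M) (FB M B F0 t)) N"
proof -
  have sp: "space (sigma (space M) (FB M B F0 r)) = space M" for r
    by (rule space_measure_of_conv)
  show ?thesis
    using X FB_mono[OF st, of M B F0] unfolding measurable_def sets_FB[OF F0] sp by auto
qed

text \<open>The elementary integrals up to time t are measurable for the filtration at t.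
  Mean-square convergence gives almost sure convergence along a subsequence, and the exceptional
  null set belongs to the filtration; so \<open>X\<close> itself, and not just a modification of it,
  is adapted.\<close>

lemma ito_version_measurable:
  fixes B :: "real \<Rightarrow> 'w \<Rightarrow> real^'d::finite"
  assumes F0: "F0 \<subseteq> sets M" and B: "\<And>r. 0 \<le> r \<Longrightarrow> B r \<in> borel_measurable M"
    and ito: "ito_version M B (FB M B F0) \<phi> t X"
  shows "X \<in> borel_measurable (sigma (space M) (FB M B F0 t))"
proof -
  let ?N = "sigma (space M) (FB M B F0 t)"
  have sp: "space ?N = space M" by (rule space_measure_of_conv)
  have XM: "X \<in> borel_measurable M" using ito by (simp add: ito_version_def)
  obtain n tt \<xi> where sa: "\<And>m. simple_adapted M (FB M B F0) (n m) (tt m) (\<xi> m) t"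
    and conv: "(\<lambda>m. \<integral>\<^sup>+\<omega>. ennreal ((simple_int B (n m) (tt m) (\<xi> m) \<omega> - X \<omega>)\<^sup>2) \<partial>M) \<longlonglongrightarrow> 0"
    using ito unfolding ito_version_def by (elim conjE exE) blast
  define Y where "Y m = simple_int B (n m) (tt m) (\<xi> m)" for m
  have mono: "tt m i \<le> tt m j" if "i \<le> j" "j \<le> n m" for m i j
    using that
  proof (induction j rule: dec_induct)
    case (step j)
    have "tt m j < tt m (Suc j)" using sa[of m] step by (simp add: simple_adapted_def)
    then show ?case using step by simp
  qed simp
  have ttr: "tt m k \<in> {0..t}" if "k \<le> n m" for m k
    using mono[of 0 k m] mono[of k "n m" m] sa[of m] that by (simp add: simple_adapted_def)
  have BN: "B r \<in> borel_measurable ?N" if r: "r \<in> {0..t}" for r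
  proof (rule measurableI)
    fix A :: "(real^'d) set" assume "A \<in> sets borel"
    then have "B r -` A \<inter> space M \<in> FB M B F0 t"
      unfolding FB_def using r by (intro sigma_sets.Basic) (auto simp: gen_sets_def)
    then show "B r -` A \<inter> space ?N \<in> sets ?N" unfolding sp sets_FB[OF F0] .
  qed simp
  have \<xi>N: "\<xi> m k \<in> borel_measurable ?N" if "k < n m" for m k
  proof -
    have 1: "\<xi> m k \<in> measurable (sigma (space M) (FB M B F0 (tt m k))) borel"
      using sa[of m] that by (simp add: simple_adapted_def)
    have "tt m k \<le> t" using ttr[of k m] that by simp
    then show ?thesis by (rule measurable_FB_mono[OF F0 1])
  qed
  have YN: "Y m \<in> borel_measurable ?N" for m
    unfolding Y_def simple_int_def
    by (intro borel_measurable_sum borel_measurable_inner borel_measurable_diff \<xi>N BN ttr) auto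
  have YM: "Y m \<in> borel_measurable M" for m
    using YN[of m] FB_subset_sets[where t=t and B=B, OF F0 B] unfolding measurable_def sets_FB[OF F0] sp by auto
  note [measurable] = XM YM
  have conv': "(\<lambda>m. \<integral>\<^sup>+\<omega>. ennreal ((Y m \<omega> - X \<omega>)\<^sup>2) \<partial>M) \<longlonglongrightarrow> 0"
    using conv by (simp add: Y_def)
  then have "\<forall>\<^sub>F m in sequentially. (\<integral>\<^sup>+\<omega>. ennreal ((Y m \<omega> - X \<omega>)\<^sup>2) \<partial>M) < 1"
    by (rule order_tendstoD) simp
  \<comment> \<open>The second moment of the error is known to be finite only close to the limit, so
    the sequence is shifted by m0 before the squares are treated as integrable functions.\<close>
  then obtain m0 where m0: "\<And>m. m \<ge> m0 \<Longrightarrow> (\<integral>\<^sup>+\<omega>. ennreal ((Y m \<omega> - X \<omega>)\<^sup>2) \<partial>M) < 1"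
    unfolding eventually_sequentially by (elim exE) blast
  define v where "v m \<omega> = (Y (m + m0) \<omega> - X \<omega>)\<^sup>2" for m \<omega>
  have vi: "integrable M (v m)" for m
  proof (rule integrableI_nonneg)
    show "v m \<in> borel_measurable M" unfolding v_def[abs_def] by measurable
    show "(\<integral>\<^sup>+\<omega>. ennreal (v m \<omega>) \<partial>M) < \<infinity>"
      using m0[of "m + m0"] unfolding v_def by (simp add: order.strict_trans)
  qed (simp add: v_def)
  have "(\<lambda>m. ennreal (\<integral>\<omega>. v m \<omega> \<partial>M)) \<longlonglongrightarrow> ennreal 0"
  proof -
    have "ennreal (\<integral>\<omega>. v m \<omega> \<partial>M) = (\<integral>\<^sup>+\<omega>. ennreal (v m \<omega>) \<partial>M)" for m
      by (rule nn_integral_eq_integral[OF vi, symmetric]) (simp add: v_def)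
    then show ?thesis using LIMSEQ_ignore_initial_segment[OF conv', of m0] by (simp add: v_def)
  qed
  then have "(\<lambda>m. \<integral>\<omega>. v m \<omega> \<partial>M) \<longlonglongrightarrow> 0"
    by (rule tendsto_ennrealD) (auto intro!: always_eventually Bochner_Integration.integral_nonneg simp: v_def)
  then have "(\<lambda>m. \<integral>\<omega>. norm (v m \<omega>) \<partial>M) \<longlonglongrightarrow> 0" by (simp add: v_def)
  from tendsto_L1_AE_subseq[OF vi this]
  obtain r where "AE \<omega> in M. (\<lambda>k. v (r k) \<omega>) \<longlonglongrightarrow> 0" by (elim exE conjE)
  then obtain Z where Z: "{\<omega> \<in> space M. \<not> (\<lambda>k. v (r k) \<omega>) \<longlonglongrightarrow> 0} \<subseteq> Z" "emeasure M Z = 0" "Z \<in> sets M"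
    by (rule AE_E)
  have Znull: "Z \<in> null_sets M" using Z by (simp add: null_sets_def)
  have nullN: "A \<in> sets ?N" if "A \<in> null_sets M" for A
    unfolding sets_FB[OF F0] unfolding FB_def using that by (intro sigma_sets.Basic UnI2)
  \<comment> \<open>Setting limit and approximations to 0 on \<open>Z\<close> makes the subsequence
    converge for every \<omega>.\<close>
  define X' where "X' \<omega> = (if \<omega> \<in> Z then 0 else X \<omega>)" for \<omega>
  have X'N: "X' \<in> borel_measurable ?N"
  proof (rule borel_measurable_LIMSEQ_metric)
    show "(\<lambda>\<omega>. if \<omega> \<in> Z then 0 else Y (r k + m0) \<omega>) \<in> borel_measurable ?N" for k
    proof (rule measurable_If_set)
      show "Z \<inter> space ?N \<in> sets ?N" using nullN[OF Znull] by (intro sets.Int) auto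
    qed (simp_all add: YN)
    fix \<omega> assume "\<omega> \<in> space ?N"
    then have w: "\<omega> \<in> space M" unfolding sp .
    show "(\<lambda>k. if \<omega> \<in> Z then 0 else Y (r k + m0) \<omega>) \<longlonglongrightarrow> X' \<omega>"
    proof (cases "\<omega> \<in> Z")
      case False
      then have "(\<lambda>k. v (r k) \<omega>) \<longlonglongrightarrow> 0" using Z(1) w by auto
      from tendsto_real_sqrt[OF this]
      have "(\<lambda>k. \<bar>Y (r k + m0) \<omega> - X \<omega>\<bar>) \<longlonglongrightarrow> 0" by (simp add: v_def)
      then have "(\<lambda>k. Y (r k + m0) \<omega> - X \<omega>) \<longlonglongrightarrow> 0" by (rule tendsto_rabs_zero_cancel)
      then show ?thesis using False by (simp add: X'_def LIM_zero_iff)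
    qed (simp add: X'_def)
  qed
  show ?thesis
  proof (rule measurableI)
    fix A :: "real set" assume A: "A \<in> sets borel"
    have 1: "X' -` A \<inter> space ?N \<in> sets ?N" by (rule measurable_sets[OF X'N A])
    \<comment> \<open>\<open>X\<close> is measurable for \<open>M\<close>, so this part of
      \<open>Z\<close> is again a null set of \<open>M\<close> and therefore lies in the
      filtration.\<close>
    have "X -` A \<inter> space M \<inter> Z \<in> null_sets M"
      using measurable_sets[OF XM A] Z(3) by (intro null_sets_subset[OF Znull]) auto
    then have 2: "X -` A \<inter> space M \<inter> Z \<in> sets ?N" by (rule nullN)
    have "X -` A \<inter> space ?N = (X' -` A \<inter> space ?N - Z) \<union> (X -` A \<inter> space M \<inter> Z)"
      unfolding sp by (auto simp: X'_def)
    then show "X -` A \<inter> space ?N \<in> sets ?N" using sets.Un[OF sets.Diff[OF 1 nullN[OF Znull]] 2] by simp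
  qed simp
qed

theorem mainTheorem7:
  fixes M :: "'w measure" and B :: "real \<Rightarrow> 'w \<Rightarrow> real^'d::finite" and F0 :: "'w set set"
    and T \<nu> \<beta> L p :: real
    and f :: "real \<Rightarrow> real^'n::finite \<Rightarrow> real^'n \<Rightarrow> real^'n"
    and g :: "real \<Rightarrow> real^'n \<Rightarrow> 'w \<Rightarrow> real^'n^'d"
    and h :: "real^'n \<Rightarrow> 'w \<Rightarrow> real^'n"
    and \<eta> :: "real \<Rightarrow> real^'n \<Rightarrow> 'w \<Rightarrow> real^'n"
    and \<Omega>0 :: "'w set"
  assumes T: "T > 0" and nu: "\<nu> > 0" and beta: "0 < \<beta>" "\<beta> < 1"
    and P: "prob_space M"
    and BM: "brownian_motion M B"
    and F0: "sigma_algebra (space M) F0" "F0 \<subseteq> sets M"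
      "prob_space.indep_set M F0 (nat_sigma M B {0..})"
    \<comment> \<open>(A1)\<close>
    and A1_reg: "Cbl_b \<beta> 2 T (\<lambda>t (xy :: (real^'n) \<times> (real^'n)). f t (fst xy) (snd xy))"
    and A1_growth: "\<forall>t\<in>{0..T}. \<forall>x y. norm (f t x y) \<le> L * (1 + norm y)"
    and A1_lip: "\<forall>t\<in>{0..T}. \<forall>x y y'. norm (f t x y - f t x y') \<le> L * norm (y - y')"
    and A1_loc: "\<forall>D>0. \<exists>C. \<forall>c\<in>Basis. \<forall>bs. set bs \<subseteq> Basis \<and> 1 \<le> length bs \<and> length bs \<le> 2 \<longrightarrow>
        (\<forall>t\<in>{0..T}. \<forall>x y. (\<forall>i. \<bar>y $ i\<bar> \<le> D) \<longrightarrow>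
           \<bar>Dl bs (\<lambda>(xy :: (real^'n) \<times> (real^'n)). f t (fst xy) (snd xy) \<bullet> c) (x, y)\<bar> \<le> C)"
    and A1_supp: "\<exists>K. compact K \<and> (\<forall>x. x \<notin> K \<longrightarrow> f 0 x 0 = 0)"
    \<comment> \<open>(A2)\<close>
    and A2_adapt: "\<forall>s\<in>{0..T}. \<forall>x. (\<lambda>\<omega>. g s x \<omega>) \<in> measurable (sigma (space M) (FB M B F0 s)) borel"
    and A2_meas: "\<forall>x. (\<lambda>(s, \<omega>). g s x \<omega>) \<in> borel_measurable (lborel \<Otimes>\<^sub>M M)"
    and A2_Hk: "\<forall>s\<in>{0..T}. \<forall>\<omega>\<in>space M. in_Hk_vec (CARD('n) div 2 + 5) (\<lambda>x. g s x \<omega>)"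
    and A2_p: "p > 4 / (1 - \<beta>)"
    and A2_int: "(\<integral>\<^sup>+\<omega>. (\<integral>\<^sup>+s. ennreal (indicator {0..T} s *
         Hk_norm_vec (CARD('n) div 2 + 5) (\<lambda>x. g s x \<omega>) powr p) \<partial>lborel) \<partial>M) < \<infinity>"
    \<comment> \<open>(A3)\<close>
    and A3: "\<forall>x. (\<lambda>\<omega>. h x \<omega>) \<in> measurable (sigma (space M) F0) borel"
      "\<forall>\<omega>\<in>space M. C2beta_b \<beta> (\<lambda>x. h x \<omega>)"
    \<comment> \<open>eta is a version of int_0^t g(s,x) dB_s\<close>
    and eta_ito: "\<forall>t\<in>{0..T}. \<forall>x. \<forall>i. ito_version M B (FB M B F0) (\<lambda>s \<omega>. \<chi> j. g s x \<omega> $ j $ i) t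
        (\<lambda>\<omega>. \<eta> t x \<omega> $ i)"
    and Omega0: "\<Omega>0 \<in> sets M" "\<Omega>0 \<subseteq> space M" "emeasure M \<Omega>0 = 1"
      "\<forall>\<omega>\<in>\<Omega>0. Cbl_b \<beta> 4 T (\<lambda>t x. \<eta> t x \<omega>)"
    \<comment> \<open>uniform bounds in C^{0,4}_b and C^2_b\<close>
    and eta_bd: "\<exists>K. \<forall>\<omega>\<in>\<Omega>0. \<forall>c\<in>Basis. \<forall>bs. set bs \<subseteq> Basis \<and> length bs \<le> 4 \<longrightarrow>
        (\<forall>t\<in>{0..T}. \<forall>x. \<bar>Dl bs (\<lambda>z. \<eta> t z \<omega> \<bullet> c) x\<bar> \<le> K)"
    and h_bd: "\<exists>K. \<forall>\<omega>\<in>\<Omega>0. \<forall>c\<in>Basis. \<forall>bs. set bs \<subseteq> Basis \<and> length bs \<le> 2 \<longrightarrow>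
        (\<forall>x. \<bar>Dl bs (\<lambda>z. h z \<omega> \<bullet> c) x\<bar> \<le> K)"
  shows "\<exists>y. bw_solution M B F0 \<Omega>0 T \<nu> f \<eta> h y \<and>
     (\<forall>y'. bw_solution M B F0 \<Omega>0 T \<nu> f \<eta> h y' \<longrightarrow>
        (\<forall>\<omega>\<in>\<Omega>0. \<forall>t\<in>{0..T}. \<forall>x. y' t x \<omega> = y t x \<omega>))"
proof -
  let ?N = "\<lambda>t. sigma (space M) (FB M B F0 t)"
  have spN: "space (?N t) = space M" for t by (rule space_measure_of_conv)
  have Bm: "B r \<in> borel_measurable M" if "0 \<le> r" for r
    using BM that unfolding brownian_motion_def by simp
  have f: "C0l_b 2 T (\<lambda>t xy. f t (fst xy) (snd xy))" using A1_reg by (simp add: Cbl_b_def)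
  have e: "C0l_b 4 T (\<lambda>t x. \<eta> t x \<omega>)" if "\<omega> \<in> \<Omega>0" for \<omega> using Omega0(4) that by (simp add: Cbl_b_def)
  have h: "Cl_b 2 (\<lambda>x. h x \<omega>)" if "\<omega> \<in> \<Omega>0" for \<omega> using A3(2) Omega0(2) that by (auto simp: C2beta_b_def)
  \<comment> \<open>The complement is null and null sets belong to the filtration at every time, so
    a prescribed value off \<open>\<Omega>0\<close> does not disturb adaptedness.\<close>
  have \<Omega>N: "\<Omega>0 \<in> sets (?N t)" for t
  proof -
    interpret prob_space M by (rule P)
    have "emeasure M (space M - \<Omega>0) = 0"
      using Omega0 by (subst emeasure_compl) (auto simp: emeasure_space_1)
    then have "space M - \<Omega>0 \<in> null_sets M" using Omega0(1) by (simp add: null_sets_def)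
    then have "space M - \<Omega>0 \<in> sets (?N t)" unfolding sets_FB[OF F0(2)] unfolding FB_def by (intro sigma_sets.Basic) auto
    then have "space (?N t) - (space M - \<Omega>0) \<in> sets (?N t)" by (rule sets.compl_sets)
    moreover have "space M - (space M - \<Omega>0) = \<Omega>0" using Omega0(2) by auto
    ultimately show ?thesis unfolding spN by simp
  qed
  have eta_m: "(\<lambda>\<omega>. \<eta> s x \<omega>) \<in> borel_measurable (?N t)" if s: "s \<in> {0..T}" "s \<le> t" for s t x
  proof (rule measurable_FB_mono[OF F0(2) _ s(2)])
    show "(\<lambda>\<omega>. \<eta> s x \<omega>) \<in> borel_measurable (?N s)"
    proof (subst borel_measurable_euclidean_space, rule ballI)
      fix c :: "real^'n" assume "c \<in> Basis"
      then obtain i where c: "c = axis i 1" by (auto simp: Basis_vec_def)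
      have "(\<lambda>\<omega>. \<eta> s x \<omega> $ i) \<in> borel_measurable (?N s)"
        by (rule ito_version_measurable[OF F0(2) Bm eta_ito[rule_format, OF s(1)]])
      then show "(\<lambda>\<omega>. \<eta> s x \<omega> \<bullet> c) \<in> borel_measurable (?N s)" by (simp add: c inner_axis)
    qed
  qed
  have h_m: "(\<lambda>\<omega>. h x \<omega>) \<in> borel_measurable (?N t)" for x t
  proof (rule measurableI)
    fix A :: "(real^'n) set" assume A: "A \<in> sets borel"
    interpret F: sigma_algebra "space M" F0 by (rule F0(1))
    have "(\<lambda>\<omega>. h x \<omega>) -` A \<inter> space (sigma (space M) F0) \<in> sets (sigma (space M) F0)"
      using A3(1) A by (intro measurable_sets) auto
    then have "(\<lambda>\<omega>. h x \<omega>) -` A \<inter> space M \<in> F0"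
      by (simp add: space_measure_of_conv F.sets_measure_of_eq)
    then show "(\<lambda>\<omega>. h x \<omega>) -` A \<inter> space (?N t) \<in> sets (?N t)"
      unfolding spN sets_FB[OF F0(2)] unfolding FB_def by (intro sigma_sets.Basic) auto
  qed simp
  obtain Ke where Ke: "\<forall>\<omega>\<in>\<Omega>0. \<forall>c\<in>Basis. \<forall>bs. set bs \<subseteq> Basis \<and> length bs \<le> 4 \<longrightarrow>
        (\<forall>t\<in>{0..T}. \<forall>x. \<bar>Dl bs (\<lambda>z. \<eta> t z \<omega> \<bullet> c) x\<bar> \<le> Ke)"
    using eta_bd by (elim exE)
  obtain Kh where Kh: "\<forall>\<omega>\<in>\<Omega>0. \<forall>c\<in>Basis. \<forall>bs. set bs \<subseteq> Basis \<and> length bs \<le> 2 \<longrightarrow>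
        (\<forall>x. \<bar>Dl bs (\<lambda>z. h z \<omega> \<bullet> c) x\<bar> \<le> Kh)"
    using h_bd by (elim exE)
  obtain Kf where Kf: "\<forall>bs. set bs \<subseteq> Basis \<and> length bs \<le> 2 \<longrightarrow>
      (\<forall>t\<in>{0..T}. \<forall>x. norm (VD bs (\<lambda>xy. f t (fst xy) (snd xy)) x) \<le> Kf)"
    using C0l_b_bound[OF f] by (elim exE)
  let ?d = "real DIM(real^'n)"
  have ke: "norm (VD bs (\<lambda>x. \<eta> t x \<omega>) x) \<le> ?d * Ke" if "\<omega> \<in> \<Omega>0" "set bs \<subseteq> Basis" "length bs \<le> 4" "t \<in> {0..T}" for \<omega> bs t x
    by (rule VD_bound) (rule Ke[rule_format, OF that(1) _ _ that(4)], use that in auto)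
  have ke0: "norm (\<eta> t x \<omega>) \<le> ?d * Ke" if "\<omega> \<in> \<Omega>0" "t \<in> {0..T}" for \<omega> t x
    using ke[OF that(1) _ _ that(2), of "[]" x] by (simp add: VD_Nil)
  have kl: "norm (lap (\<lambda>x. \<eta> t x \<omega>) x) \<le> ?d * (?d * Ke)" if "\<omega> \<in> \<Omega>0" "t \<in> {0..T}" for \<omega> t x
  proof -
    have "norm (lap (\<lambda>x. \<eta> t x \<omega>) x) \<le> (\<Sum>b\<in>(Basis::(real^'n) set). ?d * Ke)"
      unfolding lap_VD by (rule order_trans[OF norm_sum sum_mono]) (use ke that in auto)
    then show ?thesis by simp
  qed
  have kh: "norm (h x \<omega>) \<le> ?d * Kh" if w: "\<omega> \<in> \<Omega>0" for \<omega> x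
  proof -
    have "norm (VD [] (\<lambda>x. h x \<omega>) x) \<le> ?d * Kh"
      by (rule VD_bound) (use Kh[rule_format, OF w, of _ "[]"] in simp)
    then show ?thesis by (simp add: VD_Nil)
  qed
  have kf: "norm (f t x y) \<le> Kf" if "t \<in> {0..T}" for t x y
    using Kf[rule_format, of "[]" t "(x, y)"] that by (simp add: VD_Nil)
  \<comment> \<open>The left-hand side of the condition \<open>RR\<close> of
    \<open>burgers_exists\<close>, with constants free of \<omega>, so that one level R serves for
    all paths. A factor ?d turns bounds on components into bounds on vectors; the Laplacian brings a
    second one.\<close>
  define R2 where "R2 = ((?d * Kh)\<^sup>2 + (Kf + \<nu> * (?d * (?d * Ke)) + ?d * (?d * Ke) * (?d * Ke))\<^sup>2 * T) * exp ((1 + 2 * (?d * (?d * Ke))) * T)"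
  have R2: "R2 \<ge> 0" unfolding R2_def using T by (intro mult_nonneg_nonneg add_nonneg_nonneg) auto
  define R where "R = sqrt R2"
  have R: "R \<ge> 0" "R2 \<le> R\<^sup>2" using R2 by (simp_all add: R_def)
  let ?U = "\<lambda>n t x \<omega>. burgers_it R T \<nu> f (\<lambda>s z. \<eta> s z \<omega>) (\<lambda>z. h z \<omega>) n t x"
  \<comment> \<open>Defined through the iterates, so that measurability passes to it; the pathwise
    solution is then recognised as this limit. The value 0 off \<open>\<Omega>0\<close> makes it a
    function on the whole space.\<close>
  define y where "y t x \<omega> = (if \<omega> \<in> \<Omega>0 then lim (\<lambda>n. ?U n (T - t) x \<omega>) else 0)" for t x \<omega>
  have sol: "(\<forall>t x. (\<lambda>n. ?U n t x \<omega>) \<longlonglongrightarrow> y (T - t) x \<omega>) \<and> C12_b T (\<lambda>t x. y t x \<omega>) \<and>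
      solves_bw T \<nu> f (\<lambda>t x. \<eta> t x \<omega>) (\<lambda>x. h x \<omega>) (\<lambda>t x. y t x \<omega>)" if w: "\<omega> \<in> \<Omega>0" for \<omega>
  proof -
    have "\<exists>u. (\<forall>t x. (\<lambda>n. ?U n t x \<omega>) \<longlonglongrightarrow> u t x) \<and>
        C12_b T (\<lambda>t x. u (T - t) x) \<and> solves_bw T \<nu> f (\<lambda>t x. \<eta> t x \<omega>) (\<lambda>x. h x \<omega>) (\<lambda>t x. u (T - t) x)"
      by (rule burgers_exists[OF T nu R(1) f e[OF w] h[OF w] kf ke0[OF w] _ kl[OF w] kh[OF w]])
         (use ke[OF w] R(2)[unfolded R2_def] in auto)
    then obtain u where u: "\<And>t x. (\<lambda>n. ?U n t x \<omega>) \<longlonglongrightarrow> u t x" "C12_b T (\<lambda>t x. u (T - t) x)"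
      "solves_bw T \<nu> f (\<lambda>t x. \<eta> t x \<omega>) (\<lambda>x. h x \<omega>) (\<lambda>t x. u (T - t) x)" by blast
    have "y t x \<omega> = u (T - t) x" for t x
      unfolding y_def using w limI[OF u(1)] by simp
    then show ?thesis using u by simp
  qed
  have y_m: "(\<lambda>\<omega>. y t x \<omega>) \<in> borel_measurable (?N (T - t))" if t: "t \<in> {0..T}" for t x
  proof -
    \<comment> \<open>The iterates are controlled on \<open>\<Omega>0\<close> only, so measurability
      is shown for the trace \<sigma>-algebra and then extended by zero. At backward time t the
      iterate uses \<eta> on [0, T - t], which is measurable for the filtration at T - t.\<close>
    let ?NR = "restrict_space (?N (T - t)) \<Omega>0"
    have sp0: "space ?NR = \<Omega>0" using Omega0(2) by (auto simp: space_restrict_space spN)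
    have t': "T - t \<in> {0..T}" using t by auto
    have Um: "(\<lambda>\<omega>. ?U n (T - t) x \<omega>) \<in> borel_measurable ?NR" for n
    proof (rule burgers_it_measurable[OF T nu R(1) f _ _ t'])
      show "C0l_b 4 T (\<lambda>t x. \<eta> t x \<omega>)" if "\<omega> \<in> space ?NR" for \<omega> using e that unfolding sp0 .
      show "Cl_b 2 (\<lambda>x. h x \<omega>)" if "\<omega> \<in> space ?NR" for \<omega> using h that unfolding sp0 .
      show "(\<lambda>\<omega>. \<eta> s x \<omega>) \<in> borel_measurable ?NR" if "s \<in> {0..T - t}" for s x
        using that t by (intro measurable_restrict_space1 eta_m) auto
      show "(\<lambda>\<omega>. h x \<omega>) \<in> borel_measurable ?NR" for x
        by (intro measurable_restrict_space1 h_m)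
    qed (use t in auto)
    have "(\<lambda>\<omega>. y t x \<omega>) \<in> borel_measurable ?NR"
    proof (rule borel_measurable_LIMSEQ_metric[OF Um])
      fix \<omega> assume "\<omega> \<in> space ?NR"
      then have "\<omega> \<in> \<Omega>0" unfolding sp0 .
      from sol[OF this, THEN conjunct1, rule_format, of "T - t" x]
      show "(\<lambda>n. ?U n (T - t) x \<omega>) \<longlonglongrightarrow> y t x \<omega>" by simp
    qed
    moreover have "\<Omega>0 \<inter> space (?N (T - t)) \<in> sets (?N (T - t))" using \<Omega>N by (intro sets.Int) auto
    ultimately have "(\<lambda>\<omega>. if \<omega> \<in> \<Omega>0 then y t x \<omega> else 0) \<in> borel_measurable (?N (T - t))"
      by (subst (asm) measurable_restrict_space_iff[where c=0]) auto
    moreover have "(\<lambda>\<omega>. if \<omega> \<in> \<Omega>0 then y t x \<omega> else 0) = (\<lambda>\<omega>. y t x \<omega>)" by (auto simp: y_def)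
    ultimately show ?thesis by simp
  qed
  have ysol: "bw_solution M B F0 \<Omega>0 T \<nu> f \<eta> h y"
    unfolding bw_solution_def using y_m sol by blast
  have "y' t x \<omega> = y t x \<omega>" if y': "bw_solution M B F0 \<Omega>0 T \<nu> f \<eta> h y'" and w: "\<omega> \<in> \<Omega>0" and t: "t \<in> {0..T}" for y' \<omega> t x
  proof -
    have 1: "C0l_b 2 T (\<lambda>t x. y t x \<omega>)" "solves_bw T \<nu> f (\<lambda>t x. \<eta> t x \<omega>) (\<lambda>x. h x \<omega>) (\<lambda>t x. y t x \<omega>)"
      using ysol w by (auto simp: bw_solution_def C12_b_def)
    have 2: "C0l_b 2 T (\<lambda>t x. y' t x \<omega>)" "solves_bw T \<nu> f (\<lambda>t x. \<eta> t x \<omega>) (\<lambda>x. h x \<omega>) (\<lambda>t x. y' t x \<omega>)"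
      using y' w by (auto simp: bw_solution_def C12_b_def)
    show ?thesis by (rule burgers_unique[OF _ f A1_lip e[OF w] 1 2 t]) (use nu in simp)
  qed
  then show ?thesis using ysol by blast
qed

end
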